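(* Let $D$ be a link diagram. The (graded) generalized Khovanov complex $\mathcal FKh(D)$, regarded as a complex of $\mathbb Z_\pi$-modules, decomposes into a direct sum of subcomplexes $$\mathcal FKh(D)\cong\bigoplus_{(a,b)\in\mathbb Z_2\times\mathbb Z}\mathcal FKh(D)_{a,b},$$ where $\mathcal FKh(D)_{a,b}$ is the part of splitting degree $(a,b)$, and each summand is isomorphic to $\mathcal FKh(D;\mathbb Z_\pi)\cong\mathcal F_\pi Kh_\pi(D)$. Under these identifications the action of $\Bbbk$ is given by the isomorphisms $$X:\mathcal FKh(D)_{a,b}\xrightarrow{\ \mathrm{id}\ }\mathcal FKh(D)_{a+1,b},\qquad Y:\mathcal FKh(D)_{a,b}\xrightarrow{\ \cdot\pi\ }\mathcal FKh(D)_{a+1,b},\qquad Z:\mathcal FKh(D)_{a,b}\xrightarrow{\ \mathrm{id}\ }\mathcal FKh(D)_{a,b-1}.$$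
   Context: **Rings.** $\Bbbk=\mathbb Z[X,Y,Z^{\pm1}]/(X^2=Y^2=1)$, graded by $\mathbb Z_2\times\mathbb Z$ via $\mathrm{sdeg}X=\mathrm{sdeg}Y=(1,0)$, $\mathrm{sdeg}Z=(0,-1)$. $\mathbb Z_\pi=\mathbb Z[\pi]/(\pi^2-1)$ is identified with the degree-zero subring $\Bbbk_0$ via $\pi\leftrightarrow XY$ (this gives the $\mathbb Z_\pi$-module structure on $\Bbbk$-modules). $\mathbb Z_\pi$ is also a $\Bbbk$-algebra via $X,Z\mapsto1$, $Y\mapsto\pi$. Put $\lambda(a,b,a',b')=X^{aa'}Y^{bb'}Z^{ab'-a'b}$. **Chronological cobordisms.** A chronological cobordism is a 2-dimensional cobordism $W$ with a Morse function $h:W\to[0,1]$, $h^{-1}(0)$ the input, $h^{-1}(1)$ the output, critical points at distinct levels, and an orientation of the unstable space at each critical point (drawn as an arrow), up to equivalence. Objects are finite ordered families of circles. All are generated, under composition and disjoint union with vertical tubes, by: the merge $\mu:2\to1$ (arrow pointing from the second = right circle to the first = left circle), the split $\Delta:1\to2$ (arrow pointing to the back, i.e. the first output lies to the left of the arrow), the birth $\iota$, the positive death $\epsilon_+$, the negative death $\epsilon_-$, and the twist $P$. Reversing the arrow of $\mu$, $\Delta$ gives $\mu P$, $P\Delta$. $\deg W=(\#\text{births}-\#\text{merges},\#\text{deaths}-\#\text{splits})$. $\Bbbk\mathbf{ChCob}$ is the $\Bbbk$-linear category of these cobordisms modulo: $\mu P=X\mu$; $P\Delta=Y\Delta$; $\epsilon_-=Y\epsilon_+$;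 $\mu(\iota\sqcup\mathrm{id})=\mathrm{id}$; $(\mathrm{id}\sqcup\epsilon_+)\Delta=\mathrm{id}=(\epsilon_-\sqcup\mathrm{id})\Delta$; $\mu(\mu\sqcup\mathrm{id})=X\mu(\mathrm{id}\sqcup\mu)$; $(\Delta\sqcup\mathrm{id})\Delta=Y(\mathrm{id}\sqcup\Delta)\Delta$; $(\mathrm{id}\sqcup\mu)(\Delta\sqcup\mathrm{id})=Z\Delta\mu=(\mu\sqcup\mathrm{id})(\mathrm{id}\sqcup\Delta)$; $(\mathrm{id}\sqcup W)(W'\sqcup\mathrm{id})=\lambda(\deg W,\deg W')(W'\sqcup\mathrm{id})(\mathrm{id}\sqcup W)$. For a ring map $\Bbbk\to R$, $R\mathbf{ChCob}$ is defined likewise with coefficients pushed to $R$. **Splitting degree of cobordisms.** Additive under composition, with $\mathrm{sdeg}\mu=\mathrm{sdeg}\iota=(0,0)$, $\mathrm{sdeg}\Delta=(0,-2)$, $\mathrm{sdeg}P=(1,0)$, $\mathrm{sdeg}\epsilon_+=(0,1)$, $\mathrm{sdeg}\epsilon_-=(1,1)$; placing $k$ tubes to the left and $\ell$ to the right of $W$ with $\deg W=(\alpha,\beta)$ adds $(k\alpha+\ell\beta,(k+\ell)\beta)$. **The complex $Kh(D)$.** Let $D$ have $n$ enumerated crossings, each decorated by an arrow joining the two arcs of its type 0 resolution. At a crossing whose overstrand runs NW–SE, type 0 joins NW–NE and SW–SE, type 1 joins NW–SW and NE–SE. For $\xi\in\{0,1\}^n$, $D_\xi$ is the resolved family of circles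 (ordered arbitrarily). An edge $\zeta:\xi\to\xi'$ of the cube carries the saddle cobordism $D_\zeta$ oriented by the arrow. It is known that there is a cubical 2-cocycle $\psi$ with values in $\Bbbk^*$ with $W_{1\star}W_{\star0}=\psi(S)W_{\star1}W_{0\star}$ on each face $S$; fix it. (It is determined by the chronological relations except on faces where a circle is split and then merged back, where both $1$ and $XY$ satisfy the identity and the value is fixed by a local rule: the circle carries two arrows with alternating endpoints, $a$ inside and $b$ outside, and $\psi(S)$ is $1$ or $XY$ according to whether the first endpoint of $b$ met counterclockwise from the tail of $a$ is a tail or a head.) A sign assignment is a $\Bbbk^*$-valued 1-cochain $\epsilon$ with $\epsilon_{1\star}\epsilon_{\star0}\psi(S)=-\epsilon_{\star1}\epsilon_{0\star}$ on each face. $Kh(D)$ is the complex in the additive closure of $\Bbbk\mathbf{ChCob}$ with $Kh(D)^i=\bigoplus_{|\xi|=i+n_-}D_\xi$ ($n_-$ = number of negative crossings), differential $\sum_\zeta\epsilon(\zeta)D_\zeta$. $Kh_\pi(D)$ is the same construction in $\mathbb Z_\pi\mathbf{ChCob}$ (with coefficients pushed along $\Bbbk\to\mathbb Z_\pi$). **The functor $\mathcal F$.** $\mathcal F$ sends $k$ circles to $A^{\otimes k}$, $A=\Bbbk v_+\oplus\Bbbk v_-$, $\deg v_+=(1,0)$, $\deg v_-=(0,-1)$; it sends $(W\sqcup\mathrm{id})(\mathrm{id}\sqcup W')$ to $\mathcal F(W)\otimes\mathcal F(W')$, where $(f\otimes g)(m\otimes n)=\lambda(\deg g,\deg m)f(m)\otimes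 g(n)$, the twist to $m\otimes n\mapsto\lambda(\deg m,\deg n)n\otimes m$, and: $\mu$: $v_+v_+\mapsto v_+$, $v_+v_-\mapsto v_-$, $v_-v_+\mapsto XZv_-$, $v_-v_-\mapsto0$; $\Delta$: $v_+\mapsto v_-\otimes v_++YZv_+\otimes v_-$, $v_-\mapsto v_-\otimes v_-$; $\iota$: $1\mapsto v_+$; $\epsilon_-$: $v_+\mapsto0$, $v_-\mapsto1$. $\mathcal F_\pi:\mathbb Z_\pi\mathbf{ChCob}\to\mathbf{Mod}_{\mathbb Z_\pi}$ is given by the same formulas with $X=Z=1$, $Y=\pi$. $\mathcal FKh(D;\mathbb Z_\pi)=\mathcal FKh(D)\otimes_\Bbbk\mathbb Z_\pi$. **Grading of $\mathcal FKh(D)$.** A basis element $v_{k}\otimes\cdots\otimes v_{1}$ of $A^{\otimes k}$ ($v_i\in\{v_+,v_-\}$, indices decreasing from left to right) has $\mathrm{sdeg}=(s,s)$, $s=-\sum_{i:\,v_i=v_-}i$ (first entry mod 2). In the summand $\mathcal F(D_\xi)$ of the complex this degree is shifted: $u$ has degree $\mathrm{sdeg}(u)-\mathrm{sdeg}(W_\xi)$, where $W_\xi$ is the composition of corrected edges $\epsilon(\zeta)D_\zeta$ along any path from $(0,\dots,0)$ to $\xi$. With this grading the differential preserves degree. *)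

theory Defs
  imports
    "HOL-Algebra.Algebraic_Closure_Type"
    "HOL-Algebra.Free_Abelian_Groups"
    "HOL-Algebra.Module"
    "HOL-Library.Poly_Mapping"
    "HOL-Library.Product_Plus"
    "HOL-Library.Z2"
begin

section \<open>The ground rings\<close>

text \<open>The ring \<open>\<int>[X, Y, Z\<^sup>\<plusminus>\<^sup>1]/(X\<^sup>2 = Y\<^sup>2 = 1)\<close> as the group ring of \<open>\<int>\<^sub>2 \<times> \<int>\<^sub>2 \<times> \<int>\<close>: the index
  \<open>(a, b, c)\<close> stands for the monomial \<open>X\<^sup>a Y\<^sup>b Z\<^sup>c\<close>.  Likewise \<open>\<int>[\<pi>]/(\<pi>\<^sup>2 - 1)\<close> is the group ring
  of \<open>\<int>\<^sub>2\<close>.\<close>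

type_synonym kring = "(bit \<times> bit \<times> int) \<Rightarrow>\<^sub>0 int"
type_synonym zpi = "bit \<Rightarrow>\<^sub>0 int"

definition Xk :: kring where "Xk = Poly_Mapping.single (1, 0, 0) 1"
definition Yk :: kring where "Yk = Poly_Mapping.single (0, 1, 0) 1"
definition Zk :: kring where "Zk = Poly_Mapping.single (0, 0, 1) 1"
definition pi_elt :: zpi where "pi_elt = Poly_Mapping.single 1 1"

text \<open>The inclusion \<open>\<pi> \<mapsto> XY\<close> onto the subring of degree zero, and the algebra structure
  \<open>X, Z \<mapsto> 1\<close>, \<open>Y \<mapsto> \<pi>\<close>.\<close>

definition zpi_to_k :: "zpi \<Rightarrow> kring" where
  "zpi_to_k q = (\<Sum>e\<in>Poly_Mapping.keys q. Poly_Mapping.single (e, e, 0) (Poly_Mapping.lookup q e))"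

definition k_to_zpi :: "kring \<Rightarrow> zpi" where
  "k_to_zpi p =
     (\<Sum>(a, b, c)\<in>Poly_Mapping.keys p. Poly_Mapping.single b (Poly_Mapping.lookup p (a, b, c)))"

type_synonym sdegree = "bit \<times> int"

fun mono_sdeg :: "bit \<times> bit \<times> int \<Rightarrow> sdegree" where
  "mono_sdeg (a, b, c) = (a + b, - c)"

definition k_homogeneous :: "sdegree \<Rightarrow> kring \<Rightarrow> bool" where
  "k_homogeneous d r \<longleftrightarrow> (\<forall>k\<in>Poly_Mapping.keys r. mono_sdeg k = d)"

fun lam :: "int \<times> int \<Rightarrow> int \<times> int \<Rightarrow> kring" where
  "lam (a, b) (a', b') =
     Poly_Mapping.single (of_int (a * a'), of_int (b * b'), a * b' - a' * b) 1"

section \<open>Linear algebra on finitely supported functions\<close>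

definition scale :: "'r::comm_ring_1 \<Rightarrow> ('b \<Rightarrow>\<^sub>0 'r) \<Rightarrow> ('b \<Rightarrow>\<^sub>0 'r)" where
  "scale r u = Poly_Mapping.map (\<lambda>x. r * x) u"

definition lin_ext :: "('b \<Rightarrow> ('c \<Rightarrow>\<^sub>0 'r)) \<Rightarrow> ('b \<Rightarrow>\<^sub>0 'r) \<Rightarrow> ('c \<Rightarrow>\<^sub>0 'r::comm_ring_1)" where
  "lin_ext f u = (\<Sum>x\<in>Poly_Mapping.keys u. scale (Poly_Mapping.lookup u x) (f x))"

section \<open>Chronological cobordisms\<close>

text \<open>A cobordism is a word in layers, the first layer of the list being the bottom one.  The layer
  \<open>(k, g, l)\<close> is the generator \<open>g\<close> with \<open>k\<close> vertical tubes to its left and \<open>l\<close> to its right.\<close>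

datatype gen = Merge | Split | Birth | DeathP | DeathN | Twist

fun gin :: "gen \<Rightarrow> nat" where
  "gin Merge = 2" | "gin Split = 1" | "gin Birth = 0" | "gin DeathP = 1" | "gin DeathN = 1"
| "gin Twist = 2"

fun gout :: "gen \<Rightarrow> nat" where
  "gout Merge = 1" | "gout Split = 2" | "gout Birth = 1" | "gout DeathP = 0" | "gout DeathN = 0"
| "gout Twist = 2"

fun gdeg :: "gen \<Rightarrow> int \<times> int" where
  "gdeg Merge = (-1, 0)" | "gdeg Split = (0, -1)" | "gdeg Birth = (1, 0)"
| "gdeg DeathP = (0, 1)" | "gdeg DeathN = (0, 1)" | "gdeg Twist = (0, 0)"

type_synonym layer = "nat \<times> gen \<times> nat"
type_synonym word = "layer list"

text \<open>\<open>cob m w n\<close>: the word \<open>w\<close> is a cobordism from \<open>m\<close> circles to \<open>n\<close> circles.\<close>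

fun cob :: "nat \<Rightarrow> word \<Rightarrow> nat \<Rightarrow> bool" where
  "cob m [] n \<longleftrightarrow> m = n"
| "cob m ((k, g, l) # w) n \<longleftrightarrow> m = k + gin g + l \<and> cob (k + gout g + l) w n"

definition tubes :: "nat \<Rightarrow> nat \<Rightarrow> word \<Rightarrow> word" where
  "tubes k l w = map (\<lambda>(i, g, j). (k + i, g, j + l)) w"

definition wdeg :: "word \<Rightarrow> int \<times> int" where
  "wdeg w = (\<Sum>(k, g, l)\<leftarrow>w. gdeg g)"

fun gen_sdeg :: "gen \<Rightarrow> sdegree" where
  "gen_sdeg Merge = (0, 0)" | "gen_sdeg Split = (0, -2)" | "gen_sdeg Birth = (0, 0)"
| "gen_sdeg DeathP = (0, 1)" | "gen_sdeg DeathN = (1, 1)" | "gen_sdeg Twist = (1, 0)"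

fun layer_sdeg :: "layer \<Rightarrow> sdegree" where
  "layer_sdeg (k, g, l) = gen_sdeg g +
     (of_int (int k * fst (gdeg g) + int l * snd (gdeg g)), (int k + int l) * snd (gdeg g))"

definition wsdeg :: "word \<Rightarrow> sdegree" where
  "wsdeg w = sum_list (map layer_sdeg w)"

text \<open>Among \<open>N\<close> circles, move the one at position \<open>j\<close> to the front by twists.\<close>

definition bring :: "nat \<Rightarrow> nat \<Rightarrow> word" where
  "bring N j = map (\<lambda>i. (i, Twist, N - i - 2)) (rev [0..<j])"

text \<open>\<open>chcob_rel p w r w' q\<close>: the defining relation \<open>w = r w'\<close> between cobordisms from \<open>p\<close> to \<open>q\<close>
  circles.  The first two rules say which words represent equivalent cobordisms: circles are
  permuted by the twists according to the symmetric group, and every generator can be moved past a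
  vertical tube crossing it; for the twist itself this is the braid relation.\<close>

inductive chcob_rel :: "nat \<Rightarrow> word \<Rightarrow> kring \<Rightarrow> word \<Rightarrow> nat \<Rightarrow> bool" where
  twist_twist: "chcob_rel 2 [(0, Twist, 0), (0, Twist, 0)] 1 [] 2"
| twist_natural: "chcob_rel (gin g + 1) ((0, g, 1) # bring (gout g + 1) (gout g)) 1
     (bring (gin g + 1) (gin g) @ [(1, g, 0)]) (gout g + 1)"
| merge_twist: "chcob_rel 2 [(0, Twist, 0), (0, Merge, 0)] Xk [(0, Merge, 0)] 1"
| split_twist: "chcob_rel 1 [(0, Split, 0), (0, Twist, 0)] Yk [(0, Split, 0)] 2"
| death: "chcob_rel 1 [(0, DeathN, 0)] Yk [(0, DeathP, 0)] 0"
| birth_merge: "chcob_rel 1 [(0, Birth, 1), (0, Merge, 0)] 1 [] 1"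
| split_death_pos: "chcob_rel 1 [(0, Split, 0), (1, DeathP, 0)] 1 [] 1"
| split_death_neg: "chcob_rel 1 [(0, Split, 0), (0, DeathN, 1)] 1 [] 1"
| merge_assoc: "chcob_rel 3 [(0, Merge, 1), (0, Merge, 0)] Xk [(1, Merge, 0), (0, Merge, 0)] 1"
| split_assoc: "chcob_rel 1 [(0, Split, 0), (0, Split, 1)] Yk [(0, Split, 0), (1, Split, 0)] 3"
| frobenius_left: "chcob_rel 2 [(0, Split, 1), (1, Merge, 0)] Zk [(0, Merge, 0), (0, Split, 0)] 2"
| frobenius_right: "chcob_rel 2 [(1, Split, 0), (0, Merge, 1)] Zk [(0, Merge, 0), (0, Split, 0)] 2"
| disjoint: "cob p w q \<Longrightarrow> cob p' w' q' \<Longrightarrow>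
     chcob_rel (p' + p) (tubes 0 p w' @ tubes q' 0 w) (lam (wdeg w) (wdeg w'))
       (tubes p' 0 w @ tubes 0 q w') (q' + q)"

text \<open>Coefficients are pushed along a ring map \<open>h\<close>.  The morphisms from \<open>m\<close> to \<open>n\<close> circles are the
  formal combinations of words from \<open>m\<close> to \<open>n\<close>, modulo the submodule spanned by all composites of
  the relations.\<close>

inductive_set chcob_null :: "(kring \<Rightarrow> 'r) \<Rightarrow> nat \<Rightarrow> nat \<Rightarrow> (word \<Rightarrow>\<^sub>0 'r::comm_ring_1) set"
  for h m n where
  zero: "0 \<in> chcob_null h m n"
| rel: "chcob_rel p w r w' q \<Longrightarrow> cob m u (k + p + l) \<Longrightarrow> cob (k + q + l) v n \<Longrightarrow>
     Poly_Mapping.single (u @ tubes k l w @ v) 1 - Poly_Mapping.single (u @ tubes k l w' @ v) (h r)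
       \<in> chcob_null h m n"
| add: "f \<in> chcob_null h m n \<Longrightarrow> g \<in> chcob_null h m n \<Longrightarrow> f + g \<in> chcob_null h m n"
| scale: "f \<in> chcob_null h m n \<Longrightarrow> scale r f \<in> chcob_null h m n"

definition chcob_class ::
  "(kring \<Rightarrow> 'r) \<Rightarrow> nat \<Rightarrow> nat \<Rightarrow> (word \<Rightarrow>\<^sub>0 'r) \<Rightarrow> (word \<Rightarrow>\<^sub>0 'r::comm_ring_1) set" where
  "chcob_class h m n f =
     {g. (\<forall>w\<in>Poly_Mapping.keys g. cob m w n) \<and> g - f \<in> chcob_null h m n}"

section \<open>The functor\<close>

text \<open>The \<open>k\<close>-fold tensor power of the free module on \<open>v\<^sub>+\<close>, \<open>v\<^sub>-\<close> is the free module on the lists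
  of length \<open>k\<close>, where \<open>[x, \<dots>, y]\<close> stands for \<open>x \<otimes> \<dots> \<otimes> y\<close>.\<close>

datatype sgn = Vp | Vm

definition vdeg :: "sgn list \<Rightarrow> int \<times> int" where
  "vdeg xs = (int (count_list xs Vp), - int (count_list xs Vm))"

fun F_gen :: "(kring \<Rightarrow> 'r) \<Rightarrow> gen \<Rightarrow> sgn list \<Rightarrow> (sgn list \<Rightarrow>\<^sub>0 'r::comm_ring_1)" where
  "F_gen h Merge [Vp, Vp] = Poly_Mapping.single [Vp] 1"
| "F_gen h Merge [Vp, Vm] = Poly_Mapping.single [Vm] 1"
| "F_gen h Merge [Vm, Vp] = Poly_Mapping.single [Vm] (h (Xk * Zk))"
| "F_gen h Merge [Vm, Vm] = 0"
| "F_gen h Split [Vp] =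
     Poly_Mapping.single [Vm, Vp] 1 + Poly_Mapping.single [Vp, Vm] (h (Yk * Zk))"
| "F_gen h Split [Vm] = Poly_Mapping.single [Vm, Vm] 1"
| "F_gen h Birth [] = Poly_Mapping.single [Vp] 1"
| "F_gen h DeathN [Vp] = 0"
| "F_gen h DeathN [Vm] = Poly_Mapping.single [] 1"
| "F_gen h DeathP [Vp] = 0"
| "F_gen h DeathP [Vm] = Poly_Mapping.single [] (h Yk)"
| "F_gen h Twist [a, b] = Poly_Mapping.single [b, a] (h (lam (vdeg [a]) (vdeg [b])))"
| "F_gen h _ _ = 0"

text \<open>\<open>(f \<otimes> g)(m \<otimes> n) = \<lambda>(deg g, deg m) f(m) \<otimes> g(n)\<close>.\<close>

fun F_layer :: "(kring \<Rightarrow> 'r) \<Rightarrow> layer \<Rightarrow> sgn list \<Rightarrow> (sgn list \<Rightarrow>\<^sub>0 'r::comm_ring_1)" where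
  "F_layer h (k, g, l) xs =
     scale (h (lam (gdeg g) (vdeg (take k xs))))
       (lin_ext (\<lambda>ys. Poly_Mapping.single (take k xs @ ys @ drop (k + gin g) xs) 1)
         (F_gen h g (take (gin g) (drop k xs))))"

fun F_word :: "(kring \<Rightarrow> 'r) \<Rightarrow> word \<Rightarrow> sgn list \<Rightarrow> (sgn list \<Rightarrow>\<^sub>0 'r::comm_ring_1)" where
  "F_word h [] xs = Poly_Mapping.single xs 1"
| "F_word h (L # w) xs = lin_ext (F_word h w) (F_layer h L xs)"

definition F_comb :: "(kring \<Rightarrow> 'r) \<Rightarrow> (word \<Rightarrow>\<^sub>0 'r) \<Rightarrow> sgn list \<Rightarrow> (sgn list \<Rightarrow>\<^sub>0 'r::comm_ring_1)" where
  "F_comb h f xs = lin_ext (\<lambda>w. F_word h w xs) f"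

text \<open>The value on a morphism, that is, the common value on all its representatives.\<close>

definition F_mor ::
  "(kring \<Rightarrow> 'r) \<Rightarrow> (word \<Rightarrow>\<^sub>0 'r) set \<Rightarrow> sgn list \<Rightarrow> (sgn list \<Rightarrow>\<^sub>0 'r::comm_ring_1)" where
  "F_mor h c xs = the_elem ((\<lambda>f. F_comb h f xs) ` c)"

definition basis_sdeg :: "sgn list \<Rightarrow> sdegree" where
  "basis_sdeg xs =
     (let s = - (\<Sum>j<length xs. if xs ! j = Vm then int (length xs - j) else 0) in (of_int s, s))"

section \<open>Complexes of modules\<close>

record ('r, 'm) cplx =
  grp :: "int \<Rightarrow> ('r, 'm) module"
  diff :: "int \<Rightarrow> 'm \<Rightarrow> 'm"

definition lin_map ::
  "'r ring \<Rightarrow> ('r, 'm) module \<Rightarrow> ('r, 'n) module \<Rightarrow> ('m \<Rightarrow> 'n) \<Rightarrow> bool" where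
  "lin_map R M N f \<longleftrightarrow> f \<in> carrier M \<rightarrow> carrier N \<and>
     (\<forall>x\<in>carrier M. \<forall>y\<in>carrier M. f (x \<oplus>\<^bsub>M\<^esub> y) = f x \<oplus>\<^bsub>N\<^esub> f y) \<and>
     (\<forall>r\<in>carrier R. \<forall>x\<in>carrier M. f (r \<odot>\<^bsub>M\<^esub> x) = r \<odot>\<^bsub>N\<^esub> f x)"

definition chain_complex :: "'r ring \<Rightarrow> ('r, 'm) cplx \<Rightarrow> bool" where
  "chain_complex R C \<longleftrightarrow>
     (\<forall>i. module R (grp C i)) \<and>
     (\<forall>i. lin_map R (grp C i) (grp C (i + 1)) (diff C i)) \<and>
     (\<forall>i. \<forall>x\<in>carrier (grp C i). diff C (i + 1) (diff C i x) = \<zero>\<^bsub>grp C (i + 2)\<^esub>)"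

definition chain_iso ::
  "'r ring \<Rightarrow> ('r, 'm) cplx \<Rightarrow> ('r, 'n) cplx \<Rightarrow> (int \<Rightarrow> 'm \<Rightarrow> 'n) \<Rightarrow> bool" where
  "chain_iso R C C' f \<longleftrightarrow> chain_complex R C \<and> chain_complex R C' \<and>
     (\<forall>i. lin_map R (grp C i) (grp C' i) (f i)) \<and>
     (\<forall>i. bij_betw (f i) (carrier (grp C i)) (carrier (grp C' i))) \<and>
     (\<forall>i. \<forall>x\<in>carrier (grp C i). f (i + 1) (diff C i x) = diff C' i (f i x))"

definition restrict_cplx :: "('r, 'm) cplx \<Rightarrow> (int \<Rightarrow> 'm set) \<Rightarrow> ('r, 'm) cplx" where
  "restrict_cplx C H = C\<lparr>grp := \<lambda>i. (grp C i)\<lparr>carrier := H i\<rparr>\<rparr>"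

definition subcomplex :: "'r ring \<Rightarrow> ('r, 'm) cplx \<Rightarrow> (int \<Rightarrow> 'm set) \<Rightarrow> bool" where
  "subcomplex R C H \<longleftrightarrow>
     (\<forall>i. submodule (H i) R (grp C i)) \<and> (\<forall>i. diff C i \<in> H i \<rightarrow> H (i + 1))"

definition scalars_module :: "('s \<Rightarrow> 'r) \<Rightarrow> ('r, 'm) module \<Rightarrow> ('s, 'm) module" where
  "scalars_module h M = \<lparr>carrier = carrier M, monoid.mult = monoid.mult M, one = one M,
     ring.zero = ring.zero M, add = add M, module.smult = (\<lambda>s x. h s \<odot>\<^bsub>M\<^esub> x)\<rparr>"

definition scalars_cplx :: "('s \<Rightarrow> 'r) \<Rightarrow> ('r, 'm) cplx \<Rightarrow> ('s, 'm) cplx" where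
  "scalars_cplx h C = \<lparr>grp = (\<lambda>i. scalars_module h (grp C i)), diff = diff C\<rparr>"

text \<open>External direct sum over all elements of the index type.\<close>

definition dsum_module :: "('a \<Rightarrow> ('r, 'm) module) \<Rightarrow> ('r, 'a \<Rightarrow> 'm) module" where
  "dsum_module M = \<lparr>carrier = {f. (\<forall>a. f a \<in> carrier (M a)) \<and> finite {a. f a \<noteq> \<zero>\<^bsub>M a\<^esub>}},
     monoid.mult = undefined, one = undefined, ring.zero = (\<lambda>a. \<zero>\<^bsub>M a\<^esub>),
     add = (\<lambda>f g a. f a \<oplus>\<^bsub>M a\<^esub> g a), module.smult = (\<lambda>r f a. r \<odot>\<^bsub>M a\<^esub> f a)\<rparr>"

definition dsum_cplx :: "('a \<Rightarrow> ('r, 'm) cplx) \<Rightarrow> ('r, 'a \<Rightarrow> 'm) cplx" where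
  "dsum_cplx C =
     \<lparr>grp = (\<lambda>i. dsum_module (\<lambda>a. grp (C a) i)), diff = (\<lambda>i f a. diff (C a) i (f a))\<rparr>"

definition sum_map :: "('r, 'm) cplx \<Rightarrow> int \<Rightarrow> ('a \<Rightarrow> 'm) \<Rightarrow> 'm" where
  "sum_map C i f = (\<Oplus>\<^bsub>grp C i\<^esub>a\<in>{a. f a \<noteq> \<zero>\<^bsub>grp C i\<^esub>}. f a)"

text \<open>Base change \<open>M \<otimes> S\<close> along a ring map \<open>h\<close> into \<open>S\<close>: the free abelian group on \<open>M \<times> S\<close> modulo
  the relations of a balanced biadditive map.\<close>

definition tensor_free ::
  "('k, 'm) module \<Rightarrow> ('m \<times> 's \<Rightarrow>\<^sub>0 int) monoid" where
  "tensor_free M = free_Abelian_group (carrier M \<times> UNIV)"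

definition tensor_null ::
  "('k \<Rightarrow> 's::comm_ring_1) \<Rightarrow> ('k, 'm) module \<Rightarrow> ('m \<times> 's \<Rightarrow>\<^sub>0 int) set" where
  "tensor_null h M = generate (tensor_free M)
     ({frag_of (x \<oplus>\<^bsub>M\<^esub> y, s) - frag_of (x, s) - frag_of (y, s) | x y s.
         x \<in> carrier M \<and> y \<in> carrier M} \<union>
      {frag_of (x, s + t) - frag_of (x, s) - frag_of (x, t) | x s t. x \<in> carrier M} \<union>
      {frag_of (r \<odot>\<^bsub>M\<^esub> x, s) - frag_of (x, h r * s) | r x s. x \<in> carrier M})"

definition tensor_module ::
  "('k \<Rightarrow> 's) \<Rightarrow> ('k, 'm) module \<Rightarrow> ('s::comm_ring_1, ('m \<times> 's \<Rightarrow>\<^sub>0 int) set) module" where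
  "tensor_module h M =
     (let Q = tensor_free M Mod tensor_null h M in
      \<lparr>carrier = carrier Q, monoid.mult = undefined, one = undefined, ring.zero = one Q,
       add = monoid.mult Q, module.smult = (\<lambda>t c. \<Union>x\<in>c. tensor_null h M #>\<^bsub>tensor_free M\<^esub>
                 frag_extend (\<lambda>(m, s). frag_of (m, t * s)) x)\<rparr>)"

definition tensor_cplx ::
  "('k \<Rightarrow> 's) \<Rightarrow> ('k, 'm) cplx \<Rightarrow> ('s::comm_ring_1, ('m \<times> 's \<Rightarrow>\<^sub>0 int) set) cplx" where
  "tensor_cplx h C =
     \<lparr>grp = (\<lambda>i. tensor_module h (grp C i)),
      diff = (\<lambda>i c. \<Union>x\<in>c. tensor_null h (grp C (i + 1)) #>\<^bsub>tensor_free (grp C (i + 1))\<^esub>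
                 frag_extend (\<lambda>(m, s). frag_of (diff C i m, s)) x)\<rparr>"

section \<open>Complexes in the additive closure, and their images under the functor\<close>

text \<open>The object in degree \<open>i\<close> is the direct sum of \<open>circs v\<close> circles over \<open>v \<in> verts i\<close>; the
  differential is the matrix \<open>entry\<close>.\<close>

record (overloaded) ('v, 'r) cob_cplx =
  verts :: "int \<Rightarrow> 'v set"
  circs :: "'v \<Rightarrow> nat"
  entry :: "'v \<Rightarrow> 'v \<Rightarrow> (word \<Rightarrow>\<^sub>0 'r) set"

definition free_module :: "'b set \<Rightarrow> ('r::comm_ring_1, 'b \<Rightarrow>\<^sub>0 'r) module" where
  "free_module B = \<lparr>carrier = {u. Poly_Mapping.keys u \<subseteq> B}, monoid.mult = undefined, one = undefined,
     ring.zero = 0, add = (+), module.smult = scale\<rparr>"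

definition F_cplx ::
  "(kring \<Rightarrow> 'r) \<Rightarrow> ('v, 'r) cob_cplx \<Rightarrow> ('r, 'v \<times> sgn list \<Rightarrow>\<^sub>0 'r::comm_ring_1) cplx" where
  "F_cplx h K =
     \<lparr>grp = (\<lambda>i. free_module {(v, xs). v \<in> verts K i \<and> length xs = circs K v}),
      diff = (\<lambda>i. lin_ext (\<lambda>(v, xs). \<Sum>v'\<in>verts K (i + 1).
                lin_ext (\<lambda>ys. Poly_Mapping.single (v', ys) 1) (F_mor h (entry K v v') xs)))\<rparr>"

section \<open>Link diagrams\<close>

text \<open>A diagram is recorded as an oriented planar map.  Draw each crossing with its overstrand from
  NW to SE; then \<open>(c, 0)\<close>, \<open>(c, 1)\<close>, \<open>(c, 2)\<close>, \<open>(c, 3)\<close> are the ends at crossing \<open>c\<close> in the directions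
  NW, SW, SE, NE, in counterclockwise order.  \<open>arc\<close> maps an end to the other end of its arc;
  \<open>outgoing\<close> are the ends at which the strand leaves the crossing; \<open>arrow_down c\<close> means that the
  arrow at \<open>c\<close> points from the NW-NE arc of the type 0 resolution to its SW-SE arc; \<open>loops\<close> is the
  number of components without crossings.\<close>

type_synonym dart = "nat \<times> nat"

record diagram =
  crossings :: nat
  arc :: "dart \<Rightarrow> dart"
  outgoing :: "dart \<Rightarrow> bool"
  arrow_down :: "nat \<Rightarrow> bool"
  loops :: nat

definition darts :: "diagram \<Rightarrow> dart set" where
  "darts D = {..<crossings D} \<times> {..<4}"

definition rot :: "dart \<Rightarrow> dart" where
  "rot d = (fst d, (snd d + 1) mod 4)"

definition orbit_of :: "diagram \<Rightarrow> (dart \<Rightarrow> dart) set \<Rightarrow> dart \<Rightarrow> dart set" where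
  "orbit_of D fs d = {(x, f x) | x f. x \<in> darts D \<and> f \<in> fs}\<^sup>* `` {d}"

text \<open>The last condition is Euler's formula \<open>V - E + F = 2C\<close> for a map with \<open>C\<close> components, where
  \<open>E = 2V\<close>.\<close>

definition link_diagram :: "diagram \<Rightarrow> bool" where
  "link_diagram D \<longleftrightarrow>
     (\<forall>d\<in>darts D. arc D d \<in> darts D \<and> arc D d \<noteq> d \<and> arc D (arc D d) = d) \<and>
     (\<forall>d\<in>darts D. outgoing D (arc D d) \<noteq> outgoing D d \<and>
        outgoing D (rot (rot d)) \<noteq> outgoing D d) \<and>
     card (orbit_of D {rot \<circ> arc D} ` darts D)
       = crossings D + 2 * card (orbit_of D {rot, arc D} ` darts D)"

definition negative_crossing :: "diagram \<Rightarrow> nat \<Rightarrow> bool" where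
  "negative_crossing D c \<longleftrightarrow> outgoing D (c, 2) \<noteq> outgoing D (c, 3)"

definition n_minus :: "diagram \<Rightarrow> nat" where
  "n_minus D = card {c. c < crossings D \<and> negative_crossing D c}"

section \<open>The cube of resolutions\<close>

text \<open>A vertex of the cube is the set of crossings resolved by type 1.\<close>

definition vertices :: "diagram \<Rightarrow> nat set set" where
  "vertices D = Pow {..<crossings D}"

definition smooth :: "nat set \<Rightarrow> dart \<Rightarrow> dart" where
  "smooth \<xi> d = (fst d, if fst d \<in> \<xi> then [1, 0, 3, 2] ! snd d else [3, 2, 1, 0] ! snd d)"

type_synonym circle = "dart set + nat"

definition circ :: "diagram \<Rightarrow> nat set \<Rightarrow> dart \<Rightarrow> circle" where
  "circ D \<xi> d = Inl (orbit_of D {arc D, smooth \<xi>} d)"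

definition circles :: "diagram \<Rightarrow> nat set \<Rightarrow> circle set" where
  "circles D \<xi> = circ D \<xi> ` darts D \<union> Inr ` {..<loops D}"

definition circle_order :: "diagram \<Rightarrow> (nat set \<Rightarrow> circle list) \<Rightarrow> bool" where
  "circle_order D ord \<longleftrightarrow> (\<forall>\<xi>\<in>vertices D. distinct (ord \<xi>) \<and> set (ord \<xi>) = circles D \<xi>)"

definition edge :: "diagram \<Rightarrow> nat set \<Rightarrow> nat \<Rightarrow> bool" where
  "edge D \<xi> c \<longleftrightarrow> \<xi> \<in> vertices D \<and> c < crossings D \<and> c \<notin> \<xi>"

definition face :: "diagram \<Rightarrow> nat set \<Rightarrow> nat \<Rightarrow> nat \<Rightarrow> bool" where
  "face D \<xi> c c' \<longleftrightarrow> edge D \<xi> c \<and> edge D \<xi> c' \<and> c < c'"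

text \<open>The permutation taking the sequence of circles \<open>xs\<close> to the sequence \<open>ys\<close>.\<close>

fun perm_word :: "'a list \<Rightarrow> 'a list \<Rightarrow> word" where
  "perm_word xs [] = []"
| "perm_word xs (y # ys) =
     bring (length xs) (length (takeWhile (\<lambda>x. x \<noteq> y) xs)) @ tubes 1 0 (perm_word (remove1 y xs) ys)"

text \<open>The saddle cobordism of the edge changing crossing \<open>c\<close>.  For a merge, the circle at the head
  of the arrow is the first input and the circle at the tail the second one.  For a split, the first
  output is the circle to the left of the arrow: the one containing the NE-SE arc if the arrow points
  down, and the one containing the NW-SW arc otherwise.  In a planar diagram a saddle always changes
  the number of circles; the last branch only makes the function total.\<close>

definition saddle :: "diagram \<Rightarrow> (nat set \<Rightarrow> circle list) \<Rightarrow> nat set \<Rightarrow> nat \<Rightarrow> word" where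
  "saddle D ord \<xi> c =
     (let \<xi>' = insert c \<xi>;
          upper = circ D \<xi> (c, 0); lower = circ D \<xi> (c, 1);
          left = circ D \<xi>' (c, 0); right = circ D \<xi>' (c, 3);
          rest = filter (\<lambda>z. z \<noteq> upper \<and> z \<noteq> lower) (ord \<xi>)
      in if upper \<noteq> lower
         then perm_word (ord \<xi>)
                ((if arrow_down D c then [lower, upper] else [upper, lower]) @ rest)
              @ [(0, Merge, length rest)] @ perm_word (left # rest) (ord \<xi>')
         else if left \<noteq> right
         then perm_word (ord \<xi>) (upper # rest) @ [(0, Split, length rest)]
              @ perm_word ((if arrow_down D c then [right, left] else [left, right]) @ rest) (ord \<xi>')
         else [])"

text \<open>Walk from the tail of the arrow at \<open>a\<close> along its circle in \<open>D\<^sub>\<xi>\<close>, with the arrow at \<open>a\<close> on the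
  left, i.e.\ counterclockwise if that arrow lies inside the circle.  If the two arrows alternate,
  exchanging their roles does not change whether a tail is met first, so that \<open>a\<close> may be taken to be
  either of them.\<close>

definition tail_met_first :: "diagram \<Rightarrow> nat set \<Rightarrow> nat \<Rightarrow> nat \<Rightarrow> bool" where
  "tail_met_first D \<xi> a b =
     (let start = (a, if arrow_down D a then 0 else 2);
          arrivals = (\<lambda>j. arc D (((\<lambda>d. smooth \<xi> (arc D d)) ^^ j) start));
          p = snd (arrivals (LEAST j. fst (arrivals j) = b))
      in if arrow_down D b then p \<in> {0, 3} else p \<in> {1, 2})"

text \<open>Faces on which a circle is split and then merged back.\<close>

definition split_merge_face :: "diagram \<Rightarrow> nat set \<Rightarrow> nat \<Rightarrow> nat \<Rightarrow> bool" where
  "split_merge_face D \<xi> c c' \<longleftrightarrow> face D \<xi> c c' \<and>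
     circ D \<xi> (c, 0) = circ D \<xi> (c, 1) \<and> circ D \<xi> (c', 0) = circ D \<xi> (c', 1) \<and>
     circ D (insert c \<xi>) (c', 0) \<noteq> circ D (insert c \<xi>) (c', 1)"

text \<open>\<open>\<psi> \<xi> c c'\<close> is the value on the face at \<open>\<xi>\<close> in the directions \<open>c < c'\<close>, \<open>\<epsilon> \<xi> c\<close> the value on
  the edge at \<open>\<xi>\<close> in the direction \<open>c\<close>.\<close>

definition commutation_cocycle ::
  "diagram \<Rightarrow> (nat set \<Rightarrow> circle list) \<Rightarrow> (nat set \<Rightarrow> nat \<Rightarrow> nat \<Rightarrow> kring) \<Rightarrow> bool" where
  "commutation_cocycle D ord \<psi> \<longleftrightarrow>
     (\<forall>\<xi> c c'. face D \<xi> c c' \<longrightarrow> \<psi> \<xi> c c' dvd 1) \<and>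
     (\<forall>\<xi> a b c. face D \<xi> a b \<and> face D \<xi> b c \<longrightarrow>
        \<psi> (insert a \<xi>) b c * \<psi> \<xi> a c * \<psi> (insert c \<xi>) a b
          = \<psi> \<xi> b c * \<psi> (insert b \<xi>) a c * \<psi> \<xi> a b) \<and>
     (\<forall>\<xi> c c'. face D \<xi> c c' \<longrightarrow>
        (let cls = chcob_class id (length (ord \<xi>)) (length (ord (insert c (insert c' \<xi>)))) in
         cls (Poly_Mapping.single (saddle D ord \<xi> c @ saddle D ord (insert c \<xi>) c') 1)
         = cls (Poly_Mapping.single (saddle D ord \<xi> c' @ saddle D ord (insert c' \<xi>) c) (\<psi> \<xi> c c')))) \<and>
     (\<forall>\<xi> c c'. split_merge_face D \<xi> c c' \<longrightarrow>
        \<psi> \<xi> c c' = (if tail_met_first D \<xi> c c' then 1 else Xk * Yk))"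

definition sign_assignment ::
  "diagram \<Rightarrow> (nat set \<Rightarrow> nat \<Rightarrow> nat \<Rightarrow> kring) \<Rightarrow> (nat set \<Rightarrow> nat \<Rightarrow> kring) \<Rightarrow> bool" where
  "sign_assignment D \<psi> \<epsilon> \<longleftrightarrow>
     (\<forall>\<xi> c. edge D \<xi> c \<longrightarrow> \<epsilon> \<xi> c dvd 1) \<and>
     (\<forall>\<xi> c c'. face D \<xi> c c' \<longrightarrow>
        \<epsilon> (insert c \<xi>) c' * \<epsilon> \<xi> c * \<psi> \<xi> c c' = - (\<epsilon> (insert c' \<xi>) c * \<epsilon> \<xi> c'))"

section \<open>The generalized Khovanov complex\<close>

definition Kh :: "(kring \<Rightarrow> 'r) \<Rightarrow> diagram \<Rightarrow> (nat set \<Rightarrow> circle list) \<Rightarrow> (nat set \<Rightarrow> nat \<Rightarrow> kring) \<Rightarrow>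
    (nat set, 'r::comm_ring_1) cob_cplx" where
  "Kh h D ord \<epsilon> =
     \<lparr>verts = (\<lambda>i. {\<xi>\<in>vertices D. int (card \<xi>) = i + int (n_minus D)}),
      circs = (\<lambda>\<xi>. length (ord \<xi>)),
      entry = (\<lambda>\<xi> \<xi>'. chcob_class h (length (ord \<xi>)) (length (ord \<xi>'))
        (\<Sum>c | edge D \<xi> c \<and> \<xi>' = insert c \<xi>. Poly_Mapping.single (saddle D ord \<xi> c) (h (\<epsilon> \<xi> c))))\<rparr>"

type_synonym 'r kh_chain = "nat set \<times> sgn list \<Rightarrow>\<^sub>0 'r"

definition FKh :: "diagram \<Rightarrow> (nat set \<Rightarrow> circle list) \<Rightarrow> (nat set \<Rightarrow> nat \<Rightarrow> kring) \<Rightarrow>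
    (kring, kring kh_chain) cplx" where
  "FKh D ord \<epsilon> = F_cplx id (Kh id D ord \<epsilon>)"

definition F_pi_Kh_pi :: "diagram \<Rightarrow> (nat set \<Rightarrow> circle list) \<Rightarrow> (nat set \<Rightarrow> nat \<Rightarrow> kring) \<Rightarrow>
    (zpi, zpi kh_chain) cplx" where
  "F_pi_Kh_pi D ord \<epsilon> = F_cplx k_to_zpi (Kh k_to_zpi D ord \<epsilon>)"

text \<open>\<open>path_sdeg D ord \<epsilon> \<xi> d\<close>: the composition of the corrected edges along some path from
  \<open>(0, \<dots>, 0)\<close> to \<open>\<xi>\<close> has splitting degree \<open>d\<close>.\<close>

inductive path_sdeg :: "diagram \<Rightarrow> (nat set \<Rightarrow> circle list) \<Rightarrow> (nat set \<Rightarrow> nat \<Rightarrow> kring) \<Rightarrow>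
    nat set \<Rightarrow> sdegree \<Rightarrow> bool"
  for D ord \<epsilon> where
  start: "path_sdeg D ord \<epsilon> {} 0"
| step: "path_sdeg D ord \<epsilon> \<xi> d \<Longrightarrow> edge D \<xi> c \<Longrightarrow> k_homogeneous e (\<epsilon> \<xi> c) \<Longrightarrow>
     path_sdeg D ord \<epsilon> (insert c \<xi>) (d + (e + wsdeg (saddle D ord \<xi> c)))"

definition vertex_sdeg :: "diagram \<Rightarrow> (nat set \<Rightarrow> circle list) \<Rightarrow> (nat set \<Rightarrow> nat \<Rightarrow> kring) \<Rightarrow>
    nat set \<Rightarrow> sdegree" where
  "vertex_sdeg D ord \<epsilon> \<xi> = (THE d. path_sdeg D ord \<epsilon> \<xi> d)"

definition FKh_part :: "diagram \<Rightarrow> (nat set \<Rightarrow> circle list) \<Rightarrow> (nat set \<Rightarrow> nat \<Rightarrow> kring) \<Rightarrow>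
    sdegree \<Rightarrow> int \<Rightarrow> kring kh_chain set" where
  "FKh_part D ord \<epsilon> ab i =
     {u \<in> carrier (grp (FKh D ord \<epsilon>) i).
        \<forall>(\<xi>, xs)\<in>Poly_Mapping.keys u. \<forall>k\<in>Poly_Mapping.keys (Poly_Mapping.lookup u (\<xi>, xs)).
          mono_sdeg k + basis_sdeg xs - vertex_sdeg D ord \<epsilon> \<xi> = ab}"

end

theory Submission
  imports Defs
begin

text \<open>Evaluated on basis vectors, \<open>\<F>\<close> of a cobordism is homogeneous for the splitting degree, and
  the degree of a vertex of the cube does not depend on the path: the two composites around a face
  are equal up to a unit, \<open>\<F>\<close> of such a composite is nonzero, and the units of the ground ring are
  signed monomials, hence homogeneous.  So every coefficient of the differential has degree zero for
  the shifted grading, and splitting coefficients into homogeneous parts decomposes the complex.  A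
  homogeneous element of the ground ring is determined by its image under \<open>X, Z \<mapsto> 1\<close>,
  \<open>Y \<mapsto> \<pi>\<close>, and any image occurs in each degree, so applying this map to the coefficients
  identifies each part with \<open>\<F>\<^sub>\<pi>Kh\<^sub>\<pi>(D)\<close>.  Base change of a free module also just applies
  it to the coefficients, which gives the remaining isomorphism.\<close>

section \<open>Linear extensions and coefficient maps\<close>

text \<open>Nonvanishing on a face is the delicate point: the ground ring has zero divisors, and the
  terms of a composite might cancel. Setting X = Y = Z = 1 turns every structure constant into a
  nonnegative integer; starting from \<open>Vp\<close> on all circles, two saddles never apply a
  merge to two copies of \<open>Vm\<close>, so some coefficient stays positive. Splitting degrees
  are computed from words, whereas the relations identify different words. The two are linked only
  through values on basis vectors, where a monomial common to both composites of a face computes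
  both degrees at once. On a class, the functor is defined by its common value on all
  representatives, so invariance under the chronological relations has to come before the
  differential can be computed. The isomorphism from each part is the same coefficient map in every
  degree; hence X and Z, which map to 1, act as the identity. Both Y and XY map to
  \<open>pi_elt\<close>, and XY is how \<open>pi_elt\<close> acts, which gives the action of
  Y.\<close>

abbreviation "single \<equiv> Poly_Mapping.single"
abbreviation "lookup \<equiv> Poly_Mapping.lookup"
abbreviation "keys \<equiv> Poly_Mapping.keys"

text \<open>The coefficient changes that occur are the identity, \<open>k_to_zpi\<close>,
  \<open>zpi_to_k\<close>, the specializations \<open>k_char\<close> and
  \<open>augmentation\<close>; one locale treats the effect of all of them.\<close>

locale comm_ring_map =
  fixes h :: "'a::comm_ring_1 \<Rightarrow> 'b::comm_ring_1"
  assumes map_one: "h 1 = 1"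
    and map_add: "h (x + y) = h x + h y"
    and map_mult: "h (x * y) = h x * h y"
begin

lemma map_zero: "h 0 = 0"
  using map_add[of 0 0] by simp

lemma map_uminus: "h (- x) = - h x"
  using map_add[of x "- x"] by (simp add: map_zero eq_neg_iff_add_eq_0 add.commute)

lemma map_sum: "h (sum f A) = (\<Sum>x\<in>A. h (f x))"
  by (induction A rule: infinite_finite_induct) (simp_all add: map_zero map_add)

lemma lookup_map: "lookup (Poly_Mapping.map h u) x = h (lookup u x)"
  by (simp add: Poly_Mapping.map.rep_eq when_def map_zero)

end

lemma comm_ring_map_id: "comm_ring_map id"
  by unfold_locales simp_all

lemma poly_mapping_sum_single: "(\<Sum>k\<in>keys f. single k (lookup f k)) = f"
  by (intro poly_mapping_eqI)
    (simp add: lookup_sum lookup_single when_def in_keys_iff)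

text \<open>The value in the case \<open>single\<close> may be 0, so this case also covers the zero
  function, from which finite sums are built up.\<close>

lemma poly_mapping_add_induct [case_names single add]:
  fixes f :: "'a \<Rightarrow>\<^sub>0 'b::comm_monoid_add"
  assumes "\<And>k v. P (single k v)" "\<And>f g. P f \<Longrightarrow> P g \<Longrightarrow> P (f + g)"
  shows "P f"
proof -
  have "P (\<Sum>k\<in>A. single k (lookup f k))" for A
  proof (induction A rule: infinite_finite_induct)
    case (infinite A)
    show ?case using assms(1)[of undefined 0] infinite by simp
  next
    case empty
    show ?case using assms(1)[of undefined 0] by simp
  qed (simp add: assms)
  then show ?thesis by (metis poly_mapping_sum_single)
qed

lemma lookup_scale [simp]: "lookup (scale r u) x = r * lookup u x"
  by (simp add: scale_def Poly_Mapping.map.rep_eq when_def)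

lemma scale_simps [simp]:
  "scale 1 u = u" "scale 0 u = 0" "scale r 0 = 0"
  "scale r (scale s u) = scale (r * s) u"
  "scale r (single x s) = single x (r * s)"
  by (intro poly_mapping_eqI; simp add: mult.assoc lookup_single when_def)+

lemma scale_add: "scale r (u + v) = scale r u + scale r v" "scale (r + s) u = scale r u + scale s u"
  by (intro poly_mapping_eqI; simp add: lookup_add algebra_simps)+

lemma scale_uminus: "scale r (- u) = - scale r u" "scale (- r) u = - scale r u"
  by (intro poly_mapping_eqI; simp)+

lemma scale_diff: "scale r (u - v) = scale r u - scale r v"
  by (intro poly_mapping_eqI; simp add: lookup_minus algebra_simps)+

lemma scale_sum: "scale r (sum f A) = (\<Sum>x\<in>A. scale r (f x))"
  by (induction A rule: infinite_finite_induct) (simp_all add: scale_add)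

lemma keys_scale: "keys (scale r u) \<subseteq> keys u"
  by (auto simp: in_keys_iff)

text \<open>\<open>lin_ext\<close> sums over the support, which changes under addition and scaling.
  A common finite superset makes such sums comparable term by term.\<close>

lemma lin_ext_superset:
  assumes "finite A" "keys u \<subseteq> A"
  shows "lin_ext f u = (\<Sum>x\<in>A. scale (lookup u x) (f x))"
  unfolding lin_ext_def using assms
  by (intro sum.mono_neutral_left) (auto simp: in_keys_iff)

lemma lookup_lin_ext: "lookup (lin_ext f u) y = (\<Sum>x\<in>keys u. lookup u x * lookup (f x) y)"
  by (simp add: lin_ext_def lookup_sum)

lemma lin_ext_single [simp]: "lin_ext f (single x r) = scale r (f x)"
  by (simp add: lin_ext_def)

lemma lin_ext_zero [simp]: "lin_ext f 0 = 0"
  by (simp add: lin_ext_def)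

lemma lin_ext_add: "lin_ext f (u + v) = lin_ext f u + lin_ext f v"
proof -
  let ?A = "keys u \<union> keys v"
  have "lin_ext f w = (\<Sum>x\<in>?A. scale (lookup w x) (f x))" if "w \<in> {u, v, u + v}" for w
    using that Poly_Mapping.keys_add[of u v] by (intro lin_ext_superset) auto
  then show ?thesis by (simp add: lookup_add scale_add sum.distrib)
qed

lemma lin_ext_scale: "lin_ext f (scale r u) = scale r (lin_ext f u)"
proof -
  have "lin_ext f (scale r u) = (\<Sum>x\<in>keys u. scale (lookup (scale r u) x) (f x))"
    by (intro lin_ext_superset finite_keys keys_scale)
  then show ?thesis by (simp add: lin_ext_def scale_sum)
qed

lemma lin_ext_uminus: "lin_ext f (- u) = - lin_ext f u"
  using lin_ext_add[of f u "- u"] by (simp add: eq_neg_iff_add_eq_0 add.commute)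

lemma lin_ext_diff: "lin_ext f (u - v) = lin_ext f u - lin_ext f v"
  using lin_ext_add[of f u "- v"] by (simp add: lin_ext_uminus)

lemma lin_ext_sum: "lin_ext f (sum u A) = (\<Sum>x\<in>A. lin_ext f (u x))"
  by (induction A rule: infinite_finite_induct) (simp_all add: lin_ext_add)

lemma lin_ext_single_id [simp]: "lin_ext (\<lambda>x. single x 1) u = u"
  by (simp add: lin_ext_def poly_mapping_sum_single)

lemma lin_ext_lin_ext: "lin_ext g (lin_ext f u) = lin_ext (\<lambda>x. lin_ext g (f x)) u"
  by (simp add: lin_ext_def[of f] lin_ext_def[of _ u] lin_ext_sum lin_ext_scale)

lemma lin_ext_cong: "(\<And>x. x \<in> keys u \<Longrightarrow> f x = g x) \<Longrightarrow> lin_ext f u = lin_ext g u"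
  by (simp add: lin_ext_def)

lemma lin_ext_fun_scale: "lin_ext (\<lambda>x. scale r (f x)) u = scale r (lin_ext f u)"
  by (simp add: lin_ext_def scale_sum mult.commute)

lemma lin_ext_fun_zero [simp]: "lin_ext (\<lambda>x. 0) u = 0"
  by (simp add: lin_ext_def)

lemma lin_ext_fun_sum: "lin_ext (\<lambda>x. \<Sum>i\<in>A. f i x) u = (\<Sum>i\<in>A. lin_ext (f i) u)"
  unfolding lin_ext_def scale_sum by (rule sum.swap)

lemma keys_lin_ext: "y \<in> keys (lin_ext f u) \<Longrightarrow> \<exists>x\<in>keys u. y \<in> keys (f x)"
  unfolding in_keys_iff lookup_lin_ext
  by (metis (no_types, lifting) mult_zero_right sum.not_neutral_contains_not_neutral in_keys_iff)

context comm_ring_map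
begin

lemma map_poly_add: "Poly_Mapping.map h (u + v) = Poly_Mapping.map h u + Poly_Mapping.map h v"
  by (intro poly_mapping_eqI) (simp add: lookup_map lookup_add map_add)

lemma map_poly_sum: "Poly_Mapping.map h (sum f A) = (\<Sum>x\<in>A. Poly_Mapping.map h (f x))"
  by (intro poly_mapping_eqI) (simp add: lookup_map lookup_sum map_sum)

lemma map_poly_scale: "Poly_Mapping.map h (scale r u) = scale (h r) (Poly_Mapping.map h u)"
  by (intro poly_mapping_eqI) (simp add: lookup_map map_mult)

lemma keys_map_poly: "keys (Poly_Mapping.map h u) \<subseteq> keys u"
  by (auto simp: in_keys_iff lookup_map map_zero)

lemma map_poly_lin_ext:
  "Poly_Mapping.map h (lin_ext f u) = lin_ext (\<lambda>x. Poly_Mapping.map h (f x)) (Poly_Mapping.map h u)"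
proof -
  have "lin_ext (\<lambda>x. Poly_Mapping.map h (f x)) (Poly_Mapping.map h u)
      = (\<Sum>x\<in>keys u. scale (lookup (Poly_Mapping.map h u) x) (Poly_Mapping.map h (f x)))"
    by (intro lin_ext_superset finite_keys keys_map_poly)
  then show ?thesis by (simp add: lin_ext_def map_poly_sum map_poly_scale lookup_map)
qed

lemma map_poly_single [simp]: "Poly_Mapping.map h (single x r) = single x (h r)"
  by (simp add: map_zero)

lemma map_poly_zero [simp]: "Poly_Mapping.map h 0 = 0"
  by (intro poly_mapping_eqI) (simp add: lookup_map map_zero)

end

section \<open>The ground rings\<close>

text \<open>Monoid rings are functorial: a homomorphism \<open>\<phi>\<close> of exponents, twisted
  by a multiplicative weight \<open>e\<close>, extends to a ring map. The two maps between the
  ground rings have weight 1; the specializations of X and Y at signs have a sign as weight.\<close>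

lemma comm_ring_map_lin_ext_single:
  fixes \<phi> :: "'b::comm_monoid_add \<Rightarrow> 'c::comm_monoid_add"
  assumes "\<phi> 0 = 0" "\<And>x y. \<phi> (x + y) = \<phi> x + \<phi> y"
    and "e 0 = 1" "\<And>x y. e (x + y) = e x * e y"
  shows "comm_ring_map (lin_ext (\<lambda>k. single (\<phi> k) (e k :: 'r::comm_ring_1)))"
proof
  let ?f = "lin_ext (\<lambda>k. single (\<phi> k) (e k :: 'r))"
  show "?f 1 = 1"
    using assms(1,3) by (metis lin_ext_single scale_simps(1) single_one)
  show "?f (x + y) = ?f x + ?f y" for x y
    by (rule lin_ext_add)
  show "?f (x * y) = ?f x * ?f y" for x y
  proof (induction x rule: poly_mapping_add_induct)
    case (single k v)
    show ?case
      by (induction y rule: poly_mapping_add_induct)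
        (simp_all add: mult_single assms lin_ext_add algebra_simps)
  next
    case (add f g)
    then show ?case by (simp add: distrib_right lin_ext_add)
  qed
qed

lemma k_to_zpi_eq: "k_to_zpi = lin_ext (\<lambda>k. single (case k of (a, b, c) \<Rightarrow> b) 1)"
  by (intro ext) (auto simp: k_to_zpi_def lin_ext_def intro!: sum.cong)

lemma zpi_to_k_eq: "zpi_to_k = lin_ext (\<lambda>e. single (e, e, 0) 1)"
  by (intro ext) (auto simp: zpi_to_k_def lin_ext_def intro!: sum.cong)

lemma comm_ring_map_k_to_zpi: "comm_ring_map k_to_zpi"
  unfolding k_to_zpi_eq by (rule comm_ring_map_lin_ext_single) (auto simp: zero_prod_def)

lemma comm_ring_map_zpi_to_k: "comm_ring_map zpi_to_k"
  unfolding zpi_to_k_eq by (rule comm_ring_map_lin_ext_single) (auto simp: zero_prod_def)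

text \<open>XY goes back to \<open>\<pi>\<close>. This retraction makes \<open>k_to_zpi\<close>
  linear over \<open>zpi\<close> acting through \<open>zpi_to_k\<close>, and it lets chains over
  \<open>zpi\<close> be lifted.\<close>

lemma k_to_zpi_zpi_to_k [simp]: "k_to_zpi (zpi_to_k q) = q"
  by (simp add: k_to_zpi_eq zpi_to_k_eq lin_ext_lin_ext)

lemma k_to_zpi_generators [simp]: "k_to_zpi Xk = 1" "k_to_zpi Yk = pi_elt" "k_to_zpi Zk = 1"
  by (simp_all add: k_to_zpi_eq Xk_def Yk_def Zk_def pi_elt_def)

section \<open>Functoriality and homogeneity\<close>

lemma lam_add_left: "lam (d + d') e = lam d e * lam d' e"
  by (cases d; cases d'; cases e) (simp add: mult_single algebra_simps)

lemma lam_add_right: "lam d (e + e') = lam d e * lam d e'"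
  by (cases d; cases e'; cases e) (simp add: mult_single algebra_simps)

lemma single_zero_triple: "single (0, 0, 0) 1 = 1"
  by (metis single_one zero_prod_def)

lemma lam_zero [simp]: "lam 0 e = 1" "lam d 0 = 1"
proof -
  have "lam (0, 0) (a, b) = 1" "lam (a, b) (0, 0) = 1" for a b
    by (simp_all add: single_zero_triple)
  then show "lam 0 e = 1" "lam d 0 = 1"
    by (metis surj_pair zero_prod_def)+
qed

lemma vdeg_append: "vdeg (xs @ ys) = vdeg xs + vdeg ys"
  by (simp add: vdeg_def)

lemma vdeg_Nil [simp]: "vdeg [] = 0"
  by (simp add: vdeg_def zero_prod_def)

lemma wdeg_simps [simp]: "wdeg [] = 0" "wdeg ((k, g, l) # w) = gdeg g + wdeg w"
  "wdeg (u @ v) = wdeg u + wdeg v" "wdeg (tubes i j w) = wdeg w"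
  by (simp_all add: wdeg_def tubes_def o_def case_prod_unfold)

lemma wsdeg_simps [simp]: "wsdeg [] = 0" "wsdeg (L # w) = layer_sdeg L + wsdeg w"
  "wsdeg (u @ v) = wsdeg u + wsdeg v"
  by (simp_all add: wsdeg_def)

lemma tubes_simps [simp]: "tubes i j [] = []" "tubes i j ((k, g, l) # w) = (i + k, g, l + j) # tubes i j w"
  "tubes i j (u @ v) = tubes i j u @ tubes i j v"
  by (simp_all add: tubes_def)

lemma cob_append: "cob m (u @ v) n \<longleftrightarrow> (\<exists>k. cob m u k \<and> cob k v n)"
  by (induction m u n rule: cob.induct) auto

lemma cob_tubes: "cob m w n \<Longrightarrow> cob (k + m + l) (tubes k l w) (k + n + l)"
  by (induction m w n rule: cob.induct) (auto simp: add.assoc add.left_commute)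

lemma length_two: "length xs = 2 \<longleftrightarrow> (\<exists>a b. xs = [a, b])"
  by (auto simp: numeral_2_eq_2 length_Suc_conv)

text \<open>The twist stays a single case because one formula through \<open>lam\<close> gives its
  value; every other generator is split by basis vectors.\<close>

lemma F_gen_cases:
  assumes "length xs = gin g"
  obtains "g = Merge" "xs = [Vp, Vp]" | "g = Merge" "xs = [Vp, Vm]" | "g = Merge" "xs = [Vm, Vp]"
  | "g = Merge" "xs = [Vm, Vm]" | "g = Split" "xs = [Vp]" | "g = Split" "xs = [Vm]"
  | "g = Birth" "xs = []" | "g = DeathP" "xs = [Vp]" | "g = DeathP" "xs = [Vm]"
  | "g = DeathN" "xs = [Vp]" | "g = DeathN" "xs = [Vm]"
  | a b where "g = Twist" "xs = [a, b]"
proof (cases g)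
  case Merge
  with assms obtain a b where "xs = [a, b]" by (auto simp: length_two)
  with Merge that(1-4) show thesis by (cases a; cases b) simp_all
next
  case Twist
  with assms that(12) show thesis by (auto simp: length_two)
next
  case Split
  with assms obtain a where "xs = [a]" by (auto simp: length_Suc_conv)
  with Split that(5,6) show thesis by (cases a) simp_all
next
  case DeathP
  with assms obtain a where "xs = [a]" by (auto simp: length_Suc_conv)
  with DeathP that(8,9) show thesis by (cases a) simp_all
next
  case DeathN
  with assms obtain a where "xs = [a]" by (auto simp: length_Suc_conv)
  with DeathN that(10,11) show thesis by (cases a) simp_all
qed (use assms that(7) in simp)

text \<open>Degrees of basis vectors lie on the diagonal. With the additive map \<open>diag\<close>,
  identities between them become identities between integers.\<close>

definition diag :: "int \<Rightarrow> sdegree" where "diag s = (of_int s, s)"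

lemma diag_add: "diag (s + t) = diag s + diag t"
  by (simp add: diag_def)

lemma diag_zero [simp]: "diag 0 = 0"
  by (simp add: diag_def zero_prod_def)

lemma basis_sdeg_Cons:
  "basis_sdeg (x # xs) = basis_sdeg xs + (if x = Vm then diag (- int (length xs) - 1) else 0)"
proof -
  have "(\<Sum>j<length (x # xs). if (x # xs) ! j = Vm then int (length (x # xs) - j) else 0)
     = (if x = Vm then int (length xs) + 1 else 0)
       + (\<Sum>j<length xs. if xs ! j = Vm then int (length xs - j) else 0)"
    unfolding length_Cons sum.lessThan_Suc_shift by (simp cong: if_cong)
  then show ?thesis
    unfolding basis_sdeg_def Let_def diag_def[symmetric] by (simp only:) (simp add: diag_add[symmetric])
qed

lemma basis_sdeg_Nil [simp]: "basis_sdeg [] = 0"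
  by (simp add: basis_sdeg_def zero_prod_def)

lemma snd_vdeg_Cons: "snd (vdeg (x # xs)) = snd (vdeg xs) - (if x = Vm then 1 else 0)"
  by (simp add: vdeg_def)

text \<open>Positions are counted from the right, so appending \<open>ys\<close> raises the index of
  each \<open>Vm\<close> in \<open>xs\<close> by the length of \<open>ys\<close>;
  \<open>snd (vdeg xs)\<close> is minus the number of these entries.\<close>

lemma basis_sdeg_append:
  "basis_sdeg (xs @ ys) = basis_sdeg xs + basis_sdeg ys + diag (int (length ys) * snd (vdeg xs))"
proof (induction xs)
  case (Cons x xs)
  have "diag (- int (length (xs @ ys)) - 1) = diag (- int (length xs) - 1) - diag (int (length ys))"
    unfolding eq_diff_eq diag_add[symmetric] by (rule arg_cong[where f = diag]) simp
  moreover have "diag (int (length ys) * (s - 1)) = diag (int (length ys) * s) - diag (int (length ys))" for s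
    unfolding eq_diff_eq diag_add[symmetric] by (simp add: algebra_simps)
  ultimately show ?case
    using Cons by (cases x) (simp_all add: basis_sdeg_Cons snd_vdeg_Cons del: length_append)
qed simp

lemma mono_sdeg_add: "mono_sdeg (k + l) = mono_sdeg k + mono_sdeg l"
  by (cases k; cases l) (simp only: mono_sdeg.simps add_Pair minus_add_distrib ac_simps)

lemma Xk_Zk: "Xk * Zk = single (1, 0, 1) 1" "Yk * Zk = single (0, 1, 1) 1"
  by (simp_all add: Xk_def Yk_def Zk_def mult_single)

text \<open>The bidegree is tracked along with the length because the factor \<open>lam\<close> of a
  layer depends on the bidegree of what stands to its left.\<close>

lemma F_gen_keys:
  assumes "length xs = gin g" "y \<in> keys (F_gen h g xs)"
  shows "length y = gout g" "vdeg y = vdeg xs + gdeg g"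
proof -
  have "length y = gout g \<and> vdeg y = vdeg xs + gdeg g"
    using assms(2)
    by (cases rule: F_gen_cases[OF assms(1)])
      (auto simp: vdeg_def split: if_splits dest!: Poly_Mapping.keys_add[THEN subsetD])
  then show "length y = gout g" "vdeg y = vdeg xs + gdeg g" by auto
qed

text \<open>The monomials in the tables compensate for the positions. For the split of
  \<open>Vp\<close>, the lists \<open>[Vm, Vp]\<close> and \<open>[Vp, Vm]\<close> have degrees
  \<open>diag (-2)\<close> and \<open>diag (-1)\<close>, and they differ by exactly the degree (1,
  -1) of YZ.\<close>

lemma F_gen_sdeg:
  assumes "length xs = gin g" "y \<in> keys (F_gen id g xs)" "k \<in> keys (lookup (F_gen id g xs) y)"
  shows "mono_sdeg k + basis_sdeg y = basis_sdeg xs + gen_sdeg g"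
proof (cases rule: F_gen_cases[OF assms(1)])
  case (12 a b)
  then show ?thesis using assms(2-)
    by (cases a; cases b; auto simp: basis_sdeg_Cons diag_def zero_prod_def vdeg_def split: if_splits)
qed (use assms(2-) in \<open>auto simp: basis_sdeg_Cons diag_def zero_prod_def Xk_def Zk_def Yk_def mult_single lookup_add lookup_single
   when_def keys_one[unfolded zero_prod_def] split: if_splits\<close>)

lemma F_layer_keys:
  assumes "length xs = k + gin g + l" "y \<in> keys (F_layer h (k, g, l) xs)"
  obtains z where "y = take k xs @ z @ drop (k + gin g) xs" "z \<in> keys (F_gen h g (take (gin g) (drop k xs)))"
    "length (take (gin g) (drop k xs)) = gin g" "length y = k + gout g + l" "vdeg y = vdeg xs + gdeg g"
proof -
  let ?m = "take (gin g) (drop k xs)"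
  have len: "length ?m = gin g" using assms(1) by simp
  have xs: "xs = take k xs @ ?m @ drop (k + gin g) xs"
    by (metis append_take_drop_id drop_drop add.commute)
  obtain z where z: "y = take k xs @ z @ drop (k + gin g) xs" "z \<in> keys (F_gen h g ?m)"
    using assms(2) keys_lin_ext keys_scale by (fastforce split: if_splits)
  note zk = F_gen_keys[OF len z(2)]
  have "vdeg y = vdeg (take k xs @ ?m @ drop (k + gin g) xs) + gdeg g"
    unfolding z(1) vdeg_append zk by (simp add: ac_simps)
  then show thesis using that z len zk assms(1) xs by simp
qed

lemma F_word_keys:
  "cob m w n \<Longrightarrow> length xs = m \<Longrightarrow> y \<in> keys (F_word h w xs) \<Longrightarrow> length y = n \<and> vdeg y = vdeg xs + wdeg w"
proof (induction m w n arbitrary: xs rule: cob.induct)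
  case (2 m k g l w n)
  obtain z where "z \<in> keys (F_layer h (k, g, l) xs)" "y \<in> keys (F_word h w z)"
    using 2(4) keys_lin_ext by fastforce
  moreover from this(1) have "length z = k + gout g + l" "vdeg z = vdeg xs + gdeg g"
    using 2(2,3) by (auto elim: F_layer_keys[rotated] simp del: F_layer.simps)
  ultimately show ?case using 2(1)[of z] 2(2) by (simp add: ac_simps)
qed (auto split: if_splits)

section \<open>The functor on composites, with extra tubes, and under a change of
  coefficients\<close>

lemma F_word_append: "F_word h (u @ v) xs = lin_ext (F_word h v) (F_word h u xs)"
proof (induction u arbitrary: xs)
  case (Cons L u)
  then have "F_word h (u @ v) = (\<lambda>x. lin_ext (F_word h v) (F_word h u x))" by blast
  then show ?case by (simp add: lin_ext_lin_ext del: F_layer.simps)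
qed simp

lemma F_layer_append:
  assumes "length a = k" "length x = i + gin g + j"
  shows "F_layer h (k + i, g, l) (a @ x @ b) = scale (h (lam (gdeg g) (vdeg (a @ take i x))))
    (lin_ext (\<lambda>ys. single (a @ take i x @ ys @ drop (i + gin g) x @ b) 1) (F_gen h g (take (gin g) (drop i x))))"
  using assms by simp

locale k_algebra = comm_ring_map h for h :: "kring \<Rightarrow> 'r::comm_ring_1"

text \<open>Each layer passes the vector \<open>a\<close> on its left and picks up a factor
  \<open>lam\<close>; by bilinearity these multiply to a factor depending only on
  \<open>wdeg w\<close>. Tubes on the right cost nothing.\<close>

lemma (in k_algebra) F_word_tubes:
  "cob m w n \<Longrightarrow> length a = k \<Longrightarrow> length x = m \<Longrightarrow>
     F_word h (tubes k l w) (a @ x @ b)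
     = scale (h (lam (wdeg w) (vdeg a))) (lin_ext (\<lambda>ys. single (a @ ys @ b) 1) (F_word h w x))"
proof (induction m w n arbitrary: x rule: cob.induct)
  case (2 m i g j w n)
  have x: "length x = i + gin g + j" and w: "cob (i + gout g + j) w n" using 2 by auto
  let ?G = "F_gen h g (take (gin g) (drop i x))"
  have IH: "F_word h (tubes k l w) (a @ (take i x @ z @ drop (i + gin g) x) @ b)
      = scale (h (lam (wdeg w) (vdeg a)))
        (lin_ext (\<lambda>ys. single (a @ ys @ b) 1) (F_word h w (take i x @ z @ drop (i + gin g) x)))"
    if "z \<in> keys ?G" for z
    using F_gen_keys(1)[OF _ that] x by (intro 2(1) w 2(3)) simp
  have "F_word h (tubes k l ((i, g, j) # w)) (a @ x @ b)
    = scale (h (lam (gdeg g) (vdeg (a @ take i x))))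
       (lin_ext (\<lambda>z. F_word h (tubes k l w) (a @ (take i x @ z @ drop (i + gin g) x) @ b)) ?G)"
    unfolding tubes_simps F_word.simps F_layer_append[OF 2(3) x] by (simp add: lin_ext_scale lin_ext_lin_ext)
  also have "\<dots> = scale (h (lam (gdeg g) (vdeg (a @ take i x))))
       (lin_ext (\<lambda>z. scale (h (lam (wdeg w) (vdeg a)))
        (lin_ext (\<lambda>ys. single (a @ ys @ b) 1) (F_word h w (take i x @ z @ drop (i + gin g) x)))) ?G)"
    by (intro arg_cong[where f = "scale _"] lin_ext_cong IH)
  also have "\<dots> = scale (h (lam (wdeg ((i, g, j) # w)) (vdeg a)))
      (lin_ext (\<lambda>ys. single (a @ ys @ b) 1) (F_word h ((i, g, j) # w) x))"
    by (simp add: lin_ext_fun_scale lin_ext_scale lin_ext_lin_ext vdeg_append lam_add_right lam_add_left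
        map_mult ac_simps)
  finally show ?case .
qed (simp add: map_one)

lemma (in k_algebra) map_F_gen: "Poly_Mapping.map h (F_gen id g xs) = F_gen h g xs"
  by (cases "(id :: kring \<Rightarrow> kring, g, xs)" rule: F_gen.cases) (simp_all add: map_one map_poly_add)

text \<open>All structure constants come from \<open>kring\<close>, so an identity checked there can
  be pushed along every \<open>h\<close>.\<close>

lemma (in k_algebra) map_F_word:
  "Poly_Mapping.map h (F_word id w xs) = F_word h w xs"
proof (induction w arbitrary: xs)
  case (Cons L w)
  have "Poly_Mapping.map h (F_layer id L xs) = F_layer h L xs"
    by (cases L) (simp add: map_poly_scale map_poly_lin_ext map_F_gen map_one)
  then show ?case by (simp only: F_word.simps map_poly_lin_ext Cons)
qed (simp add: map_one)

text \<open>Monomials of a product of coefficients are products of monomials, so degrees can be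
  followed along a single trail of monomials through nested linear extensions.\<close>

lemma keys_lookup_lin_ext:
  fixes f :: "'b \<Rightarrow> 'c \<Rightarrow>\<^sub>0 kring"
  assumes "k \<in> keys (lookup (lin_ext f u) y)"
  obtains x k1 k2 where "x \<in> keys u" "k1 \<in> keys (lookup u x)" "k2 \<in> keys (lookup (f x) y)" "k = k1 + k2"
proof -
  have "k \<in> (\<Union>x\<in>keys u. keys (lookup u x * lookup (f x) y))"
    using assms Poly_Mapping.keys_sum[of "\<lambda>x. lookup u x * lookup (f x) y" "keys u"]
    by (auto simp: lookup_lin_ext)
  then obtain x where x: "x \<in> keys u" "k \<in> keys (lookup u x * lookup (f x) y)" by blast
  then show thesis
    using that Poly_Mapping.keys_mult[of "lookup u x" "lookup (f x) y"] by blast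
qed

lemma keys_lookup_scale:
  fixes u :: "'b \<Rightarrow>\<^sub>0 kring"
  assumes "k \<in> keys (lookup (scale r u) y)"
  obtains k1 k2 where "k1 \<in> keys r" "k2 \<in> keys (lookup u y)" "k = k1 + k2"
  using assms Poly_Mapping.keys_mult[of r "lookup u y"] by auto

lemma of_int_bit_eqI: "x = y + 2 * z \<Longrightarrow> (of_int x :: bit) = of_int y"
  by simp

text \<open>A generator to the right of \<open>a\<close> changes the indices of the entries
  \<open>Vm\<close> in \<open>a\<close>. The degree of \<open>lam\<close> makes up the difference
  between this change and the degree shift prescribed for added tubes. With \<open>gdeg g\<close>
  equal to \<open>(\<alpha>, \<beta>)\<close>, the identity rests on \<open>gout g\<close> being
  \<open>gin g\<close> plus \<open>\<alpha>\<close> minus \<open>\<beta>\<close>.\<close>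

lemma lam_sdeg:
  assumes "k \<in> keys (lam (gdeg g) (vdeg a))"
  shows "mono_sdeg k + diag (int l * snd (gdeg g)) + diag (int (gout g) * snd (vdeg a))
    = diag (int (gin g) * snd (vdeg a))
      + (of_int (int (length a) * fst (gdeg g) + int l * snd (gdeg g)), (int (length a) + int l) * snd (gdeg g))"
proof -
  obtain \<alpha> \<beta> where g: "gdeg g = (\<alpha>, \<beta>)" by force
  define p q where pq: "p = int (count_list a Vp)" "q = int (count_list a Vm)"
  have "count_list a Vp + count_list a Vm = length a"
    by (induction a) (auto, metis sgn.exhaust)
  then have len: "int (length a) = p + q" by (simp add: pq)
  have a: "vdeg a = (p, - q)" by (simp add: vdeg_def pq)
  have out: "int (gout g) = int (gin g) + \<alpha> - \<beta>" using g by (cases g) auto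
  have k: "mono_sdeg k = (of_int (\<alpha> * p - \<beta> * q), \<alpha> * q + p * \<beta>)"
    using assms by (simp add: g a)
  \<comment> \<open>As integers the two first components differ by -2 \<open>\<alpha>\<close>
    \<open>q\<close>, which vanishes mod 2; this explains the witness \<open>z\<close>.\<close>
  show ?thesis
    unfolding k g a out len diag_def add_Pair of_int_add[symmetric] fst_conv snd_conv prod.inject
    by (intro conjI of_int_bit_eqI[where z = "- \<alpha> * q"]) (simp_all add: algebra_simps)
qed

lemma F_layer_sdeg:
  assumes len: "length xs = k + gin g + l"
    and "y \<in> keys (F_layer id (k, g, l) xs)" and e: "e \<in> keys (lookup (F_layer id (k, g, l) xs) y)"
  shows "mono_sdeg e + basis_sdeg y = basis_sdeg xs + layer_sdeg (k, g, l)"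
proof -
  define a m b where amb: "a = take k xs" "m = take (gin g) (drop k xs)" "b = drop (k + gin g) xs"
  have xs: "xs = a @ m @ b"
    unfolding amb by (metis append_take_drop_id drop_drop add.commute)
  have lens: "length a = k" "length m = gin g" "length b = l" using len by (simp_all add: amb)
  obtain e1 e' where e1: "e1 \<in> keys (lam (gdeg g) (vdeg a))" "e = e1 + e'"
    and e': "e' \<in> keys (lookup (lin_ext (\<lambda>ys. single (a @ ys @ b) 1) (F_gen id g m)) y)"
    using e unfolding F_layer.simps amb[symmetric] id_apply by (elim keys_lookup_scale) blast
  obtain z k1 where z: "z \<in> keys (F_gen id g m)" "k1 \<in> keys (lookup (F_gen id g m) z)" "y = a @ z @ b" "e' = k1"
    using e' by (elim keys_lookup_lin_ext) (auto simp: lookup_single when_def split: if_splits)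
  note zk = F_gen_keys[OF lens(2) z(1)] F_gen_sdeg[OF lens(2) z(1,2)]
  have "mono_sdeg e + basis_sdeg y
    = (mono_sdeg k1 + basis_sdeg z) + (mono_sdeg e1 + diag (int l * snd (gdeg g)) + diag (int (gout g) * snd (vdeg a)))
      + basis_sdeg a + basis_sdeg b + diag (int l * snd (vdeg a)) + diag (int l * snd (vdeg m))"
    by (simp add: e1(2) z(3,4) mono_sdeg_add basis_sdeg_append zk lens distrib_left distrib_right diag_add ac_simps)
  also have "\<dots> = basis_sdeg xs + layer_sdeg (k, g, l)"
    unfolding zk lam_sdeg[OF e1(1)]
    by (simp add: xs basis_sdeg_append lens distrib_left distrib_right diag_add ac_simps)
  finally show ?thesis .
qed

lemma F_word_sdeg:
  "cob m w n \<Longrightarrow> length xs = m \<Longrightarrow> k \<in> keys (lookup (F_word id w xs) y)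
    \<Longrightarrow> mono_sdeg k + basis_sdeg y = basis_sdeg xs + wsdeg w"
proof (induction m w n arbitrary: xs k rule: cob.induct)
  case (1 m n)
  then show ?case
    by (auto simp: lookup_single when_def keys_one zero_prod_def split: if_splits)
next
  case (2 m i g j w n)
  obtain z k1 k2 where z: "z \<in> keys (F_layer id (i, g, j) xs)" "k1 \<in> keys (lookup (F_layer id (i, g, j) xs) z)"
     "k2 \<in> keys (lookup (F_word id w z) y)" "k = k1 + k2"
    using 2(4) unfolding F_word.simps by (elim keys_lookup_lin_ext) blast
  have len: "length xs = i + gin g + j" "cob (i + gout g + j) w n" using 2 by auto
  have "mono_sdeg k1 + basis_sdeg z = basis_sdeg xs + layer_sdeg (i, g, j)"
    by (rule F_layer_sdeg[OF len(1) z(1,2)])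
  moreover have "length z = i + gout g + j"
    using F_layer_keys[OF len(1) z(1)] by metis
  then have "mono_sdeg k2 + basis_sdeg y = basis_sdeg z + wsdeg w"
    using 2(1)[OF len(2) _ z(3)] by simp
  ultimately show ?case
    unfolding z(4) mono_sdeg_add wsdeg_simps
    by (metis (no_types, lifting) add.assoc add.commute)
qed

section \<open>Invariance under the chronological relations\<close>

lemma length_three: "length xs = 3 \<longleftrightarrow> (\<exists>a b c. xs = [a, b, c])"
  by (auto simp: numeral_3_eq_3 length_Suc_conv)

text \<open>Since both sides have the same bidegree, tubes added on the left scale both by the same
  factor.\<close>

lemma chcob_rel_cob:
  "chcob_rel p w r w' q \<Longrightarrow> cob p w q \<and> cob p w' q \<and> wdeg w = wdeg w'"
proof (induction rule: chcob_rel.induct)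
  case (twist_natural g)
  then show ?case by (cases g) (simp_all add: bring_def upt_rec)
next
  case (disjoint p w q p' w' q')
  then show ?case
    using cob_tubes[OF disjoint(1), of p' 0] cob_tubes[OF disjoint(1), of q' 0]
      cob_tubes[OF disjoint(2), of 0 p] cob_tubes[OF disjoint(2), of 0 q]
    by (auto simp: cob_append ac_simps)
qed (auto simp: zero_prod_def)

interpretation k_id: k_algebra id
  by (intro k_algebra.intro comm_ring_map_id)

lemma lin_ext_swap: "lin_ext (\<lambda>x. lin_ext (f x) v) u = lin_ext (\<lambda>y. lin_ext (\<lambda>x. f x y) u) v"
  unfolding lin_ext_def scale_sum scale_simps by (subst sum.swap) (simp add: mult.commute)

lemma bring_1_2 [simp]: "bring n 0 = []" "bring n 1 = [(0, Twist, n - 2)]"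
   "bring n 2 = [(1, Twist, n - 3), (0, Twist, n - 2)]" "bring n (Suc 0) = [(0, Twist, n - 2)]"
  by (simp_all add: bring_def numeral_2_eq_2 numeral_3_eq_3)

lemmas F_eval = Xk_def Yk_def Zk_def mult_single vdeg_def single_zero_triple lin_ext_add scale_add

text \<open>All relations except \<open>disjoint\<close> concern fixed words and are evaluated on
  basis vectors. For \<open>disjoint\<close>, the word \<open>w\<close> has on its left the output
  of \<open>w'\<close> on one side of the relation and the input of \<open>w'\<close> on the other.
  Their bidegrees differ by \<open>wdeg w'\<close>, and the resulting quotient of factors is the
  coefficient of the relation.\<close>

lemma chcob_rel_F_word:
  "chcob_rel p w r w' q \<Longrightarrow> length xs = p \<Longrightarrow> F_word id w xs = scale r (F_word id w' xs)"
proof (induction arbitrary: xs rule: chcob_rel.induct)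
  case twist_twist
  then obtain a b where "xs = [a, b]" by (auto simp: length_two)
  then show ?case by (cases a; cases b) (simp_all add: F_eval)
next
  case (twist_natural g)
  then obtain x ys where xs: "xs = ys @ [x]" "length ys = gin g"
    by (metis length_append_singleton append_butlast_last_id length_butlast add_diff_cancel_right'
        list.size(3) Suc_eq_plus1 nat.simps(3))
  show ?case
    by (cases rule: F_gen_cases[OF xs(2)]; cases x) (auto simp: xs F_eval)
next
  case (disjoint p w q p' w' q')
  define a b where ab: "a = take p' xs" "b = drop p' xs"
  have xs: "xs = a @ b" "length a = p'" "length b = p" using disjoint(3) by (simp_all add: ab)
  let ?J = "\<lambda>ys zs. single (ys @ zs) 1 :: sgn list \<Rightarrow>\<^sub>0 kring"
  let ?u = "lin_ext (\<lambda>ys. lin_ext (?J ys) (F_word id w b)) (F_word id w' a)"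
  have right: "F_word id (tubes i 0 w) (ys @ b)
      = scale (lam (wdeg w) (vdeg ys)) (lin_ext (?J ys) (F_word id w b))" if "length ys = i" for i ys
    using k_id.F_word_tubes[OF disjoint(1) that xs(3), of 0 "[]"] by simp
  have left: "F_word id (tubes 0 i w') (a @ zs) = lin_ext (\<lambda>ys. ?J ys zs) (F_word id w' a)" for i zs
    using k_id.F_word_tubes[OF disjoint(2) _ xs(2), of "[]" 0 i zs] by simp
  have "F_word id (tubes 0 p w' @ tubes q' 0 w) xs
     = lin_ext (\<lambda>ys. F_word id (tubes q' 0 w) (ys @ b)) (F_word id w' a)"
    unfolding F_word_append xs(1) left lin_ext_lin_ext by simp
  also have "\<dots> = lin_ext (\<lambda>ys. scale (lam (wdeg w) (vdeg a + wdeg w')) (lin_ext (?J ys) (F_word id w b)))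
      (F_word id w' a)"
  proof (rule lin_ext_cong)
    fix ys assume "ys \<in> keys (F_word id w' a)"
    then have ys: "length ys = q'" "vdeg ys = vdeg a + wdeg w'"
      using F_word_keys[OF disjoint(2) xs(2)] by blast+
    show "F_word id (tubes q' 0 w) (ys @ b)
      = scale (lam (wdeg w) (vdeg a + wdeg w')) (lin_ext (?J ys) (F_word id w b))"
      unfolding right[OF ys(1)] ys(2) ..
  qed
  also have "\<dots> = scale (lam (wdeg w) (wdeg w')) (scale (lam (wdeg w) (vdeg a)) ?u)"
    by (simp add: lin_ext_fun_scale lam_add_right mult.commute)
  also have "scale (lam (wdeg w) (vdeg a)) ?u = F_word id (tubes p' 0 w @ tubes 0 q w') xs"
    unfolding F_word_append xs(1) right[OF xs(2)] lin_ext_scale lin_ext_lin_ext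
    by (simp add: left lin_ext_swap[of _ "F_word id w b"])
  finally show ?case .
next
  case merge_twist
  then obtain a b where "xs = [a, b]" by (auto simp: length_two)
  then show ?case by (cases a; cases b) (simp_all add: F_eval)
next
  case split_twist
  then obtain a where "xs = [a]" by (auto simp: length_Suc_conv)
  then show ?case by (cases a) (simp_all add: F_eval)
next
  case merge_assoc
  then obtain a b c where "xs = [a, b, c]" by (auto simp: length_three)
  then show ?case by (cases a; cases b; cases c) (simp_all add: F_eval)
next
  case split_assoc
  then obtain a where "xs = [a]" by (auto simp: length_Suc_conv)
  then show ?case by (cases a) (simp_all add: F_eval)
next
  case death
  then obtain a where "xs = [a]" by (auto simp: length_Suc_conv)
  then show ?case by (cases a) (simp_all add: F_eval)
next
  case birth_merge
  then obtain a where "xs = [a]" by (auto simp: length_Suc_conv)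
  then show ?case by (cases a) (simp_all add: F_eval)
next
  case split_death_pos
  then obtain a where "xs = [a]" by (auto simp: length_Suc_conv)
  then show ?case by (cases a) (simp_all add: F_eval)
next
  case split_death_neg
  then obtain a where "xs = [a]" by (auto simp: length_Suc_conv)
  then show ?case by (cases a) (simp_all add: F_eval)
next
  case frobenius_left
  then obtain a b where "xs = [a, b]" by (auto simp: length_two)
  then show ?case by (cases a; cases b) (simp_all add: F_eval)
next
  case frobenius_right
  then obtain a b where "xs = [a, b]" by (auto simp: length_two)
  then show ?case by (cases a; cases b) (simp_all add: F_eval)
qed

text \<open>By linearity only a relation placed inside a longer word matters. Every basis vector
  reached by the prefix \<open>u\<close> is cut into the parts under the left tubes, the relation
  and the right tubes, and the relation is applied to the middle part.\<close>

lemma (in k_algebra) F_comb_null: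
  assumes "f \<in> chcob_null h m n" "length xs = m"
  shows "F_comb h f xs = 0"
  using assms(1)
proof induction
  case (rel p w r w' q u k l v)
  have word: "F_word h (u @ tubes k l w @ v) xs = scale (h r) (F_word h (u @ tubes k l w' @ v) xs)"
  proof -
    have "F_word h (tubes k l w) y = scale (h r) (F_word h (tubes k l w') y)" if "y \<in> keys (F_word h u xs)" for y
    proof -
      have "length y = k + p + l" using F_word_keys[OF rel(2) assms(2) that] by simp
      then obtain a x b where y: "y = a @ x @ b" "length a = k" "length x = p"
        by (metis append_take_drop_id length_append length_take length_drop min.absorb2 le_add1 add.assoc add_diff_cancel_left')
      have "F_word h w x = scale (h r) (F_word h w' x)"
        using arg_cong[OF chcob_rel_F_word[OF rel(1) y(3)], of "Poly_Mapping.map h"]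
        by (simp add: map_F_word map_poly_scale)
      moreover have "cob p w q" "cob p w' q" "wdeg w = wdeg w'" using chcob_rel_cob[OF rel(1)] by auto
      ultimately show ?thesis
        unfolding y(1) by (simp add: F_word_tubes[OF _ y(2,3)] lin_ext_scale mult.commute)
    qed
    then have "lin_ext (F_word h (tubes k l w)) (F_word h u xs)
        = lin_ext (\<lambda>y. scale (h r) (F_word h (tubes k l w') y)) (F_word h u xs)"
      by (rule lin_ext_cong)
    moreover have "F_word h (u @ t @ v) xs = lin_ext (F_word h v) (lin_ext (F_word h t) (F_word h u xs))" for t
      by (metis F_word_append append.assoc)
    ultimately show ?thesis by (simp add: lin_ext_fun_scale lin_ext_scale)
  qed
  then show ?case by (simp add: F_comb_def lin_ext_diff)
qed (simp_all add: F_comb_def lin_ext_add lin_ext_scale)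

text \<open>All representatives have the same value because their differences are null, and
  \<open>f\<close> itself is a representative. So the set inside \<open>F_mor\<close> is a singleton
  and \<open>the_elem\<close> returns this value.\<close>

lemma (in k_algebra) F_mor_class:
  assumes "\<And>w. w \<in> keys f \<Longrightarrow> cob m w n" "length xs = m"
  shows "F_mor h (chcob_class h m n f) xs = F_comb h f xs"
proof -
  have "F_comb h g xs = F_comb h f xs" if "g \<in> chcob_class h m n f" for g
    using F_comb_null[of "g - f" m n xs] that assms(2)
    by (simp add: chcob_class_def F_comb_def lin_ext_diff)
  moreover have "f \<in> chcob_class h m n f"
    using assms(1) by (simp add: chcob_class_def chcob_null.zero)
  ultimately have "(\<lambda>f. F_comb h f xs) ` chcob_class h m n f = {F_comb h f xs}" by blast
  then show ?thesis by (simp add: F_mor_def)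
qed

section \<open>Units of the ground ring\<close>

text \<open>Only one pair of exponents contributes to this coefficient, so nothing can cancel; the
  pair of minima and the pair of maxima are of this kind.\<close>

lemma lookup_mult_extremal:
  fixes p q :: "int \<Rightarrow>\<^sub>0 int"
  assumes "\<And>i j. i \<in> keys p \<Longrightarrow> j \<in> keys q \<Longrightarrow> i + j = a + b \<Longrightarrow> i = a \<and> j = b"
  shows "lookup (p * q) (a + b) = lookup p a * lookup q b"
proof -
  have "p * q = (\<Sum>i\<in>keys p. \<Sum>j\<in>keys q. single (i + j) (lookup p i * lookup q j))"
    by (subst (1) poly_mapping_sum_single[of p, symmetric], subst (1) poly_mapping_sum_single[of q, symmetric])
      (simp add: sum_product mult_single)
  then have "lookup (p * q) (a + b)
     = (\<Sum>i\<in>keys p. \<Sum>j\<in>keys q. lookup p i * lookup q j when i + j = a + b)"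
    by (simp add: lookup_sum lookup_single)
  also have "\<dots> = (\<Sum>i\<in>keys p. \<Sum>j\<in>keys q. lookup p i * lookup q j when i = a \<and> j = b)"
    by (intro sum.cong refl when_cong) (use assms in auto)
  also have "\<dots> = (\<Sum>i\<in>keys p. (\<Sum>j\<in>keys q. if j = b then lookup p i * lookup q j else 0) when i = a)"
    by (intro sum.cong refl) (auto simp: when_def)
  also have "\<dots> = lookup p a * lookup q b"
    by (simp add: when_def in_keys_iff)
  finally show ?thesis .
qed

text \<open>The lowest and the highest terms of the two factors multiply to nonzero terms, so they have
  the same degree.\<close>

lemma laurent_unit:
  fixes p q :: "int \<Rightarrow>\<^sub>0 int"
  assumes "p * q = 1"
  obtains n u where "p = single n u" "\<bar>u\<bar> = 1"
proof -
  have ne: "keys p \<noteq> {}" "keys q \<noteq> {}"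
    using assms by (auto simp: keys_eq_empty)
  have one: "lookup (p * q) k = (1 when k = 0)" for k
    by (simp add: assms lookup_one)
  let ?a = "Min (keys p)" and ?b = "Min (keys q)" and ?A = "Max (keys p)" and ?B = "Max (keys q)"
  have bounds: "?a \<le> i \<and> i \<le> ?A" if "i \<in> keys p" for i using that by simp
  have bounds': "?b \<le> i \<and> i \<le> ?B" if "i \<in> keys q" for i using that by simp
  have mem: "?a \<in> keys p" "?A \<in> keys p" "?b \<in> keys q" "?B \<in> keys q" using ne by simp_all
  have "lookup (p * q) (?a + ?b) = lookup p ?a * lookup q ?b"
  proof (rule lookup_mult_extremal)
    fix i j assume "i \<in> keys p" "j \<in> keys q" "i + j = ?a + ?b"
    then show "i = ?a \<and> j = ?b" using bounds[of i] bounds'[of j] by arith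
  qed
  moreover have "lookup (p * q) (?A + ?B) = lookup p ?A * lookup q ?B"
  proof (rule lookup_mult_extremal)
    fix i j assume "i \<in> keys p" "j \<in> keys q" "i + j = ?A + ?B"
    then show "i = ?A \<and> j = ?B" using bounds[of i] bounds'[of j] by arith
  qed
  ultimately have "lookup (p * q) (?a + ?b) \<noteq> 0" "lookup (p * q) (?A + ?B) \<noteq> 0"
    and prod: "lookup (p * q) (?a + ?b) = lookup p ?a * lookup q ?b"
    using mem by (simp_all add: in_keys_iff)
  then have zero: "?a + ?b = 0" "?A + ?B = 0"
    unfolding one by (simp_all split: if_splits add: when_def)
  then have "?a = ?A" using bounds[OF mem(1)] bounds'[OF mem(3)] by linarith
  then have "keys p \<subseteq> {?a}" using bounds by (metis antisym singletonI subsetI)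
  then have "p = single ?a (lookup p ?a)"
    by (intro poly_mapping_eqI) (auto simp: lookup_single when_def in_keys_iff)
  moreover have "lookup p ?a * lookup q ?b = 1"
    using prod zero(1) by (simp add: one)
  then have "\<bar>lookup p ?a\<bar> = 1" by (metis zmult_eq_1_iff abs_1 abs_minus)
  ultimately show thesis by (rule that)
qed

lemma UNIV_bit: "UNIV = {0, 1 :: bit}"
  by (auto intro: bit.exhaust)

lemma finite_bit: "finite (A :: bit set)"
  by (rule finite_subset[OF subset_UNIV]) (simp only: UNIV_bit finite.intros)

fun bsign :: "bit \<Rightarrow> int" where "bsign b = (if b = 1 then -1 else 1)"

lemma bsign_add: "bsign (a + b) = bsign a * bsign b"
  by (cases a; cases b) simp_all

text \<open>The specialization \<open>X \<mapsto> (-1)\<^sup>s\<close>, \<open>Y \<mapsto> (-1)\<^sup>t\<close>.\<close>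

definition k_char :: "bit \<Rightarrow> bit \<Rightarrow> kring \<Rightarrow> (int \<Rightarrow>\<^sub>0 int)" where
  "k_char s t = lin_ext (\<lambda>k. single (snd (snd k)) (bsign (s * fst k) * bsign (t * fst (snd k))))"

lemma comm_ring_map_k_char: "comm_ring_map (k_char s t)"
  unfolding k_char_def
  by (rule comm_ring_map_lin_ext_single) (simp_all only: fst_add snd_add fst_zero snd_zero distrib_left bsign_add ac_simps, simp_all)

lemma lookup_k_char:
  "lookup (k_char s t p) n = (\<Sum>a\<in>UNIV. \<Sum>b\<in>UNIV. bsign (s * a) * bsign (t * b) * lookup p (a, b, n))"
proof (induction p rule: poly_mapping_add_induct)
  case (single k v)
  obtain a b m where "k = (a, b, m)" by (metis prod.exhaust)
  then show ?case
    by (cases a; cases b) (auto simp: k_char_def lookup_single when_def UNIV_bit)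
qed (simp add: k_char_def lin_ext_add lookup_add algebra_simps sum.distrib)

text \<open>Parseval's identity for the characters of \<open>\<int>\<^sub>2 \<times> \<int>\<^sub>2\<close>: a unit specializes to four units
  \<open>\<plusminus>Z\<^sup>n\<close>, hence the squares of its coefficients sum to one.\<close>

lemma k_unit:
  assumes "p dvd (1 :: kring)"
  obtains k u where "p = single k u" "\<bar>u\<bar> = 1"
proof -
  obtain q where q: "p * q = 1" using assms by (metis dvdE)
  have "\<exists>n u. k_char s t p = single n u \<and> \<bar>u\<bar> = 1" for s t
  proof -
    interpret comm_ring_map "k_char s t" by (rule comm_ring_map_k_char)
    have "k_char s t p * k_char s t q = 1" by (metis q map_mult map_one)
    then show ?thesis by (metis laurent_unit)
  qed
  then obtain n u where nu: "\<And>s t. k_char s t p = single (n s t) (u s t)" "\<And>s t. \<bar>u s t\<bar> = 1"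
    by metis
  \<comment> \<open>\<open>N\<close> contains all exponents of Z in \<open>p\<close> and in its four
    specializations, so that every sum below runs over the same finite set.\<close>
  define N where "N = (\<Union>s. range (n s)) \<union> (\<lambda>k. snd (snd k)) ` keys p"
  have fin: "finite N" by (simp add: N_def finite_bit)
  let ?S = "\<lambda>m. \<Sum>a\<in>UNIV. \<Sum>b\<in>UNIV. (lookup p (a, b, m))\<^sup>2"
  have parseval: "4 * ?S m = (\<Sum>s\<in>UNIV. \<Sum>t\<in>UNIV. (lookup (k_char s t p) m)\<^sup>2)" for m
    by (simp add: lookup_k_char UNIV_bit power2_eq_square algebra_simps)
  have "(\<Sum>m\<in>N. (lookup (k_char s t p) m)\<^sup>2) = 1" for s t
  proof -
    have "(\<Sum>m\<in>N. (lookup (k_char s t p) m)\<^sup>2) = (\<Sum>m\<in>N. if m = n s t then (u s t)\<^sup>2 else 0)"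
      by (intro sum.cong) (auto simp: nu lookup_single when_def)
    also have "\<dots> = (u s t)\<^sup>2" using fin by (auto simp: N_def)
    also have "\<dots> = 1" using nu(2)[of s t] by (metis one_power2 power2_abs)
    finally show ?thesis .
  qed
  then have "(\<Sum>m\<in>N. 4 * ?S m) = 4"
    unfolding parseval by (simp add: UNIV_bit sum.distrib)
  then have "(\<Sum>m\<in>N. ?S m) = 1" by (simp add: sum_distrib_left[symmetric])
  also have "(\<Sum>m\<in>N. ?S m) = (\<Sum>a\<in>UNIV. \<Sum>b\<in>UNIV. \<Sum>m\<in>N. (lookup p (a, b, m))\<^sup>2)"
    by (simp add: UNIV_bit sum.distrib)
  also have "\<dots> = (\<Sum>k\<in>UNIV \<times> UNIV \<times> N. (lookup p k)\<^sup>2)"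
    by (simp only: sum.cartesian_product case_prod_unfold prod.collapse)
  also have "\<dots> = (\<Sum>k\<in>keys p. (lookup p k)\<^sup>2)"
  proof (rule sum.mono_neutral_right)
    show "finite ((UNIV :: bit set) \<times> (UNIV :: bit set) \<times> N)" using fin by (intro finite_cartesian_product finite_bit)
    show "keys p \<subseteq> UNIV \<times> UNIV \<times> N"
    proof
      fix k assume "k \<in> keys p"
      then have "snd (snd k) \<in> N" by (simp add: N_def)
      then show "k \<in> UNIV \<times> UNIV \<times> N" by (cases k) simp
    qed
  qed (simp add: in_keys_iff)
  finally have sq: "(\<Sum>k\<in>keys p. (lookup p k)\<^sup>2) = 1" .
  then obtain k where k: "k \<in> keys p" by (metis ex_in_conv sum.empty zero_neq_one)
  have pos: "1 \<le> (lookup p k)\<^sup>2" if "k \<in> keys p" for k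
    using that by (simp add: in_keys_iff int_one_le_iff_zero_less)
  have "keys p = {k}"
  proof (rule ccontr)
    assume "keys p \<noteq> {k}"
    then obtain l where l: "l \<in> keys p" "l \<noteq> k" using k by blast
    have "(\<Sum>k\<in>{k, l}. (lookup p k)\<^sup>2) \<le> 1"
      unfolding sq[symmetric] by (rule sum_mono2) (use k l in auto)
    then show False using pos[OF k] pos[OF l(1)] l(2) by simp
  qed
  then have "p = single k (lookup p k)"
    by (intro poly_mapping_eqI) (metis lookup_single when_def in_keys_iff singletonD)
  moreover have "\<bar>lookup p k\<bar> = 1" using sq \<open>keys p = {k}\<close> by (auto simp: power2_eq_1_iff)
  ultimately show thesis by (rule that)
qed

lemma k_unit_homogeneous:
  assumes "p dvd (1 :: kring)"
  shows "\<exists>d. k_homogeneous d p"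
proof -
  obtain k u where "p = single k u" using k_unit[OF assms] by blast
  then show ?thesis by (auto simp: k_homogeneous_def)
qed

section \<open>Saddles\<close>

text \<open>The points fall into pairs \<open>{x, f x}\<close>. Counting parities with this takes
  the place of tracing a circle through the diagram.\<close>

lemma even_card_involution:
  assumes "finite A" "\<And>x. x \<in> A \<Longrightarrow> f x \<in> A \<and> f x \<noteq> x \<and> f (f x) = x"
  shows "even (card A)"
  using assms
proof (induction "card A" arbitrary: A rule: less_induct)
  case less
  show ?case
  proof (cases "A = {}")
    case False
    then obtain x where x: "x \<in> A" by blast
    note fx = less(3)[OF x]
    let ?B = "A - {x, f x}"
    have "insert x (insert (f x) ?B) = A" "finite ?B" "x \<noteq> f x"
      using x fx less(2) by auto
    then have card: "card A = card ?B + 2"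
      by (metis (no_types, lifting) Diff_iff add_2_eq_Suc' card_insert_disjoint finite_insert insertCI insertE)
    have "even (card ?B)"
    proof (rule less(1))
      show "f y \<in> ?B \<and> f y \<noteq> y \<and> f (f y) = y" if "y \<in> ?B" for y
        using that less(3)[of y] less(3)[OF x] by (metis Diff_iff insert_iff singletonD)
    qed (use card less(2) in auto)
    then show ?thesis using card by simp
  qed simp
qed

section \<open>Circles as orbits of ends\<close>

lemma orbit_of_refl: "d \<in> orbit_of D fs d"
  by (simp add: orbit_of_def)

lemma orbit_of_step: "x \<in> orbit_of D fs d \<Longrightarrow> x \<in> darts D \<Longrightarrow> f \<in> fs \<Longrightarrow> f x \<in> orbit_of D fs d"
proof -
  assume x: "x \<in> orbit_of D fs d" "x \<in> darts D" "f \<in> fs"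
  then have "(x, f x) \<in> {(x, f x) | x f. x \<in> darts D \<and> f \<in> fs}" by blast
  with x(1) show ?thesis unfolding orbit_of_def Image_singleton_iff by (rule rtrancl_into_rtrancl)
qed

lemma orbit_of_subset:
  assumes "d \<in> A" "\<And>x f. x \<in> A \<Longrightarrow> x \<in> darts D \<Longrightarrow> f \<in> fs \<Longrightarrow> f x \<in> A"
  shows "orbit_of D fs d \<subseteq> A"
proof
  fix y assume "y \<in> orbit_of D fs d"
  then have "(d, y) \<in> {(x, f x) | x f. x \<in> darts D \<and> f \<in> fs}\<^sup>*" by (simp add: orbit_of_def)
  then show "y \<in> A" by induction (use assms in auto)
qed

locale diagram_with_order =
  fixes D :: diagram and ord :: "nat set \<Rightarrow> circle list"
  assumes diagram: "link_diagram D" and order: "circle_order D ord"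
begin

lemma arc_simps: "d \<in> darts D \<Longrightarrow> arc D d \<in> darts D" "d \<in> darts D \<Longrightarrow> arc D d \<noteq> d"
  "d \<in> darts D \<Longrightarrow> arc D (arc D d) = d"
  using diagram by (auto simp: link_diagram_def)

lemma smooth_simps: "d \<in> darts D \<Longrightarrow> smooth \<xi> d \<in> darts D" "d \<in> darts D \<Longrightarrow> smooth \<xi> d \<noteq> d"
  "d \<in> darts D \<Longrightarrow> smooth \<xi> (smooth \<xi> d) = d"
proof -
  assume "d \<in> darts D"
  then obtain c i where d: "d = (c, i)" "c < crossings D" "i < 4"
    by (auto simp: darts_def)
  then have i: "i = 0 \<or> i = 1 \<or> i = 2 \<or> i = 3" by arith
  show "smooth \<xi> d \<in> darts D" "smooth \<xi> d \<noteq> d" "smooth \<xi> (smooth \<xi> d) = d"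
    using d i by (auto simp: smooth_def darts_def numeral_2_eq_2 numeral_3_eq_3)
qed

lemma finite_darts: "finite (darts D)"
  by (simp add: darts_def)

abbreviation orb :: "nat set \<Rightarrow> dart \<Rightarrow> dart set" where
  "orb \<xi> \<equiv> orbit_of D {arc D, smooth \<xi>}"

lemma orb_darts: "d \<in> darts D \<Longrightarrow> orb \<xi> d \<subseteq> darts D"
  by (rule orbit_of_subset) (auto simp: arc_simps smooth_simps)

lemma orb_step: "d \<in> darts D \<Longrightarrow> x \<in> orb \<xi> d \<Longrightarrow> arc D x \<in> orb \<xi> d \<and> smooth \<xi> x \<in> orb \<xi> d"
  using orb_darts[of d \<xi>] by (auto intro: orbit_of_step)

lemma orb_trans: "d \<in> darts D \<Longrightarrow> x \<in> orb \<xi> d \<Longrightarrow> orb \<xi> x \<subseteq> orb \<xi> d"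
  by (rule orbit_of_subset) (auto intro: orbit_of_step)

text \<open>Orbits are defined by forward steps only. The arcs and the smoothing are involutions, so
  each step can be undone and the orbits partition the ends.\<close>

lemma orb_sym:
  assumes "d \<in> darts D" "x \<in> orb \<xi> d"
  shows "d \<in> orb \<xi> x"
proof -
  have "orb \<xi> d \<subseteq> {x \<in> darts D. d \<in> orb \<xi> x}"
  proof (rule orbit_of_subset)
    fix x f assume x: "x \<in> {x \<in> darts D. d \<in> orb \<xi> x}" "f \<in> {arc D, smooth \<xi>}"
    then have fx: "f x \<in> darts D" "f (f x) = x" by (auto simp: arc_simps smooth_simps)
    have "x \<in> orb \<xi> (f x)"
      using orbit_of_step[OF orbit_of_refl fx(1) x(2)] fx(2) by metis
    then show "f x \<in> {x \<in> darts D. d \<in> orb \<xi> x}"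
      using orb_trans[OF fx(1)] fx(1) x(1) by blast
  qed (use assms in \<open>auto simp: orbit_of_refl\<close>)
  then show ?thesis using assms by auto
qed

lemma orb_eq:
  assumes "d \<in> darts D" "x \<in> orb \<xi> d"
  shows "orb \<xi> x = orb \<xi> d"
proof -
  have "x \<in> darts D" using orb_darts assms by blast
  then show ?thesis using orb_trans[OF assms] orb_trans orb_sym[OF assms] by blast
qed

lemma orb_eq_iff: "d \<in> darts D \<Longrightarrow> orb \<xi> x = orb \<xi> d \<longleftrightarrow> x \<in> orb \<xi> d"
  using orb_eq[of d x \<xi>] orbit_of_refl[of x D] by auto

lemma circ_eq_iff: "d \<in> darts D \<Longrightarrow> circ D \<xi> x = circ D \<xi> d \<longleftrightarrow> x \<in> orb \<xi> d"
  by (simp add: circ_def orb_eq_iff)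

lemma smooth_insert: "fst d \<noteq> c \<Longrightarrow> smooth (insert c \<xi>) d = smooth \<xi> d"
  by (simp add: smooth_def)

text \<open>If the two arcs at \<open>c\<close> lie on different circles, then after the surgery the part of the first
  circle reachable from NW is paired by the arcs, and without NW it is paired by the smoothing.\<close>

lemma merge_right:
  assumes e: "edge D \<xi> c" and ne: "circ D \<xi> (c, 0) \<noteq> circ D \<xi> (c, 1)"
  shows "circ D (insert c \<xi>) (c, 0) = circ D (insert c \<xi>) (c, 3)"
proof (rule ccontr)
  let ?\<xi>' = "insert c \<xi>"
  assume ne': "circ D ?\<xi>' (c, 0) \<noteq> circ D ?\<xi>' (c, 3)"
  have c: "c < crossings D" "c \<notin> \<xi>" using e by (simp_all add: edge_def)
  have dc: "(c, i) \<in> darts D" if "i < 4" for i using c that by (simp add: darts_def)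
  let ?B = "orb \<xi> (c, 0) \<inter> orb ?\<xi>' (c, 0)"
  have c3: "(c, 3) \<notin> ?B" using ne' by (metis IntD2 circ_eq_iff dc zero_less_numeral)
  have c1: "(c, 1) \<notin> ?B" using ne by (metis IntD1 circ_eq_iff dc zero_less_numeral)
  have "smooth \<xi> (c, 2) = (c, 1)" using c by (simp add: smooth_def)
  then have c2: "(c, 2) \<notin> ?B"
    using c1 orb_step[OF dc[of 0], of "(c, 2)" \<xi>] orb_step[OF dc[of 0], of "(c, 1)" ?\<xi>'] c
      orb_step[OF dc[of 0], of "(c, 0)" ?\<xi>'] by (auto simp: smooth_def orbit_of_refl)
  have c0: "(c, 0) \<in> ?B" by (simp add: orbit_of_refl)
  have sub: "?B \<subseteq> darts D" using orb_darts[OF dc[of 0]] by auto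
  then have fin: "finite ?B" using finite_darts finite_subset by blast
  have "even (card ?B)"
    by (rule even_card_involution[of _ "arc D"])
      (use fin sub orb_step[OF dc[of 0]] arc_simps in auto)
  \<comment> \<open>NW is the only end at \<open>c\<close> in \<open>?B\<close>. At all other
    crossings the two smoothings agree, so they preserve the rest of \<open>?B\<close>; a finite set
    and the set with one point removed cannot both have even size.\<close>
  moreover have "even (card (?B - {(c, 0)}))"
  proof (rule even_card_involution[of _ "smooth \<xi>"])
    fix x assume x: "x \<in> ?B - {(c, 0)}"
    have xd: "x \<in> darts D" using x sub by auto
    have "snd x < 4" using xd by (auto simp: darts_def)
    then have fx: "fst x \<noteq> c"
      using x c1 c2 c3 by (cases x) (auto simp: less_Suc_eq numeral_eq_Suc)
    then have "smooth \<xi> x \<in> ?B"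
      using orb_step[OF dc[of 0], of x \<xi>] orb_step[OF dc[of 0], of x ?\<xi>'] smooth_insert[OF fx, of \<xi>] x
      by auto
    moreover have "fst (smooth \<xi> x) \<noteq> c" using fx by (simp add: smooth_def)
    ultimately show "smooth \<xi> x \<in> ?B - {(c, 0)} \<and> smooth \<xi> x \<noteq> x \<and> smooth \<xi> (smooth \<xi> x) = x"
      using smooth_simps[OF xd] by auto
  qed (use fin in auto)
  ultimately show False using c0 fin by (auto simp: card_Diff_singleton card_gt_0_iff)
qed

text \<open>A circle that misses all four ends at \<open>c\<close> never meets the place where the
  smoothings differ. Letting \<open>\<eta>\<close> and \<open>\<eta>'\<close> be either resolution
  covers both directions of the edge.\<close>

lemma circ_other:
  assumes e: "edge D \<xi> c" and d: "d \<in> darts D"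
    and miss: "\<And>i. i < 4 \<Longrightarrow> (c, i) \<notin> orb \<eta> d" and \<eta>: "{\<eta>, \<eta>'} = {\<xi>, insert c \<xi>}"
  shows "circ D \<eta>' d = circ D \<eta> d"
proof -
  have "smooth \<eta>' x = smooth \<eta> x" if "x \<in> orb \<eta> d" for x
  proof -
    have "x \<in> darts D" using that orb_darts[OF d] by auto
    then have "snd x < 4" by (auto simp: darts_def)
    then have "fst x \<noteq> c" using miss[of "snd x"] that by (metis prod.collapse)
    then show ?thesis using \<eta> smooth_insert by (metis doubleton_eq_iff insert_absorb)
  qed
  note sm = this
  have "orb \<eta>' d \<subseteq> orb \<eta> d"
    by (rule orbit_of_subset) (use sm orb_step[OF d] orbit_of_refl in auto)
  moreover have "orb \<eta> d \<subseteq> orb \<eta> d \<inter> orb \<eta>' d"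
    by (rule orbit_of_subset) (use sm orb_step[OF d] orbit_of_refl in \<open>auto, metis\<close>)
  ultimately show ?thesis by (auto simp: circ_def)
qed

end

section \<open>Source and target of the saddle words\<close>

lemma cob_bring: "j < N \<Longrightarrow> cob N (bring N j) N"
proof (induction j)
  case 0
  then show ?case by (simp add: bring_def)
next
  case (Suc j)
  have "bring N (Suc j) = (j, Twist, N - j - 2) # bring N j" by (simp add: bring_def)
  \<comment> \<open>Here \<open>N\<close> is at least 2, so the natural subtraction in the tube
    count does not truncate.\<close>
  moreover have "Suc (Suc (N - 2)) = N" using Suc.prems by simp
  ultimately show ?case using Suc by simp
qed

lemma cob_perm_word:
  "distinct xs \<Longrightarrow> distinct ys \<Longrightarrow> set xs = set ys \<Longrightarrow> cob (length xs) (perm_word xs ys) (length ys)"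
proof (induction ys arbitrary: xs)
  case (Cons y ys)
  have y: "y \<in> set xs" using Cons by auto
  have "length (takeWhile (\<lambda>x. x \<noteq> y) xs) < length xs"
    using y by (induction xs) auto
  then have 1: "cob (length xs) (bring (length xs) (length (takeWhile (\<lambda>x. x \<noteq> y) xs))) (length xs)"
    by (rule cob_bring)
  have "cob (length (remove1 y xs)) (perm_word (remove1 y xs) ys) (length ys)"
    using Cons by (intro Cons.IH) auto
  from cob_tubes[OF this, of 1 0] have "cob (length xs) (tubes 1 0 (perm_word (remove1 y xs) ys)) (length (y # ys))"
    using y by (cases "length xs") (auto simp: length_remove1)
  then show ?case using 1 by (auto simp: cob_append)
qed simp

context diagram_with_order
begin

definition other_circles :: "nat set \<Rightarrow> nat \<Rightarrow> circle set" where
  "other_circles \<xi> c = {circ D \<xi> d | d. d \<in> darts D \<and> (\<forall>i<4. (c, i) \<notin> orb \<xi> d)} \<union> Inr ` {..<loops D}"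

text \<open>This is what lets the list \<open>rest\<close> in \<open>saddle\<close>, extracted from
  the circles before the surgery, also enumerate the untouched circles after it.\<close>

lemma other_circles_insert:
  assumes e: "edge D \<xi> c"
  shows "other_circles (insert c \<xi>) c = other_circles \<xi> c"
proof -
  have "\<exists>d'. circ D \<eta> d = circ D \<eta>' d' \<and> d' \<in> darts D \<and> (\<forall>i<4. (c, i) \<notin> orb \<eta>' d')"
    if "d \<in> darts D" "\<forall>i<4. (c, i) \<notin> orb \<eta> d" "{\<eta>, \<eta>'} = {\<xi>, insert c \<xi>}" for d \<eta> \<eta>'
  proof -
    have "circ D \<eta>' d = circ D \<eta> d" by (rule circ_other[OF e]) (use that in auto)
    then show ?thesis using that by (metis circ_def sum.inject(1))
  qed
  note this[of _ "insert c \<xi>" \<xi>] this[of _ \<xi> "insert c \<xi>"]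
  then show ?thesis unfolding other_circles_def
    by (intro arg_cong2[where f = "(\<union>)"] refl) (auto simp: insert_commute)
qed

lemma circles_split:
  assumes c: "c < crossings D"
  shows "circles D \<xi> = (\<lambda>i. circ D \<xi> (c, i)) ` {..<4} \<union> other_circles \<xi> c"
    and "i < 4 \<Longrightarrow> circ D \<xi> (c, i) \<notin> other_circles \<xi> c"
proof -
  have dc: "(c, i) \<in> darts D" if "i < 4" for i using c that by (simp add: darts_def)
  have "circ D \<xi> d \<in> (\<lambda>i. circ D \<xi> (c, i)) ` {..<4} \<union> other_circles \<xi> c" if "d \<in> darts D" for d
  proof (cases "\<forall>i<4. (c, i) \<notin> orb \<xi> d")
    case True
    then show ?thesis using that unfolding other_circles_def by blast
  next
    case False
    then obtain i where "i < 4" "(c, i) \<in> orb \<xi> d" by blast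
    then show ?thesis using circ_eq_iff[OF that] by (metis UnI1 image_eqI lessThan_iff)
  qed
  then show "circles D \<xi> = (\<lambda>i. circ D \<xi> (c, i)) ` {..<4} \<union> other_circles \<xi> c"
    using dc unfolding circles_def by (auto simp: other_circles_def)
  show "circ D \<xi> (c, i) \<notin> other_circles \<xi> c" if "i < 4"
    using that circ_eq_iff by (auto simp: other_circles_def) (auto simp: circ_def)
qed

lemma circ_at_crossing:
  assumes "edge D \<xi> c"
  shows "circ D \<xi> (c, 3) = circ D \<xi> (c, 0)" "circ D \<xi> (c, 2) = circ D \<xi> (c, 1)"
    "circ D (insert c \<xi>) (c, 1) = circ D (insert c \<xi>) (c, 0)"
    "circ D (insert c \<xi>) (c, 2) = circ D (insert c \<xi>) (c, 3)"
proof -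
  have dc: "(c, i) \<in> darts D" if "i < 4" for i using assms that by (simp add: darts_def edge_def)
  have "circ D \<eta> (smooth \<eta> (c, i)) = circ D \<eta> (c, i)" if "i < 4" for \<eta> i
    using orb_step[OF dc[OF that] orbit_of_refl] circ_eq_iff[OF dc[OF that]] by blast
  from this[of 0 \<xi>] this[of 1 \<xi>] this[of 0 "insert c \<xi>"] this[of 3 "insert c \<xi>"] assms
  show "circ D \<xi> (c, 3) = circ D \<xi> (c, 0)" "circ D \<xi> (c, 2) = circ D \<xi> (c, 1)"
    "circ D (insert c \<xi>) (c, 1) = circ D (insert c \<xi>) (c, 0)"
    "circ D (insert c \<xi>) (c, 2) = circ D (insert c \<xi>) (c, 3)"
    by (simp_all add: smooth_def edge_def)
qed

lemma circles_edge:
  assumes e: "edge D \<xi> c"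
  shows "set (ord \<xi>) = {circ D \<xi> (c, 0), circ D \<xi> (c, 1)} \<union> other_circles \<xi> c"
    "set (ord (insert c \<xi>)) = {circ D (insert c \<xi>) (c, 0), circ D (insert c \<xi>) (c, 3)} \<union> other_circles \<xi> c"
    "distinct (ord \<xi>)" "distinct (ord (insert c \<xi>))"
    "circ D \<xi> (c, 0) \<notin> other_circles \<xi> c" "circ D \<xi> (c, 1) \<notin> other_circles \<xi> c"
    "circ D (insert c \<xi>) (c, 0) \<notin> other_circles \<xi> c" "circ D (insert c \<xi>) (c, 3) \<notin> other_circles \<xi> c"
proof -
  have v: "\<xi> \<in> vertices D" "insert c \<xi> \<in> vertices D" "c < crossings D"
    using e by (auto simp: edge_def vertices_def)
  show "distinct (ord \<xi>)" "distinct (ord (insert c \<xi>))"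
    using order v by (auto simp: circle_order_def)
  have 4: "{..<4} = {0, 1, 2, 3 :: nat}" by auto
  have "set (ord \<xi>) = circles D \<xi>" "set (ord (insert c \<xi>)) = circles D (insert c \<xi>)"
    using order v by (auto simp: circle_order_def)
  then show "set (ord \<xi>) = {circ D \<xi> (c, 0), circ D \<xi> (c, 1)} \<union> other_circles \<xi> c"
    "set (ord (insert c \<xi>)) = {circ D (insert c \<xi>) (c, 0), circ D (insert c \<xi>) (c, 3)} \<union> other_circles \<xi> c"
    unfolding circles_split(1)[OF v(3)] other_circles_insert[OF e] 4
    using circ_at_crossing[OF e] by auto
  show "circ D \<xi> (c, 0) \<notin> other_circles \<xi> c" "circ D \<xi> (c, 1) \<notin> other_circles \<xi> c"
    "circ D (insert c \<xi>) (c, 0) \<notin> other_circles \<xi> c" "circ D (insert c \<xi>) (c, 3) \<notin> other_circles \<xi> c"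
    using circles_split(2)[OF v(3), of _ \<xi>] circles_split(2)[OF v(3), of _ "insert c \<xi>"]
    unfolding other_circles_insert[OF e] by simp_all
qed

text \<open>The permutation words have the right type once the lists they connect have the same
  entries. For a merge, this requires a single circle at \<open>c\<close> afterwards, which
  \<open>merge_right\<close> supplies.\<close>

lemma cob_saddle:
  assumes e: "edge D \<xi> c"
  shows "cob (length (ord \<xi>)) (saddle D ord \<xi> c) (length (ord (insert c \<xi>)))"
proof -
  define upper lower left right where
    circs: "upper = circ D \<xi> (c, 0)" "lower = circ D \<xi> (c, 1)"
      "left = circ D (insert c \<xi>) (c, 0)" "right = circ D (insert c \<xi>) (c, 3)"
  define rest where "rest = filter (\<lambda>z. z \<noteq> upper \<and> z \<noteq> lower) (ord \<xi>)"
  note ce = circles_edge[OF e, folded circs]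
  have rest: "set rest = other_circles \<xi> c" "distinct rest"
    using ce by (auto simp: rest_def)
  have len: "length (ord \<xi>) = card (set (ord \<xi>))" "length (ord (insert c \<xi>)) = card (set (ord (insert c \<xi>)))"
    using ce distinct_card by metis+
  have sad: "saddle D ord \<xi> c = (if upper \<noteq> lower
         then perm_word (ord \<xi>)
                ((if arrow_down D c then [lower, upper] else [upper, lower]) @ rest)
              @ [(0, Merge, length rest)] @ perm_word (left # rest) (ord (insert c \<xi>))
         else if left \<noteq> right
         then perm_word (ord \<xi>) (upper # rest) @ [(0, Split, length rest)]
              @ perm_word ((if arrow_down D c then [right, left] else [left, right]) @ rest) (ord (insert c \<xi>))
         else [])"
    unfolding saddle_def Let_def circs rest_def by (rule refl)
  consider "upper \<noteq> lower" | "upper = lower" "left \<noteq> right" | "upper = lower" "left = right" by blast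
  then show ?thesis
  proof cases
    case 1
    then have lr: "left = right" using merge_right[OF e] circs by simp
    let ?in = "(if arrow_down D c then [lower, upper] else [upper, lower]) @ rest"
    have "cob (length (ord \<xi>)) (perm_word (ord \<xi>) ?in) (length ?in)"
      by (rule cob_perm_word) (use 1 ce rest in auto)
    moreover have "cob (length (left # rest)) (perm_word (left # rest) (ord (insert c \<xi>))) (length (ord (insert c \<xi>)))"
      by (rule cob_perm_word) (use lr ce rest in auto)
    ultimately show ?thesis using 1 by (auto simp: sad cob_append)
  next
    case 2
    let ?out = "(if arrow_down D c then [right, left] else [left, right]) @ rest"
    have "cob (length (ord \<xi>)) (perm_word (ord \<xi>) (upper # rest)) (length (upper # rest))"
      by (rule cob_perm_word) (use 2 ce rest in auto)
    moreover have "cob (length ?out) (perm_word ?out (ord (insert c \<xi>))) (length (ord (insert c \<xi>)))"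
      by (rule cob_perm_word) (use 2 ce rest in auto)
    ultimately show ?thesis using 2 by (auto simp: sad cob_append)
  next
    \<comment> \<open>Before and after there is one circle at \<open>c\<close> and the same other
      circles, so the empty word has matching ends.\<close>
    case 3
    then show ?thesis
      unfolding len sad using ce rest(1) finite_set[of rest] by simp
  qed
qed

end

section \<open>Splitting degrees along the cube\<close>

text \<open>The ring map with X, Y, Z sent to 1. It sends every coefficient in the tables and every
  \<open>lam\<close> to 0 or 1, which rules out cancellation.\<close>

definition augmentation :: "kring \<Rightarrow> int" where
  "augmentation p = (\<Sum>k\<in>keys p. lookup p k)"

lemma augmentation_single [simp]: "augmentation (single k v) = v"
  by (simp add: augmentation_def)

lemma k_algebra_augmentation: "k_algebra augmentation"
proof
  show add: "augmentation (x + y) = augmentation x + augmentation y" for x y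
    unfolding augmentation_def by (rule setsum_keys_plus_distrib) simp_all
  show "augmentation 1 = 1"
    by (metis augmentation_single single_one)
  show "augmentation (x * y) = augmentation x * augmentation y" for x y
  proof (induction x rule: poly_mapping_add_induct)
    case (single k v)
    show ?case
      by (induction y rule: poly_mapping_add_induct) (simp_all add: mult_single add algebra_simps)
  qed (simp add: distrib_right add)
qed

lemma augmentation_lam [simp]: "augmentation (lam d e) = 1"
  by (cases d; cases e) simp

lemma augmentation_generators [simp]:
  "augmentation Xk = 1" "augmentation Yk = 1" "augmentation Zk = 1"
  "augmentation (Xk * Zk) = 1" "augmentation (Yk * Zk) = 1"
  by (simp_all add: Xk_Zk) (simp_all add: Xk_def Yk_def Zk_def)

definition nonneg :: "('b \<Rightarrow>\<^sub>0 int) \<Rightarrow> bool" where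
  "nonneg u \<longleftrightarrow> (\<forall>y. 0 \<le> lookup u y)"

lemma nonneg_lin_ext: "nonneg u \<Longrightarrow> (\<And>x. nonneg (f x)) \<Longrightarrow> nonneg (lin_ext f u)"
  by (simp add: nonneg_def lookup_lin_ext sum_nonneg)

text \<open>All terms of the sum are nonnegative, so one positive contribution is enough.\<close>

lemma lin_ext_pos:
  assumes "nonneg u" "\<And>x. nonneg (f x)" "0 < lookup u x" "0 < lookup (f x) y"
  shows "0 < lookup (lin_ext f u) y"
proof -
  have "0 < lookup u x * lookup (f x) y" using assms by simp
  also have "\<dots> = (\<Sum>x\<in>{x}. lookup u x * lookup (f x) y)" by simp
  also have "\<dots> \<le> (\<Sum>x\<in>keys u. lookup u x * lookup (f x) y)"
    using assms by (intro sum_mono2) (auto simp: nonneg_def in_keys_iff)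
  finally show ?thesis by (simp add: lookup_lin_ext)
qed

lemma nonneg_single: "0 \<le> v \<Longrightarrow> nonneg (single x v)"
  by (simp add: nonneg_def lookup_single when_def)

lemma nonneg_F_gen: "nonneg (F_gen augmentation g xs)"
  by (cases "(augmentation, g, xs)" rule: F_gen.cases)
    (simp_all add: nonneg_def lookup_add lookup_single when_def del: lam.simps)

lemma F_layer_augmentation:
  "F_layer augmentation (k, g, l) xs = lin_ext (\<lambda>ys. single (take k xs @ ys @ drop (k + gin g) xs) 1)
    (F_gen augmentation g (take (gin g) (drop k xs)))"
  by simp

lemma nonneg_F_layer: "nonneg (F_layer augmentation L xs)"
  by (cases L) (simp add: F_layer_augmentation nonneg_lin_ext nonneg_F_gen nonneg_single del: F_layer.simps)

lemma nonneg_F_word: "nonneg (F_word augmentation w xs)"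
  by (induction w arbitrary: xs) (simp_all add: nonneg_single nonneg_lin_ext nonneg_F_layer del: F_layer.simps)

definition saddle_gens :: "word \<Rightarrow> bool" where
  "saddle_gens w \<longleftrightarrow> (\<forall>(k, g, l)\<in>set w. g \<in> {Twist, Split, Merge})"

definition saddle_count :: "word \<Rightarrow> nat" where
  "saddle_count w = length (filter (\<lambda>(k, g, l). g \<noteq> Twist) w)"

lemma saddle_gens_simps [simp]: "saddle_gens []"
  "saddle_gens ((k, g, l) # w) \<longleftrightarrow> g \<in> {Twist, Split, Merge} \<and> saddle_gens w"
  "saddle_gens (u @ v) \<longleftrightarrow> saddle_gens u \<and> saddle_gens v" "saddle_gens (tubes i j w) \<longleftrightarrow> saddle_gens w"
  by (auto simp: saddle_gens_def tubes_def) force+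

lemma saddle_count_simps [simp]: "saddle_count [] = 0"
  "saddle_count ((k, g, l) # w) = (if g = Twist then 0 else 1) + saddle_count w"
  "saddle_count (u @ v) = saddle_count u + saddle_count v" "saddle_count (tubes i j w) = saddle_count w"
  by (auto simp: saddle_count_def tubes_def filter_map o_def case_prod_unfold)

lemma saddle_gens_bring: "saddle_gens (bring N j)" "saddle_count (bring N j) = 0"
  by (auto simp: bring_def saddle_gens_def saddle_count_def)

lemma saddle_gens_perm_word: "saddle_gens (perm_word xs ys)" "saddle_count (perm_word xs ys) = 0"
  by (induction xs ys rule: perm_word.induct) (simp_all add: saddle_gens_bring)

lemma saddle_gens_saddle: "saddle_gens (saddle D ord \<xi> c)" "saddle_count (saddle D ord \<xi> c) \<le> 1"
  by (auto simp: saddle_def Let_def saddle_gens_perm_word saddle_gens_bring)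

text \<open>The coefficients of \<open>\<F>\<close> are sums of monomials with positive signs, so nothing cancels, and a
  merge is applied to \<open>v\<^sub>- \<otimes> v\<^sub>-\<close> on every basis element only if there were two splits before it.\<close>

lemma F_word_saddles_pos:
  "cob m w n \<Longrightarrow> length xs = m \<Longrightarrow> saddle_gens w \<Longrightarrow> saddle_count w + count_list xs Vm \<le> 2 \<Longrightarrow>
     \<exists>ys. 0 < lookup (F_word augmentation w xs) ys"
proof (induction m w n arbitrary: xs rule: cob.induct)
  case (1 m n)
  then show ?case by (metis F_word.simps(1) lookup_single_eq zero_less_one)
next
  case (2 m k g l w n)
  define x where "x = take (gin g) (drop k xs)"
  have len: "length xs = k + gin g + l" "length x = gin g" and w: "cob (k + gout g + l) w n"
    using 2 by (auto simp: x_def)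
  have g: "g \<in> {Twist, Split, Merge}" using 2 by simp
  have "count_list xs Vm = count_list (take k xs) Vm + (count_list x Vm + count_list (drop (gin g) (drop k xs)) Vm)"
    unfolding x_def by (metis append_take_drop_id count_list_append)
  then have cx: "count_list x Vm \<le> count_list xs Vm" by simp
  have "\<exists>z. 0 < lookup (F_gen augmentation g x) z"
  proof (cases rule: F_gen_cases[OF len(2)])
    \<comment> \<open>A merge applied to two entries \<open>Vm\<close>: with the merge itself these
      would already count 3, above the bound.\<close>
    case 4
    then show ?thesis using cx 2(5) by simp
  next
    case 5
    then have "0 < lookup (F_gen augmentation g x) [Vm, Vp]" by (simp add: lookup_add lookup_single)
    then show ?thesis by blast
  qed (use g in \<open>auto intro: exI[of _ "[_]"] exI[of _ "[_, _]"] simp: lookup_single when_def simp del: lam.simps\<close>)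
  then obtain z where z: "0 < lookup (F_gen augmentation g x) z" by blast
  define y where "y = take k xs @ z @ drop (k + gin g) xs"
  have y: "0 < lookup (F_layer augmentation (k, g, l) xs) y"
    unfolding F_layer_augmentation x_def[symmetric]
    by (rule lin_ext_pos[OF nonneg_F_gen _ z]) (simp_all add: nonneg_single y_def)
  then have "y \<in> keys (F_layer augmentation (k, g, l) xs)" by (simp add: in_keys_iff del: F_layer.simps)
  then have "length y = k + gout g + l" "vdeg y = vdeg xs + gdeg g"
    using F_layer_keys[OF len(1)] by metis+
  \<comment> \<open>A split adds one \<open>Vm\<close> but uses up one saddle; merges and twists add
    none. So the bound carries over to the remaining word.\<close>
  moreover from this(2) have "count_list y Vm \<le> count_list xs Vm + (if g = Split then 1 else 0)"
    using g by (auto simp: vdeg_def)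
  then have "saddle_count w + count_list y Vm \<le> 2"
    using 2(5) by (auto split: if_splits)
  ultimately obtain ys where "0 < lookup (F_word augmentation w y) ys"
    using 2(1)[OF w, of y] 2(4) by auto
  then have "0 < lookup (F_word augmentation ((k, g, l) # w) xs) ys"
    unfolding F_word.simps by (intro lin_ext_pos[OF nonneg_F_layer _ y] nonneg_F_word)
  then show ?case by blast
qed

text \<open>The vector with \<open>Vp\<close> on every circle contains no \<open>Vm\<close>, so two
  saddles are within the bound, and a value with nonzero augmentation is nonzero.\<close>

lemma F_word_saddles_nonzero:
  assumes "cob m w n" "saddle_gens w" "saddle_count w \<le> 2"
  shows "F_word id w (replicate m Vp) \<noteq> 0"
proof
  interpret k_algebra augmentation by (rule k_algebra_augmentation)
  assume "F_word id w (replicate m Vp) = 0"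
  then have "F_word augmentation w (replicate m Vp) = 0"
    using map_F_word[of w "replicate m Vp"] by simp
  moreover have "count_list (replicate m Vp) Vm = 0"
    by (induction m) simp_all
  ultimately show False
    using F_word_saddles_pos[OF assms(1) _ assms(2), of "replicate m Vp"] assms(3) by simp
qed

section \<open>Faces, edge degrees and independence of the path\<close>

locale cube = diagram_with_order +
  fixes \<psi> :: "nat set \<Rightarrow> nat \<Rightarrow> nat \<Rightarrow> kring" and \<epsilon> :: "nat set \<Rightarrow> nat \<Rightarrow> kring"
  assumes cocycle: "commutation_cocycle D ord \<psi>" and signs: "sign_assignment D \<psi> \<epsilon>"
begin

lemma face_edges:
  assumes "edge D \<xi> c" "edge D \<xi> c'" "c \<noteq> c'"
  shows "edge D (insert c \<xi>) c'"
  using assms by (auto simp: edge_def vertices_def)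

lemma cob_two_saddles:
  assumes "edge D \<xi> c" "edge D \<xi> c'" "c \<noteq> c'"
  shows "cob (length (ord \<xi>)) (saddle D ord \<xi> c @ saddle D ord (insert c \<xi>) c') (length (ord (insert c' (insert c \<xi>))))"
  using cob_saddle[OF assms(1)] cob_saddle[OF face_edges[OF assms]] by (auto simp: cob_append)

text \<open>Equal classes have equal values, so \<open>\<psi>\<close> becomes a scalar between the
  two composites, and the sign condition turns it into -1. Faces are indexed with
  \<open>c < c'\<close>; the identity is symmetric, so either order follows.\<close>

lemma face_anticommute:
  assumes "edge D \<xi> c" "edge D \<xi> c'" "c \<noteq> c'" "length xs = length (ord \<xi>)"
  shows "scale (\<epsilon> (insert c \<xi>) c' * \<epsilon> \<xi> c) (F_word id (saddle D ord \<xi> c @ saddle D ord (insert c \<xi>) c') xs)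
    = - scale (\<epsilon> (insert c' \<xi>) c * \<epsilon> \<xi> c') (F_word id (saddle D ord \<xi> c' @ saddle D ord (insert c' \<xi>) c) xs)"
proof -
  have *: "scale (\<epsilon> (insert c \<xi>) c' * \<epsilon> \<xi> c) (F_word id (saddle D ord \<xi> c @ saddle D ord (insert c \<xi>) c') xs)
    = - scale (\<epsilon> (insert c' \<xi>) c * \<epsilon> \<xi> c') (F_word id (saddle D ord \<xi> c' @ saddle D ord (insert c' \<xi>) c) xs)"
    if f: "face D \<xi> c c'" for c c'
  proof -
    let ?w = "saddle D ord \<xi> c @ saddle D ord (insert c \<xi>) c'"
    let ?w' = "saddle D ord \<xi> c' @ saddle D ord (insert c' \<xi>) c"
    let ?n = "length (ord (insert c (insert c' \<xi>)))"
    have e: "edge D \<xi> c" "edge D \<xi> c'" "c \<noteq> c'" using f by (auto simp: face_def)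
    have cobs: "cob (length (ord \<xi>)) ?w ?n" "cob (length (ord \<xi>)) ?w' ?n"
      using cob_two_saddles[OF e] cob_two_saddles[OF e(2,1) e(3)[symmetric]] by (simp_all add: insert_commute)
    have "chcob_class id (length (ord \<xi>)) ?n (single ?w 1) = chcob_class id (length (ord \<xi>)) ?n (single ?w' (\<psi> \<xi> c c'))"
      using cocycle f by (auto simp: commutation_cocycle_def Let_def)
    moreover have "F_mor id (chcob_class id (length (ord \<xi>)) ?n (single ?w 1)) xs = F_comb id (single ?w 1) xs"
      by (rule k_id.F_mor_class[OF _ assms(4)]) (use cobs in simp)
    moreover have "F_mor id (chcob_class id (length (ord \<xi>)) ?n (single ?w' (\<psi> \<xi> c c'))) xs
        = F_comb id (single ?w' (\<psi> \<xi> c c')) xs"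
      by (rule k_id.F_mor_class[OF _ assms(4)]) (use cobs in \<open>simp split: if_splits\<close>)
    ultimately have "F_comb id (single ?w 1) xs = F_comb id (single ?w' (\<psi> \<xi> c c')) xs"
      by metis
    then have "F_word id ?w xs = scale (\<psi> \<xi> c c') (F_word id ?w' xs)"
      by (simp add: F_comb_def)
    moreover have "\<epsilon> (insert c \<xi>) c' * \<epsilon> \<xi> c * \<psi> \<xi> c c' = - (\<epsilon> (insert c' \<xi>) c * \<epsilon> \<xi> c')"
      using signs f by (auto simp: sign_assignment_def)
    ultimately show ?thesis by (simp add: scale_uminus)
  qed
  consider "face D \<xi> c c'" | "face D \<xi> c' c" using assms by (force simp: face_def)
  then show ?thesis by cases (use * in auto)
qed

text \<open>On an edge the coefficient is a unit, hence a single signed monomial, so exactly one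
  degree is available to the choice operator.\<close>

definition edge_sdeg :: "nat set \<Rightarrow> nat \<Rightarrow> sdegree" where
  "edge_sdeg \<xi> c = (SOME e. k_homogeneous e (\<epsilon> \<xi> c)) + wsdeg (saddle D ord \<xi> c)"

lemma edge_unit:
  assumes "edge D \<xi> c"
  obtains k u where "\<epsilon> \<xi> c = single k u" "\<bar>u\<bar> = 1"
  using signs assms k_unit by (metis sign_assignment_def)

lemma edge_homogeneous:
  assumes "edge D \<xi> c"
  shows "k_homogeneous e (\<epsilon> \<xi> c) \<longleftrightarrow> e + wsdeg (saddle D ord \<xi> c) = edge_sdeg \<xi> c"
proof -
  obtain k u where "\<epsilon> \<xi> c = single k u" "\<bar>u\<bar> = 1" using edge_unit[OF assms] .
  then have "k_homogeneous e (\<epsilon> \<xi> c) \<longleftrightarrow> e = mono_sdeg k" for e by (auto simp: k_homogeneous_def)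
  then show ?thesis by (simp add: edge_sdeg_def)
qed

lemma edge_keys_sdeg:
  assumes "edge D \<xi> c" "k \<in> keys (\<epsilon> \<xi> c)"
  shows "mono_sdeg k + wsdeg (saddle D ord \<xi> c) = edge_sdeg \<xi> c"
proof -
  obtain l u where "\<epsilon> \<xi> c = single l u" using edge_unit[OF assms(1)] .
  then have "k_homogeneous (mono_sdeg k) (\<epsilon> \<xi> c)"
    using assms(2) by (auto simp: k_homogeneous_def split: if_splits)
  then show ?thesis using edge_homogeneous[OF assms(1)] by simp
qed

lemma face_keys_sdeg:
  assumes e: "edge D \<xi> c" "edge D \<xi> c'" "c \<noteq> c'" and xs: "length xs = length (ord \<xi>)"
    and k: "k \<in> keys (lookup (scale (\<epsilon> (insert c \<xi>) c' * \<epsilon> \<xi> c)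
      (F_word id (saddle D ord \<xi> c @ saddle D ord (insert c \<xi>) c') xs)) y)"
  shows "mono_sdeg k + basis_sdeg y = basis_sdeg xs + (edge_sdeg \<xi> c + edge_sdeg (insert c \<xi>) c')"
proof -
  obtain a b where ab: "a \<in> keys (\<epsilon> (insert c \<xi>) c' * \<epsilon> \<xi> c)" "k = a + b"
    "b \<in> keys (lookup (F_word id (saddle D ord \<xi> c @ saddle D ord (insert c \<xi>) c') xs) y)"
    using keys_lookup_scale[OF k] by metis
  obtain a1 a2 where a: "a1 \<in> keys (\<epsilon> (insert c \<xi>) c')" "a2 \<in> keys (\<epsilon> \<xi> c)" "a = a1 + a2"
    using ab(1) Poly_Mapping.keys_mult by blast
  have "mono_sdeg b + basis_sdeg y = basis_sdeg xs + (wsdeg (saddle D ord \<xi> c) + wsdeg (saddle D ord (insert c \<xi>) c'))"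
    using F_word_sdeg[OF cob_two_saddles[OF e] xs ab(3)] by simp
  then show ?thesis
    unfolding edge_keys_sdeg[OF e(1) a(2), symmetric] edge_keys_sdeg[OF face_edges[OF e] a(1), symmetric]
      ab(2) a(3) mono_sdeg_add by (metis (no_types, opaque_lifting) add.assoc add.commute)
qed

text \<open>The two corrected composites agree up to sign, so a monomial occurring in one occurs in
  the other at the same basis vector. Its degree, computed along both paths, gives the equation;
  nonvanishing ensures that such a monomial exists.\<close>

lemma face_sdeg:
  assumes e: "edge D \<xi> c" "edge D \<xi> c'" "c \<noteq> c'"
  shows "edge_sdeg \<xi> c + edge_sdeg (insert c \<xi>) c' = edge_sdeg \<xi> c' + edge_sdeg (insert c' \<xi>) c"
proof -
  let ?xs = "replicate (length (ord \<xi>)) Vp"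
  let ?w = "saddle D ord \<xi> c @ saddle D ord (insert c \<xi>) c'"
  have "F_word id ?w ?xs \<noteq> 0"
    using saddle_gens_saddle[of D ord \<xi> c] saddle_gens_saddle[of D ord "insert c \<xi>" c']
    by (intro F_word_saddles_nonzero[OF cob_two_saddles[OF e]]) auto
  \<comment> \<open>In a ring with zero divisors scaling may kill a nonzero vector; for a unit, the
    inverse recovers it.\<close>
  moreover have "scale (v * u) z \<noteq> 0" if z: "z \<noteq> 0" "u dvd 1" "v dvd 1" for u v :: kring and z :: "sgn list \<Rightarrow>\<^sub>0 kring"
  proof
    obtain q where "v * u * q = 1" using z(2,3) by (metis dvdE mult_dvd_mono mult_1)
    moreover assume "scale (v * u) z = 0"
    then have "scale q (scale (v * u) z) = 0" by simp
    ultimately show False using z(1) by (simp add: mult.commute)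
  qed
  ultimately have "scale (\<epsilon> (insert c \<xi>) c' * \<epsilon> \<xi> c) (F_word id ?w ?xs) \<noteq> 0"
    using signs e face_edges[OF e] by (metis sign_assignment_def)
  then obtain y where "lookup (scale (\<epsilon> (insert c \<xi>) c' * \<epsilon> \<xi> c) (F_word id ?w ?xs)) y \<noteq> 0"
    by (metis lookup_zero poly_mapping_eqI)
  then obtain k where k: "k \<in> keys (lookup (scale (\<epsilon> (insert c \<xi>) c' * \<epsilon> \<xi> c) (F_word id ?w ?xs)) y)"
    by (metis in_keys_iff lookup_zero poly_mapping_eqI)
  have "k \<in> keys (lookup (scale (\<epsilon> (insert c' \<xi>) c * \<epsilon> \<xi> c')
      (F_word id (saddle D ord \<xi> c' @ saddle D ord (insert c' \<xi>) c) ?xs)) y)"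
    using k unfolding face_anticommute[OF e length_replicate] in_keys_iff by simp
  from face_keys_sdeg[OF e(2,1) e(3)[symmetric] length_replicate this] face_keys_sdeg[OF e length_replicate k]
  show ?thesis by simp
qed

lemma path_vertex: "path_sdeg D ord \<epsilon> \<xi> d \<Longrightarrow> \<xi> \<in> vertices D"
  by (induction rule: path_sdeg.induct) (auto simp: edge_def vertices_def)

lemma path_exists:
  assumes "\<xi> \<in> vertices D"
  shows "\<exists>d. path_sdeg D ord \<epsilon> \<xi> d"
proof -
  have "finite \<xi>" "\<xi> \<subseteq> {..<crossings D}" using assms finite_subset by (auto simp: vertices_def)
  then show ?thesis
  proof (induction \<xi>)
    case (insert c \<xi>)
    then obtain d where d: "path_sdeg D ord \<epsilon> \<xi> d" by auto
    have e: "edge D \<xi> c" using insert by (auto simp: edge_def vertices_def)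
    then obtain k where "k_homogeneous k (\<epsilon> \<xi> c)"
      using k_unit_homogeneous signs by (metis sign_assignment_def)
    then show ?case using path_sdeg.step[OF d e] by blast
  qed (use path_sdeg.start in blast)
qed

lemma path_sdeg_last_edge:
  assumes "path_sdeg D ord \<epsilon> \<xi> d" "\<xi> \<noteq> {}"
  obtains \<eta> c d' where "\<xi> = insert c \<eta>" "edge D \<eta> c" "path_sdeg D ord \<epsilon> \<eta> d'" "d = d' + edge_sdeg \<eta> c"
  using assms(1)
proof cases
  case (step \<eta> d' c e)
  then show ?thesis using that edge_homogeneous by metis
qed (use assms in simp)

text \<open>A diamond argument: two paths whose last edges have different directions are both
  compared with a path to the vertex lacking these two directions, and the face above that vertex
  closes the diamond.\<close>

lemma path_unique: "path_sdeg D ord \<epsilon> \<xi> d \<Longrightarrow> path_sdeg D ord \<epsilon> \<xi> d' \<Longrightarrow> d = d'"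
proof (induction "card \<xi>" arbitrary: \<xi> d d' rule: less_induct)
  case less
  have fin: "finite \<xi>" using path_vertex[OF less(2)] finite_subset by (auto simp: vertices_def)
  show ?case
  proof (cases "\<xi> = {}")
    case True
    then show ?thesis using less(2,3) by (auto elim: path_sdeg.cases)
  next
    case False
    obtain \<eta> c a where 1: "\<xi> = insert c \<eta>" "edge D \<eta> c" "path_sdeg D ord \<epsilon> \<eta> a" "d = a + edge_sdeg \<eta> c"
      using path_sdeg_last_edge[OF less(2) False] .
    obtain \<eta>' c' a' where 2: "\<xi> = insert c' \<eta>'" "edge D \<eta>' c'" "path_sdeg D ord \<epsilon> \<eta>' a'" "d' = a' + edge_sdeg \<eta>' c'"
      using path_sdeg_last_edge[OF less(3) False] .
    have cs: "c \<notin> \<eta>" "c' \<notin> \<eta>'" using 1 2 by (auto simp: edge_def)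
    have "card \<xi> = Suc (card \<eta>)" using 1(1) cs fin by simp
    moreover have "card \<xi> = Suc (card \<eta>')" using 2(1) cs fin by simp
    ultimately have card: "card \<eta> < card \<xi>" "card \<eta>' < card \<xi>" by simp_all
    show ?thesis
    proof (cases "c = c'")
      case True
      then have "\<eta> = \<eta>'" using 1(1) 2(1) cs by (metis insert_ident)
      then show ?thesis using less(1)[OF card(1) 1(3)] 2 1 True by simp
    next
      case False
      define \<zeta> where "\<zeta> = \<eta> - {c'}"
      have \<eta>: "\<eta> = insert c' \<zeta>" "\<eta>' = insert c \<zeta>"
        using 1(1) 2(1) cs False by (auto simp: \<zeta>_def)
      have e: "edge D \<zeta> c" "edge D \<zeta> c'"
        using 1 2 cs False by (auto simp: \<zeta>_def edge_def vertices_def)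
      obtain b where b: "path_sdeg D ord \<epsilon> \<zeta> b"
        using path_exists e unfolding edge_def by blast
      have step: "path_sdeg D ord \<epsilon> (insert x \<zeta>) (b + edge_sdeg \<zeta> x)" if x: "edge D \<zeta> x" for x
      proof -
        obtain k where k: "k_homogeneous k (\<epsilon> \<zeta> x)"
          using k_unit_homogeneous signs x by (metis sign_assignment_def)
        from path_sdeg.step[OF b x k] show ?thesis using k edge_homogeneous[OF x] by simp
      qed
      have "a = b + edge_sdeg \<zeta> c'"
        using less(1)[OF card(1) 1(3)] step[OF e(2)] \<eta>(1) by simp
      moreover have "a' = b + edge_sdeg \<zeta> c"
        using less(1)[OF card(2) 2(3)] step[OF e(1)] \<eta>(2) by simp
      ultimately show ?thesis
        using face_sdeg[OF e False] 1(4) 2(4) \<eta> by (simp add: add.assoc)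
    qed
  qed
qed

lemma vertex_sdeg_insert:
  assumes "edge D \<xi> c"
  shows "vertex_sdeg D ord \<epsilon> (insert c \<xi>) = vertex_sdeg D ord \<epsilon> \<xi> + edge_sdeg \<xi> c"
proof -
  have eq: "vertex_sdeg D ord \<epsilon> \<eta> = d" if "path_sdeg D ord \<epsilon> \<eta> d" for \<eta> d
    unfolding vertex_sdeg_def using that path_unique by blast
  obtain d where d: "path_sdeg D ord \<epsilon> \<xi> d" using path_exists assms unfolding edge_def by blast
  obtain k where k: "k_homogeneous k (\<epsilon> \<xi> c)"
    using k_unit_homogeneous signs assms by (metis sign_assignment_def)
  have "path_sdeg D ord \<epsilon> (insert c \<xi>) (d + edge_sdeg \<xi> c)"
    using path_sdeg.step[OF d assms k] k edge_homogeneous[OF assms] by simp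
  then show ?thesis using eq d by metis
qed

end

section \<open>Modules and complexes\<close>

abbreviation type_ring :: "'r::comm_ring_1 ring" where
  "type_ring \<equiv> ring_of_type_algebra"

lemma type_ring_simps [simp]: "carrier (type_ring :: 'r::comm_ring_1 ring) = UNIV"
  "x \<oplus>\<^bsub>type_ring\<^esub> y = x + (y :: 'r::comm_ring_1)" "x \<otimes>\<^bsub>type_ring\<^esub> y = x * y" "\<one>\<^bsub>type_ring\<^esub> = (1 :: 'r)" "\<zero>\<^bsub>type_ring\<^esub> = (0 :: 'r)"
  by (simp_all add: ring_of_type_algebra_def)

lemma (in comm_ring_map) scale_moduleI:
  fixes M :: "('a, 'c \<Rightarrow>\<^sub>0 'b) module"
  assumes M: "add M = (+)" "\<zero>\<^bsub>M\<^esub> = 0" "module.smult M = (\<lambda>r. scale (h r))"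
    and closed: "0 \<in> carrier M" "\<And>u v. u \<in> carrier M \<Longrightarrow> v \<in> carrier M \<Longrightarrow> u + v \<in> carrier M"
      "\<And>r u. u \<in> carrier M \<Longrightarrow> scale (h r) u \<in> carrier M"
  shows "module type_ring M"
proof (rule moduleI)
  show "cring (type_ring :: 'a ring)" by (rule cring_from_type_algebra)
  have uminus: "- u \<in> carrier M" if "u \<in> carrier M" for u
    using closed(3)[OF that, of "- 1"] by (simp add: map_uminus map_one scale_uminus)
  show "abelian_group M"
  proof (rule abelian_groupI)
    show "\<exists>y\<in>carrier M. y \<oplus>\<^bsub>M\<^esub> x = \<zero>\<^bsub>M\<^esub>" if "x \<in> carrier M" for x
      using uminus[OF that] by (auto simp: M intro!: bexI[of _ "- x"])
  qed (auto simp: M closed ac_simps)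
qed (simp_all add: M closed scale_add map_add map_mult map_one)

lemma finsum_eq_sum:
  fixes G :: "('c::comm_monoid_add, 'd) ring_scheme" (structure)
  assumes "abelian_group G" "add G = (+)" "\<zero> = 0" "finite A" "f \<in> A \<rightarrow> carrier G"
  shows "(\<Oplus>x\<in>A. f x) = (\<Sum>x\<in>A. f x)"
proof -
  interpret abelian_group G by fact
  show ?thesis using assms(4,5)
    by (induction A) (simp_all add: assms(2,3) finsum_insert Pi_def)
qed

text \<open>Only closure and compatibility are asked of \<open>C\<close>; the module axioms and the
  vanishing square of its differential are pulled back along the bijections. Tensor complex, direct
  sum and homogeneous parts are all handled by this.\<close>

lemma chain_iso_transport:
  assumes C': "chain_complex R C'"
    and bij: "\<And>i. bij_betw (f i) (carrier (grp C i)) (carrier (grp C' i))"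
    and zero: "\<And>i. \<zero>\<^bsub>grp C i\<^esub> \<in> carrier (grp C i)" "\<And>i. f i \<zero>\<^bsub>grp C i\<^esub> = \<zero>\<^bsub>grp C' i\<^esub>"
    and add: "\<And>i x y. x \<in> carrier (grp C i) \<Longrightarrow> y \<in> carrier (grp C i) \<Longrightarrow>
        x \<oplus>\<^bsub>grp C i\<^esub> y \<in> carrier (grp C i) \<and> f i (x \<oplus>\<^bsub>grp C i\<^esub> y) = f i x \<oplus>\<^bsub>grp C' i\<^esub> f i y"
    and smult: "\<And>i r x. r \<in> carrier R \<Longrightarrow> x \<in> carrier (grp C i) \<Longrightarrow>
        r \<odot>\<^bsub>grp C i\<^esub> x \<in> carrier (grp C i) \<and> f i (r \<odot>\<^bsub>grp C i\<^esub> x) = r \<odot>\<^bsub>grp C' i\<^esub> f i x"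
    and diff: "\<And>i x. x \<in> carrier (grp C i) \<Longrightarrow>
        diff C i x \<in> carrier (grp C (i + 1)) \<and> f (i + 1) (diff C i x) = diff C' i (f i x)"
  shows "chain_iso R C C' f"
proof -
  have mod': "module R (grp C' i)" and lin': "lin_map R (grp C' i) (grp C' (i + 1)) (diff C' i)"
    and dd': "x \<in> carrier (grp C' i) \<Longrightarrow> diff C' (i + 1) (diff C' i x) = \<zero>\<^bsub>grp C' (i + 2)\<^esub>" for i x
    using C' by (auto simp: chain_complex_def)
  have f_in: "f i x \<in> carrier (grp C' i)" if "x \<in> carrier (grp C i)" for i x
    using bij that bij_betwE by blast
  have inj: "x = y" if "f i x = f i y" "x \<in> carrier (grp C i)" "y \<in> carrier (grp C i)" for i x y
    using bij[of i] that by (auto simp: bij_betw_def dest: inj_onD)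
  have mod: "module R (grp C i)" for i
  proof -
    interpret N: module R "grp C' i" by (rule mod')
    show ?thesis
    proof (rule moduleI)
      show "cring R" by (rule N.R.is_cring)
      show "abelian_group (grp C i)"
      proof (rule abelian_groupI)
        fix x assume x: "x \<in> carrier (grp C i)"
        \<comment> \<open>Surjectivity provides the additive inverse as a preimage of the inverse in
          the target.\<close>
        have "\<ominus>\<^bsub>grp C' i\<^esub> f i x \<in> f i ` carrier (grp C i)"
          using bij[of i] f_in[OF x] by (simp add: bij_betw_def)
        then obtain y where y: "y \<in> carrier (grp C i)" "f i y = \<ominus>\<^bsub>grp C' i\<^esub> f i x" by auto
        then have "y \<oplus>\<^bsub>grp C i\<^esub> x = \<zero>\<^bsub>grp C i\<^esub>"
          using x f_in[OF x] by (intro inj[of i]) (simp_all add: add zero N.l_neg)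
        then show "\<exists>y\<in>carrier (grp C i). y \<oplus>\<^bsub>grp C i\<^esub> x = \<zero>\<^bsub>grp C i\<^esub>" using y by blast
      qed (auto intro!: inj[of i] simp: add zero f_in N.a_ac)
    qed (auto intro!: inj[of i] simp: add smult f_in N.smult_l_distr N.smult_r_distr N.smult_assoc1)
  qed
  have dd: "diff C (i + 1) (diff C i x) = \<zero>\<^bsub>grp C (i + 2)\<^esub>" if x: "x \<in> carrier (grp C i)" for i x
  proof (rule inj[of "i + 2"])
    have 1: "diff C i x \<in> carrier (grp C (i + 1))" using diff[OF x] by blast
    then show "diff C (i + 1) (diff C i x) \<in> carrier (grp C (i + 2))"
      using diff[OF 1] by (simp add: add.assoc)
    show "f (i + 2) (diff C (i + 1) (diff C i x)) = f (i + 2) \<zero>\<^bsub>grp C (i + 2)\<^esub>"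
      using diff[OF 1] diff[OF x] dd'[OF f_in[OF x]] zero(2)[of "i + 2"] by (simp add: add.assoc)
  qed (rule zero)
  have lin: "lin_map R (grp C i) (grp C (i + 1)) (diff C i)" for i
    using lin'[of i] unfolding lin_map_def
    by (auto intro!: inj[of "i + 1"] simp: diff add smult f_in)
  show ?thesis
    unfolding chain_iso_def chain_complex_def
    using mod mod' lin lin' dd dd' bij f_in by (auto simp: lin_map_def add smult diff)
qed

text \<open>The composite is kept as an explicit formula because the action of X, Y and Z is later
  read off from it.\<close>

lemma chain_iso_inv_comp:
  assumes f: "chain_iso R A F f" and g: "chain_iso R T F g"
  shows "chain_iso R A T (\<lambda>i x. inv_into (carrier (grp T i)) (g i) (f i x))"
proof -
  have A: "chain_complex R A" and T: "chain_complex R T" and F: "chain_complex R F"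
    using f g by (auto simp: chain_iso_def)
  have bij: "bij_betw (f i) (carrier (grp A i)) (carrier (grp F i))"
    "bij_betw (g i) (carrier (grp T i)) (carrier (grp F i))" for i
    using f g by (auto simp: chain_iso_def)
  let ?k = "\<lambda>i x. inv_into (carrier (grp T i)) (g i) (f i x)"
  have fin: "f i x \<in> carrier (grp F i)" if "x \<in> carrier (grp A i)" for i x
    using bij(1) that bij_betwE by blast
  have kin: "?k i x \<in> carrier (grp T i)" and gk: "g i (?k i x) = f i x" if "x \<in> carrier (grp A i)" for i x
    using fin[OF that] bij(2)[of i] by (auto simp: bij_betw_def inv_into_into f_inv_into_f)
  have kI: "?k i x = y" if "x \<in> carrier (grp A i)" "y \<in> carrier (grp T i)" "g i y = f i x" for i x y
    using bij(2)[of i] that by (metis bij_betw_imp_inj_on inv_into_f_f)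
  have kbij: "bij_betw (?k i) (carrier (grp A i)) (carrier (grp T i))" for i
    using bij_betw_trans[OF bij(1) bij_betw_inv_into[OF bij(2)], of i] by (simp add: o_def)
  have A_closed: "y \<in> carrier (grp A i) \<Longrightarrow> x \<oplus>\<^bsub>grp A i\<^esub> y \<in> carrier (grp A i)" "r \<in> carrier R \<Longrightarrow> r \<odot>\<^bsub>grp A i\<^esub> x \<in> carrier (grp A i)"
      "diff A i x \<in> carrier (grp A (i + 1))"
    if "x \<in> carrier (grp A i)" for i x y r
  proof -
    interpret M: module R "grp A i" using A by (auto simp: chain_complex_def)
    show "y \<in> carrier (grp A i) \<Longrightarrow> x \<oplus>\<^bsub>grp A i\<^esub> y \<in> carrier (grp A i)" "r \<in> carrier R \<Longrightarrow> r \<odot>\<^bsub>grp A i\<^esub> x \<in> carrier (grp A i)"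
      using that by simp_all
    show "diff A i x \<in> carrier (grp A (i + 1))" using A that by (auto simp: chain_complex_def lin_map_def)
  qed
  have T_closed: "y \<in> carrier (grp T i) \<Longrightarrow> x \<oplus>\<^bsub>grp T i\<^esub> y \<in> carrier (grp T i)" "r \<in> carrier R \<Longrightarrow> r \<odot>\<^bsub>grp T i\<^esub> x \<in> carrier (grp T i)"
      "diff T i x \<in> carrier (grp T (i + 1))"
    if "x \<in> carrier (grp T i)" for i x y r
  proof -
    interpret M: module R "grp T i" using T by (auto simp: chain_complex_def)
    show "y \<in> carrier (grp T i) \<Longrightarrow> x \<oplus>\<^bsub>grp T i\<^esub> y \<in> carrier (grp T i)" "r \<in> carrier R \<Longrightarrow> r \<odot>\<^bsub>grp T i\<^esub> x \<in> carrier (grp T i)"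
      using that by simp_all
    show "diff T i x \<in> carrier (grp T (i + 1))" using T that by (auto simp: chain_complex_def lin_map_def)
  qed
  have lin: "lin_map R (grp A i) (grp T i) (?k i)" for i
    unfolding lin_map_def
  proof (intro conjI ballI)
    show "?k i \<in> carrier (grp A i) \<rightarrow> carrier (grp T i)" using kin by blast
    show "?k i (x \<oplus>\<^bsub>grp A i\<^esub> y) = ?k i x \<oplus>\<^bsub>grp T i\<^esub> ?k i y" if "x \<in> carrier (grp A i)" "y \<in> carrier (grp A i)" for x y
      using f g that by (intro kI A_closed T_closed kin) (simp_all add: chain_iso_def lin_map_def kin gk)
    show "?k i (r \<odot>\<^bsub>grp A i\<^esub> x) = r \<odot>\<^bsub>grp T i\<^esub> ?k i x" if "r \<in> carrier R" "x \<in> carrier (grp A i)" for x r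
      using f g that by (intro kI A_closed T_closed kin) (simp_all add: chain_iso_def lin_map_def kin gk)
  qed
  have "?k (i + 1) (diff A i x) = diff T i (?k i x)" if "x \<in> carrier (grp A i)" for i x
    using f g that by (intro kI A_closed T_closed kin) (simp_all add: chain_iso_def kin gk)
  then show ?thesis using A T lin kbij by (simp add: chain_iso_def)
qed

section \<open>Base change of a free module\<close>

text \<open>The evaluation \<open>m \<otimes> s \<mapsto> s h(m)\<close>, whose kernel on the free abelian group is the group of
  tensor relations.\<close>

definition tensor_eval :: "('k \<Rightarrow> 's) \<Rightarrow> (('b \<Rightarrow>\<^sub>0 'k::comm_ring_1) \<times> 's \<Rightarrow>\<^sub>0 int) \<Rightarrow> ('b \<Rightarrow>\<^sub>0 's::comm_ring_1)" where
  "tensor_eval h z = (\<Sum>p\<in>keys z. scale (of_int (lookup z p) * snd p) (Poly_Mapping.map h (fst p)))"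

lemma tensor_eval_add: "tensor_eval h (z + w) = tensor_eval h z + tensor_eval h w"
  unfolding tensor_eval_def
  by (rule setsum_keys_plus_distrib) (simp_all add: distrib_right scale_add)

lemma tensor_eval_zero [simp]: "tensor_eval h 0 = 0"
  by (simp add: tensor_eval_def)

lemma tensor_eval_frag [simp]: "tensor_eval h (frag_of (m, s)) = scale s (Poly_Mapping.map h m)"
  by (simp add: tensor_eval_def)

lemma tensor_eval_uminus: "tensor_eval h (- z) = - tensor_eval h z"
  using tensor_eval_add[of h z "- z"] by (simp add: eq_neg_iff_add_eq_0 add.commute)

lemma tensor_eval_diff: "tensor_eval h (z - w) = tensor_eval h z - tensor_eval h w"
  using tensor_eval_add[of h z "- w"] by (simp add: tensor_eval_uminus)

lemma free_module_simps:
  "carrier (free_module B) = {u. keys u \<subseteq> B}" "add (free_module B) = (+)"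
  "module.smult (free_module B) = scale" "\<zero>\<^bsub>free_module B\<^esub> = 0"
  by (simp_all add: free_module_def)

locale free_base_change = comm_ring_map h for h :: "'k::comm_ring_1 \<Rightarrow> 's::comm_ring_1" +
  fixes B :: "'b set"
begin

abbreviation "M \<equiv> (free_module B :: ('k, 'b \<Rightarrow>\<^sub>0 'k) module)"
abbreviation "N \<equiv> tensor_null h M"
abbreviation "Fr \<equiv> (tensor_free M :: (('b \<Rightarrow>\<^sub>0 'k) \<times> 's \<Rightarrow>\<^sub>0 int) monoid)"

lemma Fr_group: "comm_group Fr"
  unfolding tensor_free_def by (rule abelian_free_Abelian_group)

lemma Fr_carrier: "z \<in> carrier Fr \<longleftrightarrow> (\<forall>p\<in>keys z. keys (fst p) \<subseteq> B)"
  by (simp add: tensor_free_def free_module_simps subset_eq[of "keys z"] mem_Times_iff)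

lemma Fr_simps: "x \<otimes>\<^bsub>Fr\<^esub> y = x + y" "\<one>\<^bsub>Fr\<^esub> = 0" "z \<in> carrier Fr \<Longrightarrow> inv\<^bsub>Fr\<^esub> z = - z"
  by (simp_all add: tensor_free_def)

lemma frag_in_Fr: "frag_of (m, s) \<in> carrier Fr \<longleftrightarrow> keys m \<subseteq> B"
  by (simp add: tensor_free_def free_module_simps)

lemma Fr_closed: "z \<in> carrier Fr \<Longrightarrow> w \<in> carrier Fr \<Longrightarrow> z + w \<in> carrier Fr" "z \<in> carrier Fr \<Longrightarrow> - z \<in> carrier Fr"
  "z \<in> carrier Fr \<Longrightarrow> w \<in> carrier Fr \<Longrightarrow> z - w \<in> carrier Fr"
proof -
  interpret comm_group Fr by (rule Fr_group)
  show 1: "z + w \<in> carrier Fr" if "z \<in> carrier Fr" "w \<in> carrier Fr" for z w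
    using m_closed[OF that] by (simp add: Fr_simps)
  show 2: "- z \<in> carrier Fr" if "z \<in> carrier Fr" for z
    using inv_closed[OF that] Fr_simps(3)[OF that] by simp
  show "z - w \<in> carrier Fr" if "z \<in> carrier Fr" "w \<in> carrier Fr"
    using 1[OF that(1) 2[OF that(2)]] by simp
qed

lemma Fr_induct [consumes 1, case_names frag diff]:
  assumes "z \<in> carrier Fr" "\<And>m s. keys m \<subseteq> B \<Longrightarrow> P (frag_of (m, s))"
    "\<And>x y. x \<in> carrier Fr \<Longrightarrow> y \<in> carrier Fr \<Longrightarrow> P x \<Longrightarrow> P y \<Longrightarrow> P (x - y)"
  shows "P z"
proof -
  have "z \<in> carrier Fr \<and> P z"
  proof (rule frag_induction[of z "carrier M \<times> UNIV"])
    show "keys z \<subseteq> carrier M \<times> UNIV"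
      using assms(1) by (simp add: Fr_carrier free_module_simps subset_eq[of "keys z"] mem_Times_iff)
    have "frag_of (0, 0) \<in> carrier Fr \<and> P (frag_of (0, 0))"
      using assms(2) by (simp add: frag_in_Fr)
    then show "0 \<in> carrier Fr \<and> P 0" using assms(3) Fr_closed(3) by (metis diff_self)
    show "frag_of x \<in> carrier Fr \<and> P (frag_of x)" if "x \<in> carrier M \<times> UNIV" for x
      using that assms(2) by (auto simp: free_module_simps frag_in_Fr)
  qed (use assms(3) Fr_closed(3) in auto)
  then show ?thesis by blast
qed

abbreviation relations :: "(('b \<Rightarrow>\<^sub>0 'k) \<times> 's \<Rightarrow>\<^sub>0 int) set" where
  "relations \<equiv>
     {frag_of (x \<oplus>\<^bsub>M\<^esub> y, s) - frag_of (x, s) - frag_of (y, s) | x y s.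
         x \<in> carrier M \<and> y \<in> carrier M} \<union>
      {frag_of (x, s + t) - frag_of (x, s) - frag_of (x, t) | x s t. x \<in> carrier M} \<union>
      {frag_of (r \<odot>\<^bsub>M\<^esub> x, s) - frag_of (x, h r * s) | r x s. x \<in> carrier M}"

lemma relations_Fr: "relations \<subseteq> carrier Fr"
proof -
  have "keys (x + y) \<subseteq> B" if "keys x \<subseteq> B" "keys y \<subseteq> B" for x y :: "'b \<Rightarrow>\<^sub>0 'k"
    using that Poly_Mapping.keys_add[of x y] by blast
  moreover have "keys (scale r x) \<subseteq> B" if "keys x \<subseteq> B" for x :: "'b \<Rightarrow>\<^sub>0 'k" and r
    using that keys_scale[of r x] by blast
  ultimately show ?thesis
    by (auto simp: free_module_simps frag_in_Fr intro!: Fr_closed)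
qed

lemma N_subgroup: "subgroup N Fr"
  unfolding tensor_null_def
  by (rule group.generate_is_subgroup[OF comm_group.axioms(2)[OF Fr_group] relations_Fr])

lemma N_closed: "z \<in> N \<Longrightarrow> w \<in> N \<Longrightarrow> z + w \<in> N" "z \<in> N \<Longrightarrow> - z \<in> N" "0 \<in> N" "z \<in> N \<Longrightarrow> w \<in> N \<Longrightarrow> z - w \<in> N"
  "z \<in> N \<Longrightarrow> z \<in> carrier Fr"
proof -
  interpret subgroup N Fr by (rule N_subgroup)
  show car: "z \<in> carrier Fr" if "z \<in> N" for z using that by simp
  show 1: "z + w \<in> N" if "z \<in> N" "w \<in> N" for z w using m_closed[OF that] by (simp add: Fr_simps)
  show 2: "- z \<in> N" if "z \<in> N" for z using m_inv_closed[OF that] Fr_simps(3)[OF car[OF that]] by simp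
  show "0 \<in> N" using one_closed by (simp add: Fr_simps)
  show "z - w \<in> N" if "z \<in> N" "w \<in> N" using 1[OF that(1) 2[OF that(2)]] by simp
qed

lemma N_sum: "(\<And>x. x \<in> A \<Longrightarrow> f x \<in> N) \<Longrightarrow> sum f A \<in> N"
  by (induction A rule: infinite_finite_induct) (auto intro: N_closed)

lemma N_relations:
  "keys x \<subseteq> B \<Longrightarrow> keys y \<subseteq> B \<Longrightarrow> frag_of (x + y, s) - frag_of (x, s) - frag_of (y, s) \<in> N"
  "keys x \<subseteq> B \<Longrightarrow> frag_of (x, s + t) - frag_of (x, s) - frag_of (x, t) \<in> N"
  "keys x \<subseteq> B \<Longrightarrow> frag_of (scale r x, s) - frag_of (x, h r * s) \<in> N"
  unfolding tensor_null_def by (rule generate.incl; force simp: free_module_simps)+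

lemma N_zero: "frag_of (0, s) \<in> N" "keys x \<subseteq> B \<Longrightarrow> frag_of (x, 0) \<in> N"
proof -
  have "- frag_of (0, s) \<in> N" using N_relations(1)[of 0 0 s] by simp
  then show "frag_of (0, s) \<in> N" using N_closed(2) by fastforce
  assume "keys x \<subseteq> B"
  then have "- frag_of (x, 0) \<in> N" using N_relations(2)[of x 0 0] by simp
  then show "frag_of (x, 0) \<in> N" using N_closed(2) by fastforce
qed

lemma relations_eval: "z \<in> relations \<Longrightarrow> tensor_eval h z = 0"
  by (elim UnE CollectE exE conjE)
    (simp_all add: free_module_simps tensor_eval_diff map_poly_add scale_add map_poly_scale mult.commute)

lemma tensor_eval_N: "z \<in> N \<Longrightarrow> tensor_eval h z = 0"
  unfolding tensor_null_def
proof (induction rule: generate.induct)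
  case one
  show ?case unfolding Fr_simps by simp
next
  case (incl z)
  then show ?case by (rule relations_eval)
next
  case (inv z)
  have "z \<in> carrier Fr" using relations_Fr inv by (rule subsetD)
  then show ?case using relations_eval[OF inv] by (simp only: Fr_simps tensor_eval_uminus minus_zero)
next
  case (eng z w)
  then show ?case unfolding Fr_simps tensor_eval_add by simp
qed

text \<open>The inverse of the evaluation modulo relations: \<open>v\<close> goes to the sum of
  basis vectors tensored with its coefficients. The index set is a parameter so that elements with
  different supports can be compared.\<close>

definition section_on :: "'b set \<Rightarrow> ('b \<Rightarrow>\<^sub>0 's) \<Rightarrow> (('b \<Rightarrow>\<^sub>0 'k) \<times> 's \<Rightarrow>\<^sub>0 int)" where
  "section_on K v = (\<Sum>b\<in>K. frag_of (single b 1, lookup v b))"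

lemma section_on_keys:
  assumes "finite K" "keys v \<subseteq> K" "K \<subseteq> B"
  shows "section_on K v - section_on (keys v) v \<in> N"
proof -
  have "section_on K v = section_on (K - keys v) v + section_on (keys v) v"
    unfolding section_on_def by (rule sum.subset_diff[OF assms(2,1)])
  moreover have "section_on (K - keys v) v \<in> N"
    unfolding section_on_def using assms(3)
    by (intro N_sum) (auto simp: in_keys_iff intro!: N_zero)
  ultimately show ?thesis by simp
qed

lemma section_on_diff:
  assumes "K \<subseteq> B"
  shows "section_on K (v - w) - (section_on K v - section_on K w) \<in> N"
proof -
  have "frag_of (single b 1, lookup (v - w) b) - (frag_of (single b 1, lookup v b) - frag_of (single b 1, lookup w b)) \<in> N"
    if "b \<in> K" for b
    using N_closed(2)[OF N_relations(2)[of "single b 1" "lookup (v - w) b" "lookup w b"]] that assms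
    by (auto simp: lookup_minus algebra_simps)
  then have "(\<Sum>b\<in>K. frag_of (single b 1, lookup (v - w) b) - (frag_of (single b 1, lookup v b) - frag_of (single b 1, lookup w b))) \<in> N"
    by (rule N_sum)
  then show ?thesis by (simp add: section_on_def sum_subtractf)
qed

text \<open>Additivity breaks \<open>m\<close> into its monomial terms, and balancing moves each
  coefficient of \<open>m\<close> through \<open>h\<close> to the right factor.\<close>

lemma frag_section:
  assumes "keys m \<subseteq> B"
  shows "frag_of (m, s) - section_on (keys m) (scale s (Poly_Mapping.map h m)) \<in> N"
proof -
  have "frag_of (\<Sum>b\<in>K. single b (lookup m b), s) - (\<Sum>b\<in>K. frag_of (single b 1, h (lookup m b) * s)) \<in> N"
    if "finite K" "K \<subseteq> B" for K
    using that
  proof (induction K)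
    case empty
    then show ?case by (simp add: N_zero)
  next
    case (insert b K)
    let ?u = "\<Sum>b\<in>K. single b (lookup m b)"
    have "keys ?u \<subseteq> B"
      using Poly_Mapping.keys_sum[of "\<lambda>b. single b (lookup m b)" K] insert by (auto split: if_splits)
    then have "frag_of (single b (lookup m b) + ?u, s) - frag_of (single b (lookup m b), s) - frag_of (?u, s) \<in> N"
      using insert by (intro N_relations) auto
    moreover have "frag_of (single b (lookup m b), s) - frag_of (single b 1, h (lookup m b) * s) \<in> N"
      using N_relations(3)[of "single b 1" "lookup m b" s] insert by simp
    moreover have "frag_of (?u, s) - (\<Sum>b\<in>K. frag_of (single b 1, h (lookup m b) * s)) \<in> N"
      using insert by simp
    ultimately have "(frag_of (single b (lookup m b) + ?u, s) - frag_of (single b (lookup m b), s) - frag_of (?u, s))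
      + ((frag_of (single b (lookup m b), s) - frag_of (single b 1, h (lookup m b) * s))
      + (frag_of (?u, s) - (\<Sum>b\<in>K. frag_of (single b 1, h (lookup m b) * s)))) \<in> N"
      by (intro N_closed(1))
    then show ?case using insert by (simp add: algebra_simps)
  qed
  from this[OF finite_keys assms] show ?thesis
    by (simp add: poly_mapping_sum_single section_on_def lookup_map mult.commute)
qed

lemma tensor_eval_keys: "z \<in> carrier Fr \<Longrightarrow> keys (tensor_eval h z) \<subseteq> B"
proof (induction rule: Fr_induct)
  case (frag m s)
  then show ?case using keys_scale[of s "Poly_Mapping.map h m"] keys_map_poly[of m] by auto
next
  case (diff x y)
  then show ?case using Poly_Mapping.keys_diff[of "tensor_eval h x" "tensor_eval h y"] by (auto simp: tensor_eval_diff)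
qed

text \<open>An element with value zero is therefore null, which is the hard half of computing the
  kernel of the evaluation.\<close>

lemma tensor_eval_section:
  "z \<in> carrier Fr \<Longrightarrow> z - section_on (keys (tensor_eval h z)) (tensor_eval h z) \<in> N"
proof (induction rule: Fr_induct)
  case (frag m s)
  let ?v = "scale s (Poly_Mapping.map h m)"
  have "section_on (keys m) ?v - section_on (keys ?v) ?v \<in> N"
    using keys_scale[of s "Poly_Mapping.map h m"] keys_map_poly[of m] frag by (intro section_on_keys) auto
  from N_closed(1)[OF frag_section[OF frag, of s] this] show ?case by simp
next
  case (diff x y)
  define v w where vw: "v = tensor_eval h x" "w = tensor_eval h y"
  define K where "K = keys v \<union> keys w"
  have K: "finite K" "K \<subseteq> B" "keys v \<subseteq> K" "keys w \<subseteq> K" "keys (v - w) \<subseteq> K"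
    using tensor_eval_keys diff Poly_Mapping.keys_diff[of v w] by (auto simp: K_def vw)
  have "x - section_on (keys v) v \<in> N" "y - section_on (keys w) w \<in> N"
    using diff(3,4) by (simp_all add: vw)
  moreover have "section_on K (v - w) - (section_on K v - section_on K w) \<in> N"
    by (rule section_on_diff[OF K(2)])
  moreover have "section_on K u - section_on (keys u) u \<in> N" if "keys u \<subseteq> K" for u
    by (rule section_on_keys[OF K(1) that K(2)])
  note this[OF K(3)] this[OF K(4)] this[OF K(5)]
  \<comment> \<open>The six null terms telescope to \<open>x - y\<close> minus the section of its
    value; over the common support \<open>K\<close> the section is additive modulo
    relations.\<close>
  ultimately have "(x - section_on (keys v) v) - (y - section_on (keys w) w)
     - (section_on K (v - w) - (section_on K v - section_on K w))
     - (section_on K v - section_on (keys v) v) + (section_on K w - section_on (keys w) w)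
     + (section_on K (v - w) - section_on (keys (v - w)) (v - w)) \<in> N"
    by (metis N_closed(1,4))
  then show ?case by (simp add: tensor_eval_diff vw algebra_simps)
qed

lemma tensor_eval_eq_iff:
  assumes "z \<in> carrier Fr" "w \<in> carrier Fr"
  shows "tensor_eval h z = tensor_eval h w \<longleftrightarrow> z - w \<in> N"
proof
  assume "tensor_eval h z = tensor_eval h w"
  then have "tensor_eval h (z - w) = 0" by (simp add: tensor_eval_diff)
  then show "z - w \<in> N"
    using tensor_eval_section[OF Fr_closed(3)[OF assms]] by (simp add: section_on_def)
qed (use tensor_eval_N[of "z - w"] in \<open>simp add: tensor_eval_diff\<close>)

text \<open>Cosets are the fibres of the evaluation, so equalities of cosets and independence of
  representatives are decided by evaluating.\<close>

lemma coset_eq: "z \<in> carrier Fr \<Longrightarrow> N #>\<^bsub>Fr\<^esub> z = {w \<in> carrier Fr. tensor_eval h w = tensor_eval h z}"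
proof -
  assume z: "z \<in> carrier Fr"
  have "w \<in> N #>\<^bsub>Fr\<^esub> z \<longleftrightarrow> w - z \<in> N" for w
    by (auto simp: r_coset_def Fr_simps) (metis diff_add_cancel)
  moreover have "w \<in> carrier Fr" if "w - z \<in> N" for w
    using Fr_closed(1)[OF N_closed(5)[OF that] z] by simp
  ultimately show ?thesis using tensor_eval_eq_iff[OF _ z] by blast
qed

definition coset_eval :: "(('b \<Rightarrow>\<^sub>0 'k) \<times> 's \<Rightarrow>\<^sub>0 int) set \<Rightarrow> ('b \<Rightarrow>\<^sub>0 's)" where
  "coset_eval c = tensor_eval h (SOME z. z \<in> c)"

lemma coset_eval_coset [simp]: "z \<in> carrier Fr \<Longrightarrow> coset_eval (N #>\<^bsub>Fr\<^esub> z) = tensor_eval h z"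
proof -
  assume z: "z \<in> carrier Fr"
  have "(SOME w. w \<in> N #>\<^bsub>Fr\<^esub> z) \<in> N #>\<^bsub>Fr\<^esub> z"
    by (rule someI[of _ z]) (simp add: coset_eq z)
  then show ?thesis unfolding coset_eval_def by (simp add: coset_eq z)
qed

lemma tensor_carrier: "c \<in> carrier (tensor_module h M) \<longleftrightarrow> (\<exists>z\<in>carrier Fr. c = N #>\<^bsub>Fr\<^esub> z)"
  by (auto simp: tensor_module_def Let_def FactGroup_def RCOSETS_def)

lemma section_on_eval:
  "finite K \<Longrightarrow> K \<subseteq> B \<Longrightarrow> section_on K v \<in> carrier Fr \<and>
     tensor_eval h (section_on K v) = (\<Sum>b\<in>K. single b (lookup v b))"
proof (induction K rule: finite_induct)
  case empty
  then show ?case by (simp add: section_on_def Fr_carrier)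
next
  case (insert b K)
  then have "section_on (insert b K) v = frag_of (single b 1, lookup v b) + section_on K v"
    by (simp add: section_on_def)
  then show ?case
    using insert by (auto simp: tensor_eval_add map_one intro!: Fr_closed(1) frag_in_Fr[THEN iffD2])
qed

lemma coset_eval_bij:
  "bij_betw coset_eval (carrier (tensor_module h M)) {v. keys v \<subseteq> B}"
proof (rule bij_betw_imageI)
  show "inj_on coset_eval (carrier (tensor_module h M))"
  proof (rule inj_onI)
    fix c d assume cd: "c \<in> carrier (tensor_module h M)" "d \<in> carrier (tensor_module h M)" "coset_eval c = coset_eval d"
    then obtain z w where zw: "z \<in> carrier Fr" "c = N #>\<^bsub>Fr\<^esub> z" "w \<in> carrier Fr" "d = N #>\<^bsub>Fr\<^esub> w"
      by (auto simp: tensor_carrier)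
    then have "tensor_eval h z = tensor_eval h w" using cd(3) by simp
    then show "c = d" by (simp add: zw coset_eq)
  qed
  show "coset_eval ` carrier (tensor_module h M) = {v. keys v \<subseteq> B}"
  proof (intro equalityI subsetI)
    fix v :: "'b \<Rightarrow>\<^sub>0 's" assume "v \<in> {v. keys v \<subseteq> B}"
    then have "keys v \<subseteq> B" by simp
    from section_on_eval[OF finite_keys this, of v]
    have *: "section_on (keys v) v \<in> carrier Fr" "tensor_eval h (section_on (keys v) v) = v"
      by (simp_all add: poly_mapping_sum_single)
    have "N #>\<^bsub>Fr\<^esub> section_on (keys v) v \<in> carrier (tensor_module h M)"
      unfolding tensor_carrier using *(1) by (rule bexI[rotated]) (rule refl)
    moreover have "v = coset_eval (N #>\<^bsub>Fr\<^esub> section_on (keys v) v)"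
      unfolding coset_eval_coset[OF *(1)] *(2) ..
    ultimately show "v \<in> coset_eval ` carrier (tensor_module h M)" by (rule rev_image_eqI)
  next
    fix v assume "v \<in> coset_eval ` carrier (tensor_module h M)"
    then obtain z where z: "z \<in> carrier Fr" "v = tensor_eval h z" by (auto simp: tensor_carrier)
    show "v \<in> {v. keys v \<subseteq> B}" using tensor_eval_keys[OF z(1)] by (simp add: z(2))
  qed
qed

lemma tensor_zero: "\<zero>\<^bsub>tensor_module h M\<^esub> = N #>\<^bsub>Fr\<^esub> 0"
proof -
  have "N #>\<^bsub>Fr\<^esub> 0 = N" by (auto simp: r_coset_def Fr_simps)
  then show ?thesis by (simp add: tensor_module_def Let_def FactGroup_def)
qed

lemma tensor_add:
  assumes "z \<in> carrier Fr" "w \<in> carrier Fr"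
  shows "(N #>\<^bsub>Fr\<^esub> z) \<oplus>\<^bsub>tensor_module h M\<^esub> (N #>\<^bsub>Fr\<^esub> w) = N #>\<^bsub>Fr\<^esub> (z + w)"
proof -
  interpret comm_group Fr by (rule Fr_group)
  interpret normal N Fr
    by (simp add: normal_iff_subgroup N_subgroup)
  show ?thesis
    using rcos_sum[OF assms] by (simp add: tensor_module_def Let_def FactGroup_def Fr_simps)
qed

lemma frag_extend_map:
  assumes "z \<in> carrier Fr"
    and "\<And>m. keys m \<subseteq> B \<Longrightarrow> keys (g m) \<subseteq> B'"
    and "\<And>m. keys m \<subseteq> B \<Longrightarrow> Poly_Mapping.map h (g m) = lin_ext G (Poly_Mapping.map h m)"
  shows "frag_extend (\<lambda>(m, s). frag_of (g m, s)) z \<in> carrier (tensor_free (free_module B')) \<and>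
    tensor_eval h (frag_extend (\<lambda>(m, s). frag_of (g m, s)) z) = lin_ext G (tensor_eval h z)"
proof -
  interpret B': free_base_change h B' ..
  show ?thesis
    using assms(1)
  proof (induction rule: Fr_induct)
    case (frag m s)
    then show ?case using assms(2,3) by (simp add: B'.frag_in_Fr lin_ext_scale)
  next
    case (diff x y)
    then show ?case by (simp add: frag_extend_diff tensor_eval_diff B'.Fr_closed(3) lin_ext_diff)
  qed
qed

lemma frag_extend_scale:
  assumes "z \<in> carrier Fr"
  shows "frag_extend (\<lambda>(m, s). frag_of (m, t * s)) z \<in> carrier Fr \<and>
    tensor_eval h (frag_extend (\<lambda>(m, s). frag_of (m, t * s)) z) = scale t (tensor_eval h z)"
  using assms
proof (induction rule: Fr_induct)
  case (frag m s)
  then show ?case by (simp add: frag_in_Fr)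
next
  case (diff x y)
  then show ?case by (simp add: frag_extend_diff tensor_eval_diff Fr_closed(3) scale_diff)
qed

text \<open>\<open>\<phi>\<close> descends along the evaluation, so every representative yields the
  same coset and the union collapses. Scalar multiplication and the differential are both defined by
  such a union.\<close>

lemma coset_union:
  assumes z: "z \<in> carrier Fr"
    and \<phi>: "\<And>x. x \<in> carrier Fr \<Longrightarrow> \<phi> x \<in> carrier (tensor_free (free_module B')) \<and> tensor_eval h (\<phi> x) = G (tensor_eval h x)"
  shows "(\<Union>x\<in>N #>\<^bsub>Fr\<^esub> z. tensor_null h (free_module B') #>\<^bsub>tensor_free (free_module B')\<^esub> \<phi> x)
    = tensor_null h (free_module B') #>\<^bsub>tensor_free (free_module B')\<^esub> \<phi> z"
proof -
  interpret B': free_base_change h B' ..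
  have "tensor_null h (free_module B') #>\<^bsub>tensor_free (free_module B')\<^esub> \<phi> x
    = tensor_null h (free_module B') #>\<^bsub>tensor_free (free_module B')\<^esub> \<phi> z" if "x \<in> N #>\<^bsub>Fr\<^esub> z" for x
    using that \<phi> z by (simp add: coset_eq B'.coset_eq)
  moreover have "z \<in> N #>\<^bsub>Fr\<^esub> z" using z by (simp add: coset_eq)
  ultimately show ?thesis by blast
qed

lemma tensor_smult:
  assumes "z \<in> carrier Fr"
  shows "t \<odot>\<^bsub>tensor_module h M\<^esub> (N #>\<^bsub>Fr\<^esub> z) = N #>\<^bsub>Fr\<^esub> frag_extend (\<lambda>(m, s). frag_of (m, t * s)) z"
  using coset_union[OF assms, where \<phi> = "frag_extend (\<lambda>(m, s). frag_of (m, t * s))" and B' = B and G = "scale t",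
      OF frag_extend_scale]
  by (simp add: tensor_module_def Let_def)

end

lemma (in comm_ring_map) tensor_chain_iso:
  fixes Bs :: "int \<Rightarrow> 'c set"
  assumes C: "\<And>i. grp C i = free_module (Bs i)" "\<And>i m. keys m \<subseteq> Bs i \<Longrightarrow> keys (diff C i m) \<subseteq> Bs (i + 1)"
    and F: "chain_complex type_ring F" "\<And>i. grp F i = free_module (Bs i)" "\<And>i. diff F i = lin_ext (G i)"
    and map: "\<And>i m. keys m \<subseteq> Bs i \<Longrightarrow> Poly_Mapping.map h (diff C i m) = diff F i (Poly_Mapping.map h m)"
  shows "\<exists>\<Psi>. chain_iso type_ring (tensor_cplx h C) F \<Psi>"
proof -
  interpret B: free_base_change h "Bs i" for i ..
  let ?T = "tensor_cplx h C"
  have T: "grp ?T i = tensor_module h (free_module (Bs i))" for i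
    by (simp add: tensor_cplx_def C)
  have dT: "diff ?T i (B.N i #>\<^bsub>B.Fr i\<^esub> z)
      = B.N (i + 1) #>\<^bsub>B.Fr (i + 1)\<^esub> frag_extend (\<lambda>(m, s). frag_of (diff C i m, s)) z"
    and dT': "frag_extend (\<lambda>(m, s). frag_of (diff C i m, s)) z \<in> carrier (B.Fr (i + 1))"
      "tensor_eval h (frag_extend (\<lambda>(m, s). frag_of (diff C i m, s)) z) = diff F i (tensor_eval h z)"
    if z: "z \<in> carrier (B.Fr i)" for i z
  proof -
    let ?\<phi> = "frag_extend (\<lambda>(m, s). frag_of (diff C i m, s))"
    have 1: "?\<phi> x \<in> carrier (B.Fr (i + 1)) \<and> tensor_eval h (?\<phi> x) = lin_ext (G i) (tensor_eval h x)"
      if "x \<in> carrier (B.Fr i)" for x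
      by (rule B.frag_extend_map[OF that]) (simp_all add: C(2) map F(3)[symmetric])
    show "diff ?T i (B.N i #>\<^bsub>B.Fr i\<^esub> z)
      = B.N (i + 1) #>\<^bsub>B.Fr (i + 1)\<^esub> frag_extend (\<lambda>(m, s). frag_of (diff C i m, s)) z"
      using B.coset_union[OF z, where \<phi> = ?\<phi> and B' = "Bs (i + 1)", OF 1] by (simp add: tensor_cplx_def C)
    show "frag_extend (\<lambda>(m, s). frag_of (diff C i m, s)) z \<in> carrier (B.Fr (i + 1))"
      "tensor_eval h (frag_extend (\<lambda>(m, s). frag_of (diff C i m, s)) z) = diff F i (tensor_eval h z)"
      using 1[OF z] by (simp_all add: F)
  qed
  \<comment> \<open>The body of \<open>coset_eval\<close> does not involve the basis, so one
    function serves all homological degrees.\<close>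
  have "chain_iso type_ring ?T F (\<lambda>i. free_base_change.coset_eval h)"
  proof (rule chain_iso_transport[OF F(1)])
    fix i
    show "bij_betw (free_base_change.coset_eval h) (carrier (grp ?T i)) (carrier (grp F i))"
      using B.coset_eval_bij[of i] by (simp add: T F free_module_simps)
    show "\<zero>\<^bsub>grp ?T i\<^esub> \<in> carrier (grp ?T i)" "free_base_change.coset_eval h \<zero>\<^bsub>grp ?T i\<^esub> = \<zero>\<^bsub>grp F i\<^esub>"
      by (auto simp: T F B.tensor_zero B.tensor_carrier B.Fr_carrier free_module_simps intro!: bexI[of _ 0])
    fix x assume "x \<in> carrier (grp ?T i)"
    then obtain z where z: "z \<in> carrier (B.Fr i)" "x = B.N i #>\<^bsub>B.Fr i\<^esub> z" by (auto simp: T B.tensor_carrier)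
    show "diff ?T i x \<in> carrier (grp ?T (i + 1)) \<and>
      free_base_change.coset_eval h (diff ?T i x) = diff F i (free_base_change.coset_eval h x)"
      using dT[OF z(1)] dT'[OF z(1)] z by (auto simp: T B.tensor_carrier)
    show "r \<odot>\<^bsub>grp ?T i\<^esub> x \<in> carrier (grp ?T i) \<and>
      free_base_change.coset_eval h (r \<odot>\<^bsub>grp ?T i\<^esub> x) = r \<odot>\<^bsub>grp F i\<^esub> free_base_change.coset_eval h x" for r
      using B.frag_extend_scale[OF z(1), of r] z by (auto simp: T F B.tensor_carrier B.tensor_smult free_module_simps)
    fix y assume "y \<in> carrier (grp ?T i)"
    then obtain w where w: "w \<in> carrier (B.Fr i)" "y = B.N i #>\<^bsub>B.Fr i\<^esub> w" by (auto simp: T B.tensor_carrier)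
    show "x \<oplus>\<^bsub>grp ?T i\<^esub> y \<in> carrier (grp ?T i) \<and> free_base_change.coset_eval h (x \<oplus>\<^bsub>grp ?T i\<^esub> y)
      = free_base_change.coset_eval h x \<oplus>\<^bsub>grp F i\<^esub> free_base_change.coset_eval h y"
      using z w B.Fr_closed(1)[OF z(1) w(1)]
      by (auto simp: T F B.tensor_carrier B.tensor_add tensor_eval_add free_module_simps)
  qed
  then show ?thesis by blast
qed

section \<open>The complex of a diagram\<close>

text \<open>Opposite terms are paired off by induction. Showing that the sum equals its own negative
  would not suffice in a group with 2-torsion.\<close>

lemma sum_antisymmetric:
  fixes T :: "'i \<Rightarrow> 'i \<Rightarrow> 'g::ab_group_add"
  assumes "finite E" "\<And>c c'. c \<in> E \<Longrightarrow> c' \<in> E \<Longrightarrow> c \<noteq> c' \<Longrightarrow> T c c' = - T c' c"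
  shows "(\<Sum>c\<in>E. \<Sum>c'\<in>E - {c}. T c c') = 0"
  using assms
proof (induction E)
  case (insert x E)
  have "(\<Sum>c'\<in>insert x E - {c}. T c c') = T c x + (\<Sum>c'\<in>E - {c}. T c c')" if "c \<in> E" for c
  proof -
    have "insert x E - {c} = insert x (E - {c})" using insert(2) that by auto
    then show ?thesis using insert(1,2) by simp
  qed
  then have "(\<Sum>c\<in>insert x E. \<Sum>c'\<in>insert x E - {c}. T c c')
      = (\<Sum>c'\<in>E. T x c') + (\<Sum>c\<in>E. T c x) + (\<Sum>c\<in>E. \<Sum>c'\<in>E - {c}. T c c')"
    using insert(1,2) by (simp add: sum.distrib add.assoc)
  also have "(\<Sum>c\<in>E. T c x) = - (\<Sum>c\<in>E. T x c)"
    unfolding sum_negf[symmetric] using insert(2) by (intro sum.cong refl insert.prems) auto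
  also have "(\<Sum>c\<in>E. \<Sum>c'\<in>E - {c}. T c c') = 0"
    by (rule insert.IH, rule insert.prems) auto
  finally show ?case by simp
qed simp

lemma poly_mapping2_eqI: "(\<And>p k. lookup (lookup u p) k = lookup (lookup v p) k) \<Longrightarrow> u = v"
  by (intro poly_mapping_eqI)

context cube
begin

definition basis :: "int \<Rightarrow> (nat set \<times> sgn list) set" where
  "basis i = {(\<xi>, xs). \<xi> \<in> vertices D \<and> int (card \<xi>) = i + int (n_minus D) \<and> length xs = length (ord \<xi>)}"

definition edge_map :: "(kring \<Rightarrow> 'r::comm_ring_1) \<Rightarrow> nat set \<Rightarrow> sgn list \<Rightarrow> nat \<Rightarrow> (nat set \<times> sgn list \<Rightarrow>\<^sub>0 'r)" where
  "edge_map h \<xi> xs c =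
     lin_ext (\<lambda>ys. single (insert c \<xi>, ys) 1) (scale (h (\<epsilon> \<xi> c)) (F_word h (saddle D ord \<xi> c) xs))"

text \<open>The differential organized by edges of the cube, instead of by target vertices and
  classes of morphisms.\<close>

definition d_basis :: "(kring \<Rightarrow> 'r::comm_ring_1) \<Rightarrow> nat set \<times> sgn list \<Rightarrow> (nat set \<times> sgn list \<Rightarrow>\<^sub>0 'r)" where
  "d_basis h p = (\<Sum>c | edge D (fst p) c. edge_map h (fst p) (snd p) c)"

abbreviation F_Kh :: "(kring \<Rightarrow> 'r::comm_ring_1) \<Rightarrow> ('r, 'r kh_chain) cplx" where
  "F_Kh h \<equiv> F_cplx h (Kh h D ord \<epsilon>)"

lemma finite_edges: "finite {c. edge D \<xi> c}"
  by (rule finite_subset[of _ "{..<crossings D}"]) (auto simp: edge_def)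

lemma grp_F_Kh: "grp (F_Kh h) i = free_module (basis i)"
  by (simp add: F_cplx_def Kh_def basis_def conj_assoc)

lemma edge_basis:
  assumes "(\<xi>, xs) \<in> basis i" "edge D \<xi> c"
  shows "insert c \<xi> \<in> vertices D \<and> int (card (insert c \<xi>)) = i + 1 + int (n_minus D)"
proof -
  have "finite \<xi>" using assms finite_subset by (auto simp: basis_def vertices_def)
  then show ?thesis using assms by (auto simp: basis_def vertices_def edge_def)
qed

text \<open>Each matrix entry is evaluated on its defining combination of saddles. Every edge from
  \<open>\<xi>\<close> has exactly one target in the next degree, so the sum over targets regroups
  into a sum over edges.\<close>

lemma diff_F_Kh_basis:
  assumes "k_algebra h" and p: "(\<xi>, xs) \<in> basis i"
  shows "(\<Sum>\<xi>'\<in>verts (Kh h D ord \<epsilon>) (i + 1). lin_ext (\<lambda>ys. single (\<xi>', ys) 1) (F_mor h (entry (Kh h D ord \<epsilon>) \<xi> \<xi>') xs))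
    = d_basis h (\<xi>, xs)"
proof -
  interpret k_algebra h by fact
  let ?V = "verts (Kh h D ord \<epsilon>) (i + 1)"
  have xs: "length xs = length (ord \<xi>)" using p by (simp add: basis_def)
  have mor: "F_mor h (entry (Kh h D ord \<epsilon>) \<xi> \<xi>') xs
    = (\<Sum>c | edge D \<xi> c \<and> \<xi>' = insert c \<xi>. scale (h (\<epsilon> \<xi> c)) (F_word h (saddle D ord \<xi> c) xs))" for \<xi>'
  proof -
    let ?f = "\<Sum>c | edge D \<xi> c \<and> \<xi>' = insert c \<xi>. single (saddle D ord \<xi> c) (h (\<epsilon> \<xi> c))"
    have "cob (length (ord \<xi>)) w (length (ord \<xi>'))" if w: "w \<in> keys ?f" for w
    proof -
      obtain c where "edge D \<xi> c" "\<xi>' = insert c \<xi>" "w \<in> keys (single (saddle D ord \<xi> c) (h (\<epsilon> \<xi> c)))"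
        using subsetD[OF Poly_Mapping.keys_sum[of "\<lambda>c. single (saddle D ord \<xi> c) (h (\<epsilon> \<xi> c))"] w]
        by blast
      moreover from this(3) have "w = saddle D ord \<xi> c" by (simp split: if_splits)
      ultimately show ?thesis using cob_saddle by simp
    qed
    from F_mor_class[OF this xs] show ?thesis
      by (simp add: Kh_def F_comb_def lin_ext_sum)
  qed
  have "finite ?V"
    by (rule finite_subset[of _ "vertices D"]) (auto simp: Kh_def vertices_def)
  have "(\<Sum>\<xi>'\<in>?V. lin_ext (\<lambda>ys. single (\<xi>', ys) 1) (F_mor h (entry (Kh h D ord \<epsilon>) \<xi> \<xi>') xs))
    = (\<Sum>\<xi>'\<in>?V. \<Sum>c\<in>{c. c \<in> {c. edge D \<xi> c} \<and> insert c \<xi> = \<xi>'}. edge_map h \<xi> xs c)"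
    unfolding mor lin_ext_sum edge_map_def by (intro sum.cong) auto
  also have "\<dots> = (\<Sum>c | edge D \<xi> c. edge_map h \<xi> xs c)"
    using edge_basis[OF p] by (intro sum.group finite_edges \<open>finite ?V\<close>) (auto simp: Kh_def)
  finally show ?thesis by (simp add: d_basis_def)
qed

text \<open>The value of \<open>F_mor\<close> is controlled only on lists of the right length, so
  the support of \<open>u\<close> is confined to the basis of the chain group.\<close>

lemma diff_F_Kh:
  assumes "k_algebra h" "keys u \<subseteq> basis i"
  shows "diff (F_Kh h) i u = lin_ext (d_basis h) u"
proof -
  have "diff (F_Kh h) i u = lin_ext (\<lambda>(\<xi>, xs). \<Sum>\<xi>'\<in>verts (Kh h D ord \<epsilon>) (i + 1).
      lin_ext (\<lambda>ys. single (\<xi>', ys) 1) (F_mor h (entry (Kh h D ord \<epsilon>) \<xi> \<xi>') xs)) u"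
    by (simp add: F_cplx_def)
  also have "\<dots> = lin_ext (d_basis h) u"
    by (rule lin_ext_cong) (use diff_F_Kh_basis[OF assms(1)] assms(2) in auto)
  finally show ?thesis .
qed

lemma keys_edge_map:
  fixes h :: "kring \<Rightarrow> 'a::comm_ring_1"
  assumes "y \<in> keys (edge_map h \<xi> xs c)"
  obtains ys where "y = (insert c \<xi>, ys)" "ys \<in> keys (F_word h (saddle D ord \<xi> c) xs)"
proof -
  from keys_lin_ext[OF assms[unfolded edge_map_def]]
  obtain ys where ys: "ys \<in> keys (scale (h (\<epsilon> \<xi> c)) (F_word h (saddle D ord \<xi> c) xs))"
    "y \<in> keys (single (insert c \<xi>, ys) (1 :: 'a))" by blast
  have "ys \<in> keys (F_word h (saddle D ord \<xi> c) xs)" by (rule subsetD[OF keys_scale ys(1)])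
  moreover have "y = (insert c \<xi>, ys)" using ys(2) by (simp split: if_splits)
  ultimately show thesis by (rule that[rotated])
qed

lemma keys_d_basis:
  assumes "p \<in> basis i"
  shows "keys (d_basis h p) \<subseteq> basis (i + 1)"
proof
  fix y assume y: "y \<in> keys (d_basis h p)"
  from subsetD[OF Poly_Mapping.keys_sum y[unfolded d_basis_def]]
  obtain c where c: "edge D (fst p) c" "y \<in> keys (edge_map h (fst p) (snd p) c)" by blast
  obtain ys where ys: "y = (insert c (fst p), ys)" "ys \<in> keys (F_word h (saddle D ord (fst p) c) (snd p))"
    using keys_edge_map[OF c(2)] .
  have "length (snd p) = length (ord (fst p))" using assms by (auto simp: basis_def)
  from F_word_keys[OF cob_saddle[OF c(1)] this ys(2)] have "length ys = length (ord (insert c (fst p)))" ..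
  moreover have "insert c (fst p) \<in> vertices D \<and> int (card (insert c (fst p))) = i + 1 + int (n_minus D)"
    using edge_basis[of "fst p" "snd p" i c] assms c(1) by simp
  ultimately show "y \<in> basis (i + 1)" unfolding ys(1) basis_def by simp
qed

lemma keys_lin_ext_d_basis:
  assumes "keys u \<subseteq> basis i"
  shows "keys (lin_ext (d_basis h) u) \<subseteq> basis (i + 1)"
proof
  fix y assume "y \<in> keys (lin_ext (d_basis h) u)"
  from keys_lin_ext[OF this] obtain x where "x \<in> keys u" "y \<in> keys (d_basis h x)" by blast
  then show "y \<in> basis (i + 1)" using keys_d_basis[of x i h] assms by blast
qed

lemma d_basis_square:
  assumes "p \<in> basis i"
  shows "lin_ext (d_basis id) (d_basis id p) = 0"
proof -
  obtain \<xi> xs where p: "p = (\<xi>, xs)" by force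
  have xs: "length xs = length (ord \<xi>)" using assms by (simp add: p basis_def)
  let ?E = "{c. edge D \<xi> c}"
  define T where "T = (\<lambda>c c'. lin_ext (\<lambda>ys. single (insert c' (insert c \<xi>), ys) (1 :: kring))
    (scale (\<epsilon> (insert c \<xi>) c' * \<epsilon> \<xi> c) (F_word id (saddle D ord \<xi> c @ saddle D ord (insert c \<xi>) c') xs)))"
  have E: "{c'. edge D (insert c \<xi>) c'} = ?E - {c}" if "c \<in> ?E" for c
    using that by (auto simp: edge_def vertices_def)
  have "lin_ext (d_basis id) (edge_map id \<xi> xs c) = (\<Sum>c'\<in>?E - {c}. T c c')" if "c \<in> ?E" for c
    unfolding edge_map_def[of _ \<xi>] lin_ext_lin_ext lin_ext_single d_basis_def fst_conv snd_conv scale_simps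
      lin_ext_fun_sum E[OF that] T_def
    by (intro sum.cong refl)
      (simp only: edge_map_def lin_ext_lin_ext[symmetric] lin_ext_fun_scale lin_ext_scale F_word_append
        scale_simps id_apply)
  then have "lin_ext (d_basis id) (d_basis id p) = (\<Sum>c\<in>?E. \<Sum>c'\<in>?E - {c}. T c c')"
    unfolding p d_basis_def[of _ "(\<xi>, xs)"] fst_conv snd_conv lin_ext_sum by (intro sum.cong) auto
  also have "\<dots> = 0"
  proof (rule sum_antisymmetric[OF finite_edges])
    fix c c' assume c: "c \<in> ?E" "c' \<in> ?E" "c \<noteq> c'"
    then have "edge D \<xi> c" "edge D \<xi> c'" by simp_all
    from face_anticommute[OF this c(3) xs] show "T c c' = - T c' c"
      by (simp add: T_def insert_commute lin_ext_uminus)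
  qed
  finally show ?thesis .
qed

lemma map_d_basis:
  assumes "k_algebra h"
  shows "Poly_Mapping.map h (lin_ext (d_basis id) u) = lin_ext (d_basis h) (Poly_Mapping.map h u)"
proof -
  interpret k_algebra h by fact
  have "Poly_Mapping.map h (d_basis id p) = d_basis h p" for p
    by (simp add: d_basis_def edge_map_def map_poly_sum map_poly_lin_ext map_poly_scale map_F_word[unfolded id_def] map_one id_def)
  then show ?thesis by (simp add: map_poly_lin_ext)
qed

lemma d_square_id:
  assumes "keys u \<subseteq> basis i"
  shows "lin_ext (d_basis id) (lin_ext (d_basis id) u) = 0"
proof -
  have "lin_ext (d_basis id) (lin_ext (d_basis id) u) = lin_ext (\<lambda>_. 0) u"
    unfolding lin_ext_lin_ext by (rule lin_ext_cong) (use d_basis_square assms in blast)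
  then show ?thesis by simp
qed

interpretation to_zpi: k_algebra k_to_zpi
  by (intro k_algebra.intro comm_ring_map_k_to_zpi)

interpretation of_zpi: comm_ring_map zpi_to_k
  by (rule comm_ring_map_zpi_to_k)

lemma map_to_zpi_of_zpi: "Poly_Mapping.map k_to_zpi (Poly_Mapping.map zpi_to_k v) = v"
  by (rule poly_mapping_eqI) (simp add: to_zpi.lookup_map of_zpi.lookup_map)

text \<open>The face relations live over \<open>kring\<close>. The chain is lifted by
  \<open>zpi_to_k\<close>, the square vanishes there, and \<open>k_to_zpi\<close> brings the result
  back.\<close>

lemma d_square_zpi:
  assumes "keys v \<subseteq> basis i"
  shows "lin_ext (d_basis k_to_zpi) (lin_ext (d_basis k_to_zpi) v) = 0"
proof -
  let ?u = "Poly_Mapping.map zpi_to_k v"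
  have "keys ?u \<subseteq> basis i" by (rule subset_trans[OF of_zpi.keys_map_poly assms])
  then have "Poly_Mapping.map k_to_zpi (lin_ext (d_basis id) (lin_ext (d_basis id) ?u)) = 0"
    by (simp add: d_square_id)
  then show ?thesis
    unfolding map_d_basis[OF to_zpi.k_algebra_axioms] map_to_zpi_of_zpi .
qed

text \<open>There are two uses: \<open>h\<close> is \<open>id\<close> and \<open>\<phi>\<close> is
  \<open>zpi_to_k\<close> for the restriction of scalars; \<open>h\<close> is
  \<open>k_to_zpi\<close> and \<open>\<phi>\<close> is \<open>id\<close> for the complex over
  \<open>zpi\<close>.\<close>

lemma chain_complex_cube:
  fixes C :: "('s::comm_ring_1, 'r::comm_ring_1 kh_chain) cplx"
  assumes h: "k_algebra h" and "comm_ring_map \<phi>"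
    and C: "\<And>i. carrier (grp C i) = {u. keys u \<subseteq> basis i}" "\<And>i. add (grp C i) = (+)"
      "\<And>i. \<zero>\<^bsub>grp C i\<^esub> = 0" "\<And>i. module.smult (grp C i) = (\<lambda>s. scale (\<phi> s))" "diff C = diff (F_Kh h)"
    and sq: "\<And>i u. keys u \<subseteq> basis i \<Longrightarrow> lin_ext (d_basis h) (lin_ext (d_basis h) u) = 0"
  shows "chain_complex type_ring C"
proof -
  interpret \<phi>: comm_ring_map \<phi> by fact
  have closed: "keys (u + v) \<subseteq> basis i" if "keys u \<subseteq> basis i" "keys v \<subseteq> basis i" for u v :: "'r kh_chain" and i
    by (rule subset_trans[OF Poly_Mapping.keys_add Un_least[OF that]])
  have closed': "keys (scale r u) \<subseteq> basis i" if "keys u \<subseteq> basis i" for u :: "'r kh_chain" and r i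
    by (rule subset_trans[OF keys_scale that])
  have d: "diff C i u = lin_ext (d_basis h) u" if "keys u \<subseteq> basis i" for u i
    using diff_F_Kh[OF h that] by (simp add: C)
  have "module type_ring (grp C i)" for i
    by (rule \<phi>.scale_moduleI) (simp_all add: C closed closed')
  moreover have "lin_map type_ring (grp C i) (grp C (i + 1)) (diff C i)" for i
    unfolding lin_map_def C(1-4)
    by (auto simp: d closed closed' lin_ext_add lin_ext_scale dest: subsetD[OF keys_lin_ext_d_basis])
  moreover have "diff C (i + 1) (diff C i u) = 0" if u: "keys u \<subseteq> basis i" for i u
    using d[OF keys_lin_ext_d_basis[OF u]] sq[OF u] by (simp add: d[OF u])
  ultimately show ?thesis by (simp add: chain_complex_def C)
qed

abbreviation C_pi :: "(zpi, kring kh_chain) cplx" where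
  "C_pi \<equiv> scalars_cplx zpi_to_k (FKh D ord \<epsilon>)"

lemma C_pi_simps:
  "carrier (grp C_pi i) = {u. keys u \<subseteq> basis i}" "add (grp C_pi i) = (+)"
  "\<zero>\<^bsub>grp C_pi i\<^esub> = 0" "module.smult (grp C_pi i) = (\<lambda>s. scale (zpi_to_k s))" "diff C_pi = diff (F_Kh id)"
  by (simp_all add: scalars_cplx_def scalars_module_def FKh_def grp_F_Kh free_module_simps)

lemma chain_complex_C_pi: "chain_complex type_ring C_pi"
  by (rule chain_complex_cube[OF k_id.k_algebra_axioms comm_ring_map_zpi_to_k C_pi_simps]) (rule d_square_id)

lemma chain_complex_F_pi: "chain_complex type_ring (F_pi_Kh_pi D ord \<epsilon>)"
  unfolding F_pi_Kh_pi_def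
  by (rule chain_complex_cube[OF to_zpi.k_algebra_axioms comm_ring_map_id _ _ _ _ _ d_square_zpi])
    (simp_all add: grp_F_Kh free_module_simps)

lemma tensor_iso: "\<exists>\<Psi>. chain_iso type_ring (tensor_cplx k_to_zpi (FKh D ord \<epsilon>)) (F_pi_Kh_pi D ord \<epsilon>) \<Psi>"
proof (rule to_zpi.tensor_chain_iso[OF _ _ chain_complex_F_pi])
  show "grp (FKh D ord \<epsilon>) i = free_module (basis i)" "grp (F_pi_Kh_pi D ord \<epsilon>) i = free_module (basis i)" for i
    by (simp_all add: FKh_def F_pi_Kh_pi_def grp_F_Kh)
  show "diff (F_pi_Kh_pi D ord \<epsilon>) i = lin_ext (\<lambda>(v, xs). \<Sum>v'\<in>verts (Kh k_to_zpi D ord \<epsilon>) (i + 1).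
      lin_ext (\<lambda>ys. single (v', ys) 1) (F_mor k_to_zpi (entry (Kh k_to_zpi D ord \<epsilon>) v v') xs))" for i
    by (simp add: F_pi_Kh_pi_def F_cplx_def)
  fix i and m :: "kring kh_chain" assume m: "keys m \<subseteq> basis i"
  have dm: "diff (FKh D ord \<epsilon>) i m = lin_ext (d_basis id) m"
    using diff_F_Kh[OF k_id.k_algebra_axioms m] by (simp add: FKh_def)
  show "keys (diff (FKh D ord \<epsilon>) i m) \<subseteq> basis (i + 1)"
    unfolding dm by (rule keys_lin_ext_d_basis[OF m])
  have "keys (Poly_Mapping.map k_to_zpi m) \<subseteq> basis i" by (rule subset_trans[OF to_zpi.keys_map_poly m])
  then show "Poly_Mapping.map k_to_zpi (diff (FKh D ord \<epsilon>) i m)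
    = diff (F_pi_Kh_pi D ord \<epsilon>) i (Poly_Mapping.map k_to_zpi m)"
    unfolding dm F_pi_Kh_pi_def diff_F_Kh[OF to_zpi.k_algebra_axioms]
    by (simp add: diff_F_Kh[OF to_zpi.k_algebra_axioms] map_d_basis[OF to_zpi.k_algebra_axioms])
qed

end

section \<open>The decomposition by splitting degree\<close>

lemma homogeneous_mult:
  assumes "k_homogeneous d p" "k_homogeneous e q"
  shows "k_homogeneous (d + e) (p * q)"
  unfolding k_homogeneous_def
proof
  fix k assume "k \<in> keys (p * q)"
  then obtain a b where "k = a + b" "a \<in> keys p" "b \<in> keys q" using Poly_Mapping.keys_mult by blast
  then show "mono_sdeg k = d + e" using assms by (simp add: k_homogeneous_def mono_sdeg_add)
qed

lemma homogeneous_generators: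
  "k_homogeneous (1, 0) Xk" "k_homogeneous (1, 0) Yk" "k_homogeneous (0, - 1) Zk"
  by (simp_all add: k_homogeneous_def Xk_def Yk_def Zk_def)

lemma homogeneous_zpi_to_k: "k_homogeneous 0 (zpi_to_k q)"
  unfolding k_homogeneous_def
proof
  fix k assume "k \<in> keys (zpi_to_k q)"
  from keys_lin_ext[OF this[unfolded zpi_to_k_eq]] obtain e where "k \<in> keys (single (e, e, 0) (1 :: int))" by blast
  then show "mono_sdeg k = 0" by (simp add: zero_prod_def)
qed

text \<open>A monomial of degree \<open>d\<close> chosen without Y, so that it specializes to 1 in
  \<open>zpi\<close>.\<close>

definition k_shift :: "sdegree \<Rightarrow> kring" where
  "k_shift d = single (fst d, 0, - snd d) 1"

lemma k_shift_simps: "k_homogeneous d (k_shift d)" "k_to_zpi (k_shift d) = 1"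
  by (cases d; simp add: k_shift_def k_homogeneous_def k_to_zpi_eq)+

text \<open>A fixed degree determines the exponent of Z and the sum of the exponents of X and Y. So
  each monomial is a power of XY times \<open>k_shift d\<close>, and the power is given by the
  exponent of Y, which \<open>k_to_zpi\<close> retains.\<close>

lemma homogeneous_recover:
  assumes "k_homogeneous d p"
  shows "p = zpi_to_k (k_to_zpi p) * k_shift d"
proof -
  interpret a: comm_ring_map k_to_zpi by (rule comm_ring_map_k_to_zpi)
  interpret b: comm_ring_map zpi_to_k by (rule comm_ring_map_zpi_to_k)
  have mono: "zpi_to_k (k_to_zpi (single k v)) * k_shift d = single k v" if "k \<in> keys p" for k v
  proof -
    obtain x y z where k: "k = (x, y, z)" by (metis prod.exhaust)
    then have d: "d = (x + y, - z)" using assms that by (auto simp: k_homogeneous_def)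
    have "(y, y, 0) + (x + y, 0, z) = (x, y, z)" by (cases x; cases y) simp_all
    moreover have "zpi_to_k (k_to_zpi (single k v)) = single (y, y, 0) v"
      by (simp add: k k_to_zpi_eq zpi_to_k_eq)
    moreover have "k_shift d = single (x + y, 0, z) 1" by (simp only: d k_shift_def fst_conv snd_conv minus_minus)
    ultimately show ?thesis by (simp only: k mult_single mult_1_right)
  qed
  have "zpi_to_k (k_to_zpi (\<Sum>k\<in>keys p. single k (lookup p k))) * k_shift d
      = (\<Sum>k\<in>keys p. zpi_to_k (k_to_zpi (single k (lookup p k))) * k_shift d)"
    by (simp only: a.map_sum b.map_sum sum_distrib_right)
  also have "\<dots> = (\<Sum>k\<in>keys p. single k (lookup p k))"
    by (intro sum.cong refl mono)
  finally show ?thesis by (simp only: poly_mapping_sum_single)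
qed

context cube
begin

declare split_paired_All [simp del] split_paired_Ex [simp del]

definition total_sdeg :: "nat set \<times> sgn list \<Rightarrow> bit \<times> bit \<times> int \<Rightarrow> sdegree" where
  "total_sdeg p k = mono_sdeg k + basis_sdeg (snd p) - vertex_sdeg D ord \<epsilon> (fst p)"

abbreviation part :: "sdegree \<Rightarrow> int \<Rightarrow> kring kh_chain set" where
  "part \<equiv> FKh_part D ord \<epsilon>"

lemma part_iff: "u \<in> part ab i \<longleftrightarrow>
    keys u \<subseteq> basis i \<and> (\<forall>p k. k \<in> keys (lookup u p) \<longrightarrow> total_sdeg p k = ab)"
proof -
  have "p \<in> keys u" if "k \<in> keys (lookup u p)" for p k
    using that by (metis in_keys_iff keys_zero empty_iff)
  moreover have "u \<in> part ab i \<longleftrightarrow>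
      keys u \<subseteq> basis i \<and> (\<forall>p\<in>keys u. \<forall>k\<in>keys (lookup u p). total_sdeg p k = ab)"
    by (simp only: FKh_part_def FKh_def grp_F_Kh free_module_simps total_sdeg_def case_prod_unfold
        prod.collapse mem_Collect_eq)
  ultimately show ?thesis by metis
qed

lemma partD: "u \<in> part ab i \<Longrightarrow> keys u \<subseteq> basis i" "u \<in> part ab i \<Longrightarrow> k \<in> keys (lookup u p) \<Longrightarrow> total_sdeg p k = ab"
  using part_iff by blast+

lemma part_zero: "0 \<in> part ab i"
  by (simp add: part_iff)

lemma part_add:
  assumes "u \<in> part ab i" "v \<in> part ab i"
  shows "u + v \<in> part ab i"
  unfolding part_iff
proof (intro conjI allI impI)
  show "keys (u + v) \<subseteq> basis i"
    by (rule subset_trans[OF Poly_Mapping.keys_add Un_least[OF partD(1)[OF assms(1)] partD(1)[OF assms(2)]]])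
  fix p k assume k: "k \<in> keys (lookup (u + v) p)"
  from subsetD[OF Poly_Mapping.keys_add k[unfolded lookup_add]]
  show "total_sdeg p k = ab" using partD(2) assms by blast
qed

lemma part_scale:
  assumes "k_homogeneous d r" "u \<in> part ab i"
  shows "scale r u \<in> part (d + ab) i"
  unfolding part_iff
proof (intro conjI allI impI)
  show "keys (scale r u) \<subseteq> basis i"
    by (rule subset_trans[OF keys_scale partD(1)[OF assms(2)]])
  fix p k assume "k \<in> keys (lookup (scale r u) p)"
  then obtain a b where ab: "a \<in> keys r" "b \<in> keys (lookup u p)" "k = a + b"
    by (rule keys_lookup_scale)
  have "mono_sdeg a = d" using assms(1) ab(1) by (simp add: k_homogeneous_def)
  then show "total_sdeg p k = d + ab"
    using partD(2)[OF assms(2) ab(2)] by (simp add: total_sdeg_def ab(3) mono_sdeg_add algebra_simps)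
qed

lemma part_scale_zpi: "u \<in> part ab i \<Longrightarrow> scale (zpi_to_k q) u \<in> part ab i"
  using part_scale[OF homogeneous_zpi_to_k] by fastforce

text \<open>The sign and the saddle together raise the degree by \<open>edge_sdeg\<close>, and the
  shift at the target vertex exceeds the one at the source by the same amount.\<close>

lemma part_diff:
  assumes "u \<in> part ab i"
  shows "lin_ext (d_basis id) u \<in> part ab (i + 1)"
  unfolding part_iff
proof (intro conjI allI impI)
  show "keys (lin_ext (d_basis id) u) \<subseteq> basis (i + 1)"
    by (rule keys_lin_ext_d_basis[OF partD(1)[OF assms]])
  fix y k assume "k \<in> keys (lookup (lin_ext (d_basis id) u) y)"
  then obtain p k1 k2 where p: "p \<in> keys u" "k1 \<in> keys (lookup u p)" "k2 \<in> keys (lookup (d_basis id p) y)" "k = k1 + k2"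
    by (rule keys_lookup_lin_ext)
  obtain \<xi> xs where pxi: "p = (\<xi>, xs)" by force
  have xs: "length xs = length (ord \<xi>)" using p(1) partD(1)[OF assms] by (auto simp: pxi basis_def)
  have "k2 \<in> keys (\<Sum>c | edge D \<xi> c. lookup (edge_map id \<xi> xs c) y)"
    using p(3) by (simp add: d_basis_def pxi lookup_sum)
  from subsetD[OF Poly_Mapping.keys_sum this]
  obtain c where c: "edge D \<xi> c" "k2 \<in> keys (lookup (edge_map id \<xi> xs c) y)" by blast
  from c(2)[unfolded edge_map_def] obtain ys a b
    where ys: "a \<in> keys (lookup (scale (id (\<epsilon> \<xi> c)) (F_word id (saddle D ord \<xi> c) xs)) ys)"
      "b \<in> keys (lookup (single (insert c \<xi>, ys) (1 :: kring)) y)" "k2 = a + b"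
    by (rule keys_lookup_lin_ext)
  from ys(2) have y: "y = (insert c \<xi>, ys)" "b = 0"
    by (auto simp: lookup_single when_def split: if_splits)
  from ys(1) obtain e f where ef: "e \<in> keys (\<epsilon> \<xi> c)" "f \<in> keys (lookup (F_word id (saddle D ord \<xi> c) xs) ys)" "a = e + f"
    unfolding id_apply by (rule keys_lookup_scale)
  have 1: "mono_sdeg f + basis_sdeg ys = basis_sdeg xs + wsdeg (saddle D ord \<xi> c)"
    by (rule F_word_sdeg[OF cob_saddle[OF c(1)] xs ef(2)])
  have 2: "edge_sdeg \<xi> c = mono_sdeg e + wsdeg (saddle D ord \<xi> c)"
    by (rule edge_keys_sdeg[OF c(1) ef(1), symmetric])
  have "total_sdeg y k = mono_sdeg k1 + mono_sdeg e + (mono_sdeg f + basis_sdeg ys)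
      - (vertex_sdeg D ord \<epsilon> \<xi> + edge_sdeg \<xi> c)"
    by (simp add: total_sdeg_def p(4) ys(3) y ef(3) mono_sdeg_add vertex_sdeg_insert[OF c(1)] add.assoc)
  also have "\<dots> = mono_sdeg k1 + basis_sdeg xs - vertex_sdeg D ord \<epsilon> \<xi>"
    unfolding 1 2 by simp
  also have "\<dots> = ab"
    using partD(2)[OF assms p(2)] by (simp add: total_sdeg_def pxi)
  finally show "total_sdeg y k = ab" .
qed

lemma diff_C_pi: "keys u \<subseteq> basis i \<Longrightarrow> diff C_pi i u = lin_ext (d_basis id) u"
  by (simp add: C_pi_simps diff_F_Kh[OF k_id.k_algebra_axioms])

lemma subcomplex_part: "subcomplex type_ring C_pi (part ab)"
  unfolding subcomplex_def
proof (intro conjI allI)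
  fix i
  interpret M: module "type_ring :: zpi ring" "grp C_pi i"
    using chain_complex_C_pi by (simp add: chain_complex_def)
  show "submodule (part ab i) type_ring (grp C_pi i)"
  proof (rule M.submoduleI)
    fix u assume u: "u \<in> part ab i"
    have minus: "- u \<in> part ab i"
      using part_scale_zpi[OF u, of "- 1"]
        comm_ring_map.map_uminus[OF comm_ring_map_zpi_to_k] comm_ring_map.map_one[OF comm_ring_map_zpi_to_k]
      by (simp add: scale_uminus)
    have "\<ominus>\<^bsub>grp C_pi i\<^esub> u = - u"
      by (rule M.minus_equality) (use u minus partD(1) in \<open>auto simp: C_pi_simps\<close>)
    then show "\<ominus>\<^bsub>grp C_pi i\<^esub> u \<in> part ab i" using minus by simp
  next
    show "part ab i \<subseteq> carrier (grp C_pi i)" unfolding C_pi_simps by (intro subsetI CollectI partD(1))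
  qed (simp_all add: C_pi_simps part_zero part_add part_scale_zpi)
  show "diff C_pi i \<in> part ab i \<rightarrow> part ab (i + 1)"
    using part_diff partD(1) diff_C_pi by auto
qed

abbreviation C_part :: "sdegree \<Rightarrow> (zpi, kring kh_chain) cplx" where
  "C_part ab \<equiv> restrict_cplx C_pi (part ab)"

lemma C_part_simps: "carrier (grp (C_part ab) i) = part ab i" "add (grp (C_part ab) i) = (+)"
  "\<zero>\<^bsub>grp (C_part ab) i\<^esub> = 0" "module.smult (grp (C_part ab) i) = (\<lambda>s. scale (zpi_to_k s))"
  "diff (C_part ab) = diff C_pi"
  by (simp_all add: restrict_cplx_def C_pi_simps(2-4))

section \<open>Homogeneous components and the direct sum\<close>

definition component :: "sdegree \<Rightarrow> kring kh_chain \<Rightarrow> kring kh_chain" where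
  "component ab u = Poly_Mapping.mapp (\<lambda>p. Poly_Mapping.mapp (\<lambda>k v. if total_sdeg p k = ab then v else 0)) u"

lemma lookup_component:
  "lookup (lookup (component ab u) p) k = (if total_sdeg p k = ab then lookup (lookup u p) k else 0)"
  by (auto simp: component_def Poly_Mapping.mapp.rep_eq when_def in_keys_iff)

lemma component_part: "keys u \<subseteq> basis i \<Longrightarrow> component ab u \<in> part ab i"
  unfolding part_iff
proof (intro conjI allI impI)
  assume "keys u \<subseteq> basis i"
  moreover have "keys (component ab u) \<subseteq> keys u"
    by (auto simp: component_def in_keys_iff Poly_Mapping.mapp.rep_eq)
  ultimately show "keys (component ab u) \<subseteq> basis i" by (rule subset_trans[rotated])
qed (auto simp: in_keys_iff lookup_component split: if_splits)

lemma finite_components: "finite {ab. component ab u \<noteq> 0}"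
proof (rule finite_subset)
  show "{ab. component ab u \<noteq> 0} \<subseteq> (\<Union>p\<in>keys u. total_sdeg p ` keys (lookup u p))"
  proof
    fix ab assume "ab \<in> {ab. component ab u \<noteq> 0}"
    then obtain p k where "lookup (lookup (component ab u) p) k \<noteq> 0"
      by (metis (mono_tags) mem_Collect_eq lookup_zero poly_mapping_eqI)
    then have pk: "total_sdeg p k = ab" "lookup (lookup u p) k \<noteq> 0" by (auto simp: lookup_component split: if_splits)
    then have "lookup u p \<noteq> 0" by auto
    then show "ab \<in> (\<Union>p\<in>keys u. total_sdeg p ` keys (lookup u p))"
      using pk by (intro UN_I[of p] image_eqI[of _ _ k]) (simp_all add: in_keys_iff)
  qed
qed simp

abbreviation "C_sum \<equiv> dsum_cplx C_part"

lemma C_sum_simps: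
  "carrier (grp C_sum i) = {f. (\<forall>ab. f ab \<in> part ab i) \<and> finite {ab. f ab \<noteq> 0}}"
  "x \<oplus>\<^bsub>grp C_sum i\<^esub> y = (\<lambda>ab. x ab + y ab)" "\<zero>\<^bsub>grp C_sum i\<^esub> = (\<lambda>ab. 0)"
  "s \<odot>\<^bsub>grp C_sum i\<^esub> x = (\<lambda>ab. scale (zpi_to_k s) (x ab))" "diff C_sum i x = (\<lambda>ab. diff C_pi i (x ab))"
  by (simp_all add: dsum_cplx_def dsum_module_def C_part_simps)

lemma C_sumD:
  assumes "f \<in> carrier (grp C_sum i)"
  shows "f ab \<in> part ab i" "finite {ab. f ab \<noteq> 0}" "keys (f ab) \<subseteq> basis i"
    "ab \<noteq> total_sdeg p k \<Longrightarrow> lookup (lookup (f ab) p) k = 0"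
proof -
  show f: "f ab \<in> part ab i" "finite {ab. f ab \<noteq> 0}" using assms by (simp_all add: C_sum_simps)
  show "keys (f ab) \<subseteq> basis i" by (rule partD(1)[OF f(1)])
  show "lookup (lookup (f ab) p) k = 0" if "ab \<noteq> total_sdeg p k"
    using partD(2)[OF f(1), of k p] that by (metis in_keys_iff)
qed

lemma sum_map_eq:
  assumes f: "f \<in> carrier (grp C_sum i)" and A: "finite A" "{ab. f ab \<noteq> 0} \<subseteq> A"
  shows "sum_map C_pi i f = (\<Sum>ab\<in>A. f ab)"
proof -
  interpret M: module "type_ring :: zpi ring" "grp C_pi i"
    using chain_complex_C_pi by (simp add: chain_complex_def)
  have "f \<in> {ab. f ab \<noteq> 0} \<rightarrow> carrier (grp C_pi i)"
    using C_sumD(3)[OF f] by (simp add: C_pi_simps)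
  then have "sum_map C_pi i f = (\<Sum>ab | f ab \<noteq> 0. f ab)"
    unfolding sum_map_def C_pi_simps(3) using f
    by (intro finsum_eq_sum M.abelian_group_axioms) (auto simp: C_pi_simps C_sum_simps)
  also have "\<dots> = (\<Sum>ab\<in>A. f ab)"
    using A by (intro sum.mono_neutral_left) auto
  finally show ?thesis .
qed

text \<open>Each monomial at a basis vector has exactly one total degree, so a single summand
  contributes to it. Injectivity and surjectivity of the summation map both reduce to this.\<close>

lemma lookup_sum_map:
  assumes f: "f \<in> carrier (grp C_sum i)"
  shows "lookup (lookup (sum_map C_pi i f) p) k = lookup (lookup (f (total_sdeg p k)) p) k"
proof -
  define A where "A = insert (total_sdeg p k) {ab. f ab \<noteq> 0}"
  have A: "finite A" "{ab. f ab \<noteq> 0} \<subseteq> A" using f by (auto simp: A_def C_sum_simps)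
  have "(\<Sum>ab\<in>A. lookup (lookup (f ab) p) k) = (\<Sum>ab\<in>{total_sdeg p k}. lookup (lookup (f ab) p) k)"
    using A C_sumD(4)[OF f] by (intro sum.mono_neutral_right) (auto simp: A_def)
  then show ?thesis by (simp add: sum_map_eq[OF f A] lookup_sum)
qed

lemma sum_map_part:
  assumes "f \<in> carrier (grp C_sum i)"
  shows "keys (sum_map C_pi i f) \<subseteq> basis i"
proof
  fix p assume "p \<in> keys (sum_map C_pi i f)"
  then obtain k where "lookup (lookup (sum_map C_pi i f) p) k \<noteq> 0"
    by (metis in_keys_iff lookup_zero poly_mapping_eqI)
  then have "lookup (f (total_sdeg p k)) p \<noteq> 0" unfolding lookup_sum_map[OF assms] by auto
  then show "p \<in> basis i"
    using C_sumD(3)[OF assms, of "total_sdeg p k"] by (metis in_keys_iff subsetD)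
qed

lemma decomposition: "chain_iso type_ring C_sum C_pi (sum_map C_pi)"
proof (rule chain_iso_transport[OF chain_complex_C_pi])
  fix i
  show "\<zero>\<^bsub>grp C_sum i\<^esub> \<in> carrier (grp C_sum i)" by (simp add: C_sum_simps part_zero)
  then show "sum_map C_pi i \<zero>\<^bsub>grp C_sum i\<^esub> = \<zero>\<^bsub>grp C_pi i\<^esub>"
    by (subst sum_map_eq[where A = "{}"]) (simp_all add: C_sum_simps(3) C_pi_simps(3))
  show "bij_betw (sum_map C_pi i) (carrier (grp C_sum i)) (carrier (grp C_pi i))"
  proof (rule bij_betw_imageI)
    show "inj_on (sum_map C_pi i) (carrier (grp C_sum i))"
    proof (rule inj_onI)
      fix f g assume fg: "f \<in> carrier (grp C_sum i)" "g \<in> carrier (grp C_sum i)" "sum_map C_pi i f = sum_map C_pi i g"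
      have "lookup (lookup (f ab) p) k = lookup (lookup (g ab) p) k" for ab p k
      proof (cases "total_sdeg p k = ab")
        case True
        then show ?thesis using lookup_sum_map[OF fg(1), of p k] lookup_sum_map[OF fg(2), of p k] fg(3) by simp
      next
        case False
        then show ?thesis using C_sumD(4)[OF fg(1)] C_sumD(4)[OF fg(2)] by metis
      qed
      then show "f = g" by (intro ext poly_mapping2_eqI)
    qed
    show "sum_map C_pi i ` carrier (grp C_sum i) = carrier (grp C_pi i)"
    proof (intro equalityI subsetI)
      fix u assume "u \<in> sum_map C_pi i ` carrier (grp C_sum i)"
      then show "u \<in> carrier (grp C_pi i)" using sum_map_part unfolding C_pi_simps(1) by blast
    next
      fix u assume "u \<in> carrier (grp C_pi i)"
      \<comment> \<open>The family of components is the preimage of \<open>u\<close>; it is finitely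
        supported because \<open>u\<close> involves finitely many monomials.\<close>
      then have f: "(\<lambda>ab. component ab u) \<in> carrier (grp C_sum i)"
        by (simp add: C_sum_simps C_pi_simps component_part finite_components)
      have "u = sum_map C_pi i (\<lambda>ab. component ab u)"
        by (rule poly_mapping2_eqI) (simp add: lookup_sum_map[OF f] lookup_component)
      then show "u \<in> sum_map C_pi i ` carrier (grp C_sum i)" using f by (rule image_eqI)
    qed
  qed
  fix f assume f: "f \<in> carrier (grp C_sum i)"
  let ?S = "{ab. f ab \<noteq> 0}"
  have S: "finite ?S" "?S \<subseteq> ?S" using f by (simp_all add: C_sum_simps)
  note fk = C_sumD(3)[OF f]
  have "{ab. diff C_pi i (f ab) \<noteq> 0} \<subseteq> ?S" using diff_C_pi[OF fk] by auto
  moreover from this have df: "diff C_sum i f \<in> carrier (grp C_sum (i + 1))"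
    using f part_diff S(1) finite_subset by (auto simp: C_sum_simps diff_C_pi[OF fk])
  ultimately have "sum_map C_pi (i + 1) (diff C_sum i f) = (\<Sum>ab\<in>?S. lin_ext (d_basis id) (f ab))"
    by (subst sum_map_eq[OF df S(1)]) (simp_all add: C_sum_simps(5) diff_C_pi[OF fk])
  moreover have "diff C_pi i (sum_map C_pi i f) = lin_ext (d_basis id) (sum_map C_pi i f)"
    by (rule diff_C_pi[OF sum_map_part[OF f]])
  ultimately show "diff C_sum i f \<in> carrier (grp C_sum (i + 1)) \<and>
    sum_map C_pi (i + 1) (diff C_sum i f) = diff C_pi i (sum_map C_pi i f)"
    using df by (simp add: sum_map_eq[OF f S] lin_ext_sum)
  show "s \<odot>\<^bsub>grp C_sum i\<^esub> f \<in> carrier (grp C_sum i) \<and>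
    sum_map C_pi i (s \<odot>\<^bsub>grp C_sum i\<^esub> f) = s \<odot>\<^bsub>grp C_pi i\<^esub> sum_map C_pi i f" for s
  proof -
    have sub: "{ab. scale (zpi_to_k s) (f ab) \<noteq> 0} \<subseteq> ?S" by auto
    then have sf: "s \<odot>\<^bsub>grp C_sum i\<^esub> f \<in> carrier (grp C_sum i)"
      using f part_scale_zpi S(1) finite_subset by (auto simp: C_sum_simps)
    have "sum_map C_pi i (s \<odot>\<^bsub>grp C_sum i\<^esub> f) = (\<Sum>ab\<in>?S. scale (zpi_to_k s) (f ab))"
      using sub by (subst sum_map_eq[OF sf S(1)]) (simp_all add: C_sum_simps(4))
    then show ?thesis using sf by (simp add: C_pi_simps(4) sum_map_eq[OF f S] scale_sum)
  qed
  fix g assume g: "g \<in> carrier (grp C_sum i)"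
  have "{ab. f ab + g ab \<noteq> 0} \<subseteq> ?S \<union> {ab. g ab \<noteq> 0}" by auto
  moreover have "finite (?S \<union> {ab. g ab \<noteq> 0})" using f g by (simp add: C_sum_simps)
  ultimately have fg: "f \<oplus>\<^bsub>grp C_sum i\<^esub> g \<in> carrier (grp C_sum i)"
    using f g part_add finite_subset by (simp add: C_sum_simps) blast
  have "sum_map C_pi i (f \<oplus>\<^bsub>grp C_sum i\<^esub> g) = sum_map C_pi i f + sum_map C_pi i g"
    by (rule poly_mapping2_eqI)
      (simp only: lookup_add lookup_sum_map[OF f] lookup_sum_map[OF g] lookup_sum_map[OF fg],
        simp only: C_sum_simps(2) lookup_add)
  then show "f \<oplus>\<^bsub>grp C_sum i\<^esub> g \<in> carrier (grp C_sum i) \<and>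
    sum_map C_pi i (f \<oplus>\<^bsub>grp C_sum i\<^esub> g) = sum_map C_pi i f \<oplus>\<^bsub>grp C_pi i\<^esub> sum_map C_pi i g"
    using fg by (simp add: C_pi_simps(2))
qed

text \<open>Within one splitting degree a coefficient is determined by its image under
  \<open>X, Z \<mapsto> 1\<close>, \<open>Y \<mapsto> \<pi>\<close>.\<close>

lemma part_iso: "chain_iso type_ring (C_part ab) (F_pi_Kh_pi D ord \<epsilon>) (\<lambda>i. Poly_Mapping.map k_to_zpi)"
proof (rule chain_iso_transport[OF chain_complex_F_pi])
  interpret to_zpi: k_algebra k_to_zpi by (intro k_algebra.intro comm_ring_map_k_to_zpi)
  interpret of_zpi: comm_ring_map zpi_to_k by (rule comm_ring_map_zpi_to_k)
  have F: "carrier (grp (F_pi_Kh_pi D ord \<epsilon>) i) = {v. keys v \<subseteq> basis i}" "add (grp (F_pi_Kh_pi D ord \<epsilon>) i) = (+)"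
    "module.smult (grp (F_pi_Kh_pi D ord \<epsilon>) i) = scale" "\<zero>\<^bsub>grp (F_pi_Kh_pi D ord \<epsilon>) i\<^esub> = 0" for i
    by (simp_all add: F_pi_Kh_pi_def grp_F_Kh free_module_simps)
  fix i
  \<comment> \<open>The degree a coefficient at \<open>p\<close> must have for its total degree to
    be \<open>ab\<close>.\<close>
  define \<delta> where "\<delta> = (\<lambda>p. ab - basis_sdeg (snd p) + vertex_sdeg D ord \<epsilon> (fst p))"
  have \<delta>: "total_sdeg p k = ab \<longleftrightarrow> mono_sdeg k = \<delta> p" for p k
    unfolding total_sdeg_def \<delta>_def by (metis (no_types, opaque_lifting) add_diff_cancel_right' diff_add_cancel diff_add_eq)
  have recover: "lookup u p = zpi_to_k (k_to_zpi (lookup u p)) * k_shift (\<delta> p)" if "u \<in> part ab i" for u p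
    by (rule homogeneous_recover) (use partD(2)[OF that] \<delta> in \<open>simp add: k_homogeneous_def\<close>)
  show "bij_betw (Poly_Mapping.map k_to_zpi) (carrier (grp (C_part ab) i)) (carrier (grp (F_pi_Kh_pi D ord \<epsilon>) i))"
    unfolding C_part_simps F
  proof (rule bij_betw_imageI)
    show "inj_on (Poly_Mapping.map k_to_zpi) (part ab i)"
    proof (rule inj_onI)
      fix u v assume uv: "u \<in> part ab i" "v \<in> part ab i" "Poly_Mapping.map k_to_zpi u = Poly_Mapping.map k_to_zpi v"
      have "k_to_zpi (lookup u p) = k_to_zpi (lookup v p)" for p
        using arg_cong[OF uv(3), of "\<lambda>w. lookup w p"] by (simp add: to_zpi.lookup_map)
      then show "u = v" using recover uv(1,2) by (metis poly_mapping_eqI)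
    qed
    show "Poly_Mapping.map k_to_zpi ` part ab i = {v. keys v \<subseteq> basis i}"
    proof (intro equalityI subsetI)
      fix v assume "v \<in> Poly_Mapping.map k_to_zpi ` part ab i"
      then obtain u where "u \<in> part ab i" "v = Poly_Mapping.map k_to_zpi u" by blast
      then show "v \<in> {v. keys v \<subseteq> basis i}" using subset_trans[OF to_zpi.keys_map_poly partD(1)] by simp
    next
      fix v :: "zpi kh_chain" assume "v \<in> {v. keys v \<subseteq> basis i}"
      then have v: "keys v \<subseteq> basis i" by simp
      \<comment> \<open>The degree zero lift of each coefficient is moved into degree
        \<open>\<delta> p\<close> by a monomial that becomes 1 under
        \<open>k_to_zpi\<close>.\<close>
      define u where "u = Poly_Mapping.mapp (\<lambda>p q. zpi_to_k q * k_shift (\<delta> p)) v"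
      have lu: "lookup u p = zpi_to_k (lookup v p) * k_shift (\<delta> p)" for p
        by (simp add: u_def Poly_Mapping.mapp.rep_eq when_def in_keys_iff of_zpi.map_zero)
      have "u \<in> part ab i"
        unfolding part_iff
      proof (intro conjI allI impI)
        have "keys u \<subseteq> keys v"
          unfolding subset_iff in_keys_iff lu using of_zpi.map_zero by auto
        then show "keys u \<subseteq> basis i" using v by (rule subset_trans)
        fix p k assume "k \<in> keys (lookup u p)"
        moreover have "k_homogeneous (\<delta> p) (lookup u p)"
          unfolding lu using homogeneous_mult[OF homogeneous_zpi_to_k k_shift_simps(1)] by simp
        ultimately show "total_sdeg p k = ab" by (simp add: \<delta> k_homogeneous_def)
      qed
      moreover have "v = Poly_Mapping.map k_to_zpi u"
        by (rule poly_mapping_eqI) (simp add: to_zpi.lookup_map lu to_zpi.map_mult k_shift_simps)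
      ultimately show "v \<in> Poly_Mapping.map k_to_zpi ` part ab i" by (rule rev_image_eqI)
    qed
  qed
  show "\<zero>\<^bsub>grp (C_part ab) i\<^esub> \<in> carrier (grp (C_part ab) i)"
    "Poly_Mapping.map k_to_zpi \<zero>\<^bsub>grp (C_part ab) i\<^esub> = \<zero>\<^bsub>grp (F_pi_Kh_pi D ord \<epsilon>) i\<^esub>"
    by (simp_all add: C_part_simps F part_zero)
  fix u assume "u \<in> carrier (grp (C_part ab) i)"
  then have u: "u \<in> part ab i" by (simp add: C_part_simps)
  show "s \<odot>\<^bsub>grp (C_part ab) i\<^esub> u \<in> carrier (grp (C_part ab) i) \<and>
    Poly_Mapping.map k_to_zpi (s \<odot>\<^bsub>grp (C_part ab) i\<^esub> u) = s \<odot>\<^bsub>grp (F_pi_Kh_pi D ord \<epsilon>) i\<^esub> Poly_Mapping.map k_to_zpi u" for s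
    using part_scale_zpi[OF u] by (simp add: C_part_simps F to_zpi.map_poly_scale)
  have mu: "keys (Poly_Mapping.map k_to_zpi u) \<subseteq> basis i"
    by (rule subset_trans[OF to_zpi.keys_map_poly partD(1)[OF u]])
  show "diff (C_part ab) i u \<in> carrier (grp (C_part ab) (i + 1)) \<and>
    Poly_Mapping.map k_to_zpi (diff (C_part ab) i u) = diff (F_pi_Kh_pi D ord \<epsilon>) i (Poly_Mapping.map k_to_zpi u)"
    using part_diff[OF u] diff_F_Kh[OF to_zpi.k_algebra_axioms mu]
    by (simp add: C_part_simps diff_C_pi[OF partD(1)[OF u]] F_pi_Kh_pi_def map_d_basis[OF to_zpi.k_algebra_axioms])
  fix v assume "v \<in> carrier (grp (C_part ab) i)"
  then show "u \<oplus>\<^bsub>grp (C_part ab) i\<^esub> v \<in> carrier (grp (C_part ab) i) \<and>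
    Poly_Mapping.map k_to_zpi (u \<oplus>\<^bsub>grp (C_part ab) i\<^esub> v)
      = Poly_Mapping.map k_to_zpi u \<oplus>\<^bsub>grp (F_pi_Kh_pi D ord \<epsilon>) i\<^esub> Poly_Mapping.map k_to_zpi v"
    using part_add[OF u] by (simp add: C_part_simps F to_zpi.map_poly_add)
qed

lemma part_generators:
  assumes "u \<in> part (a, b) i"
  shows "scale Xk u \<in> part (a + 1, b) i" "scale Yk u \<in> part (a + 1, b) i" "scale Zk u \<in> part (a, b - 1) i"
proof -
  have "(1, 0) + (a, b) = (a + 1, b)" "(0, - 1) + (a, b) = (a, b - 1)"
    by (simp_all only: add_Pair add_0 add.commute[of 1] uminus_add_conv_diff)
  then show "scale Xk u \<in> part (a + 1, b) i" "scale Yk u \<in> part (a + 1, b) i" "scale Zk u \<in> part (a, b - 1) i"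
    using part_scale[OF homogeneous_generators(1) assms] part_scale[OF homogeneous_generators(2) assms]
      part_scale[OF homogeneous_generators(3) assms] by (simp_all only:)
qed

end

theorem theorem5p4:
  fixes D :: diagram
    and ord :: "nat set \<Rightarrow> circle list"
    and \<psi> :: "nat set \<Rightarrow> nat \<Rightarrow> nat \<Rightarrow> kring"
    and \<epsilon> :: "nat set \<Rightarrow> nat \<Rightarrow> kring"
  assumes "link_diagram D"
    and "circle_order D ord"
    and "commutation_cocycle D ord \<psi>"
    and "sign_assignment D \<psi> \<epsilon>"
  shows "let R = (ring_of_type_algebra :: zpi ring);
             C = scalars_cplx zpi_to_k (FKh D ord \<epsilon>);
             P = FKh_part D ord \<epsilon>;
             T = tensor_cplx k_to_zpi (FKh D ord \<epsilon>)
         in (\<forall>ab. subcomplex R C (P ab)) \<and>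
            chain_iso R (dsum_cplx (\<lambda>ab. restrict_cplx C (P ab))) C (sum_map C) \<and>
            (\<exists>\<Psi>. chain_iso R T (F_pi_Kh_pi D ord \<epsilon>) \<Psi>) \<and>
            (\<exists>\<Phi>. (\<forall>ab. chain_iso R (restrict_cplx C (P ab)) T (\<Phi> ab)) \<and>
              (\<forall>a b i. \<forall>u\<in>P (a, b) i.
                 Xk \<odot>\<^bsub>grp (FKh D ord \<epsilon>) i\<^esub> u \<in> P (a + 1, b) i \<and>
                 \<Phi> (a + 1, b) i (Xk \<odot>\<^bsub>grp (FKh D ord \<epsilon>) i\<^esub> u) = \<Phi> (a, b) i u \<and>
                 Yk \<odot>\<^bsub>grp (FKh D ord \<epsilon>) i\<^esub> u \<in> P (a + 1, b) i \<and>
                 \<Phi> (a + 1, b) i (Yk \<odot>\<^bsub>grp (FKh D ord \<epsilon>) i\<^esub> u)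
                   = pi_elt \<odot>\<^bsub>grp T i\<^esub> \<Phi> (a, b) i u \<and>
                 Zk \<odot>\<^bsub>grp (FKh D ord \<epsilon>) i\<^esub> u \<in> P (a, b - 1) i \<and>
                 \<Phi> (a, b - 1) i (Zk \<odot>\<^bsub>grp (FKh D ord \<epsilon>) i\<^esub> u) = \<Phi> (a, b) i u))"
proof -
  interpret cube D ord \<psi> \<epsilon> by unfold_locales (fact assms)+
  interpret to_zpi: k_algebra k_to_zpi by (intro k_algebra.intro comm_ring_map_k_to_zpi)
  let ?T = "tensor_cplx k_to_zpi (FKh D ord \<epsilon>)" and ?F = "F_pi_Kh_pi D ord \<epsilon>"
  obtain \<Psi> where \<Psi>: "chain_iso type_ring ?T ?F \<Psi>" using tensor_iso by blast
  \<comment> \<open>The formula does not depend on the degree, so vectors in different parts with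
    the same specialized coefficients have the same image.\<close>
  define \<Phi> where "\<Phi> = (\<lambda>i u. inv_into (carrier (grp ?T i)) (\<Psi> i) (Poly_Mapping.map k_to_zpi u))"
  have \<Phi>: "chain_iso type_ring (C_part ab) ?T \<Phi>" for ab
    unfolding \<Phi>_def by (rule chain_iso_inv_comp[OF part_iso \<Psi>])
  have smult: "module.smult (grp (FKh D ord \<epsilon>) i) = scale" for i
    by (simp add: FKh_def grp_F_Kh free_module_simps)
  have XZ: "\<Phi> i (scale Xk u) = \<Phi> i u" "\<Phi> i (scale Zk u) = \<Phi> i u" for i u
    by (simp_all add: \<Phi>_def to_zpi.map_poly_scale)
  have Y: "\<Phi> i (scale Yk u) = pi_elt \<odot>\<^bsub>grp ?T i\<^esub> \<Phi> i u" if u: "u \<in> part ab i" for i u ab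
  proof -
    \<comment> \<open>Y and XY have the same image under \<open>k_to_zpi\<close>, and multiplication
      by XY is the action of \<open>pi_elt\<close>, over which \<open>\<Phi>\<close> is
      linear.\<close>
    have "\<Phi> i (scale Yk u) = \<Phi> i (scale (zpi_to_k pi_elt) u)"
      by (simp add: \<Phi>_def to_zpi.map_poly_scale)
    also have "\<dots> = pi_elt \<odot>\<^bsub>grp ?T i\<^esub> \<Phi> i u"
      using \<Phi>[of ab] u by (auto simp: chain_iso_def lin_map_def C_part_simps)
    finally show ?thesis .
  qed
  show ?thesis
    unfolding Let_def
    by (intro conjI exI[of _ "\<lambda>_. \<Phi>"] allI ballI subcomplex_part decomposition tensor_iso \<Phi>)
      (simp_all only: smult XZ Y part_generators)
qed

end
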